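(* Let $N=\binom{n}{2}$, let $e_1,\dots,e_N$ be a uniformly random permutation of the edges of $K_n$, and for $0\le m\le N$ let $\mathcal{G}(n,m)=([n],\{e_1,\dots,e_m\})$ (the Erd\H{o}s--R\'enyi random graph process). Let $$M=\min\{m : \mathcal{G}(n,m)\text{ is connected}\}.$$ Then asymptotically almost surely (i.e. with probability tending to $1$ as $n\to\infty$) $$a_f(\mathcal{G}(n,M)) = a_u(\mathcal{G}(n,M)) = 1.$$
   Context: Acquisition numbers: Let $G$ be a graph in which every vertex initially has weight $1$. A unit acquisition move transfers one unit of weight from a vertex $u$ to a neighbouring vertex $v$, provided that immediately prior to the move the weight on $v$ is at least the weight on $u$. A fractional acquisition move transfers an arbitrary positive (possibly non-integer) amount of weight, not exceeding the current weight of $u$, from a vertex $u$ to a neighbouring vertex $v$, provided that immediately prior to the move the weight on $v$ is at least the weight on $u$. An acquisition protocol is a maximal sequence of such moves (until no move of that type remains possible); the set of vertices with positive weight at the end is a residual set. The unit acquisition number $a_u(G)$ (resp. fractional acquisition number $a_f(G)$) is the minimum possible size of a residual set over all acquisition protocols using unit (resp. fractional) acquisition moves. *)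

theory Defs
  imports "HOL-Probability.Probability" "HOL-Combinatorics.Multiset_Permutations"
begin

text \<open>Graphs: vertex set {0..<n}, edge set E a set of 2-element vertex sets.\<close>

definition Kn_edges :: "nat \<Rightarrow> nat set set" where
  "Kn_edges n = {{u, v} | u v. u < n \<and> v < n \<and> u \<noteq> v}"

definition graph_connected :: "nat \<Rightarrow> nat set set \<Rightarrow> bool" where
  "graph_connected n E \<longleftrightarrow>
     (\<forall>u<n. \<forall>v<n. (u, v) \<in> {(x, y). {x, y} \<in> E}\<^sup>*)"

text \<open>Unit acquisition move (weights are natural numbers).\<close>
definition unit_move :: "nat set set \<Rightarrow> (nat \<Rightarrow> nat) \<Rightarrow> (nat \<Rightarrow> nat) \<Rightarrow> bool" where
  "unit_move E w w' \<longleftrightarrow>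
     (\<exists>u v. {u, v} \<in> E \<and> u \<noteq> v \<and> 1 \<le> w u \<and> w u \<le> w v \<and>
            w' = w(u := w u - 1, v := w v + 1))"

text \<open>Fractional acquisition move (weights are nonnegative reals).\<close>
definition frac_move :: "nat set set \<Rightarrow> (nat \<Rightarrow> real) \<Rightarrow> (nat \<Rightarrow> real) \<Rightarrow> bool" where
  "frac_move E w w' \<longleftrightarrow>
     (\<exists>u v x. {u, v} \<in> E \<and> u \<noteq> v \<and> 0 < x \<and> x \<le> w u \<and> w u \<le> w v \<and>
            w' = w(u := w u - x, v := w v + x))"

text \<open>Acquisition numbers: minimum size of a residual set, i.e. of the positive-weight
  vertex set of a configuration reached from the all-ones configuration by a (finite)
  sequence of moves after which no move is possible.\<close>
definition unit_acq_number :: "nat \<Rightarrow> nat set set \<Rightarrow> nat" where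
  "unit_acq_number n E = Inf {card {v. v < n \<and> 0 < w v} | w.
      (unit_move E)\<^sup>*\<^sup>* (\<lambda>v. if v < n then 1 else 0) w \<and> \<not> (\<exists>w'. unit_move E w w')}"

definition frac_acq_number :: "nat \<Rightarrow> nat set set \<Rightarrow> nat" where
  "frac_acq_number n E = Inf {card {v. v < n \<and> 0 < w v} | w.
      (frac_move E)\<^sup>*\<^sup>* (\<lambda>v. if v < n then 1 else 0) w \<and> \<not> (\<exists>w'. frac_move E w w')}"

text \<open>Random graph process: a uniformly random ordering of the edges of K_n.\<close>
definition edge_orderings :: "nat \<Rightarrow> nat set list set" where
  "edge_orderings n = permutations_of_set (Kn_edges n)"

definition process_graph :: "nat set list \<Rightarrow> nat \<Rightarrow> nat set set" where
  "process_graph \<sigma> m = set (take m \<sigma>)"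

definition connectivity_time :: "nat \<Rightarrow> nat set list \<Rightarrow> nat" where
  "connectivity_time n \<sigma> = (LEAST m. graph_connected n (process_graph \<sigma> m))"

end

(*
  A protocol that brings all weight to one vertex remains available when edges are added, and it shows at
  once that both acquisition numbers are 1. Unit moves collect the weight of a rooted tree at its root as
  soon as the weights increase strictly towards the root (leaves may tie with their parents): the weight
  passes up unit by unit, outermost vertices first.

  Such weights are obtained by spending neighbours. Shortly before the graph becomes connected, almost all
  vertices have many neighbours in a small part {0..<q} of the vertex set and in its complement. On the good
  vertices of the small part, expansion gives a spanning tree of depth O(ln n / ln ln n) in which only
  O(n / ln n) vertices need a weight above 3. By Hall's theorem every tree vertex receives its own set of
  neighbours in the complement, large enough to raise its weight to the required value. All
  remaining good vertices hang off the tree. The poor vertices are so sparse that each of them, isolated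
  ones excepted, hangs off a good vertex that is not spent.

  The edges that arrive until the graph is connected attach the few isolated vertices to good vertices, no
  two of them to the same star. All probabilities are first moment bounds for uniformly random edge sets,
  except that isolated vertices exist before the connectivity time, which is a second moment bound.
*)
theory Submission
  imports Defs "HOL-Real_Asymp.Real_Asymp"
begin

section \<open>Collecting weight along a rooted tree\<close>

text \<open>The obstacle is the supply of star leaves. Weights of the order of the tree depth at
  every tree vertex would demand about \<open>q * ln n / ln (ln n)\<close> leaves, more than there
  are vertices. Hence weights 2 and 3 are used wherever the tree permits, with stars of at most 3q =
  3n/10 leaves in total, and the O(n / ln n) high vertices together demand only O(n / ln ln n). Each
  single demand stays far below the degrees, which are of order ln n. The split at \<open>q\<close>
  keeps centres and leaves apart, so that all stars can be spent before any weight travels. The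
  connectivity time is random and its graph is not uniform. Therefore two rounds are revealed: tree
  and stars depend on the first round only, and the second round is shown to serve all intermediate
  graphs without isolated vertices at once. The first round has to leave at most n^0.03 isolated
  vertices: each may be joined to one of up to n^0.95 poor vertices, with probability of order ln n
  / n for each such pair, and this must sum to o(1).\<close>

definition collects_all :: "nat \<Rightarrow> nat set set \<Rightarrow> bool" where
  "collects_all n E \<longleftrightarrow>
     (\<exists>w r. (unit_move E)\<^sup>*\<^sup>* (\<lambda>v. if v < n then 1 else 0) w \<and> (\<forall>v. v \<noteq> r \<longrightarrow> w v = 0))"

lemma collects_all_mono:
  assumes "collects_all n E" "E \<subseteq> E'"
  shows "collects_all n E'"
proof -
  have "unit_move E \<le> unit_move E'"
    using assms(2) unfolding unit_move_def by blast
  hence "(unit_move E)\<^sup>*\<^sup>* \<le> (unit_move E')\<^sup>*\<^sup>*"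
    by (rule rtranclp_mono)
  thus ?thesis
    using assms(1) unfolding collects_all_def by blast
qed

lemma sum_move:
  fixes w :: "nat \<Rightarrow> 'a::ab_group_add"
  assumes "finite V" "u \<in> V" "v \<in> V" "u \<noteq> v"
  shows "sum (w(u := w u - x, v := w v + x)) V = sum w V"
proof -
  have *: "sum g V = g u + (g v + sum g (V - {u} - {v}))" for g :: "nat \<Rightarrow> 'a"
    using assms sum.remove[of V u g] sum.remove[of "V - {u}" v g] by simp
  have "sum (w(u := w u - x, v := w v + x)) (V - {u} - {v}) = sum w (V - {u} - {v})"
    by (rule sum.cong) auto
  thus ?thesis
    using assms(4) *[of w] *[of "w(u := w u - x, v := w v + x)"] by (simp add: algebra_simps)
qed

lemma Kn_edges_endpoints:
  assumes "{u, v} \<in> E" "E \<subseteq> Kn_edges n"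
  shows "u < n" "v < n" "u \<noteq> v"
proof -
  obtain a b where "{u, v} = {a, b}" "a < n" "b < n" "a \<noteq> b"
    using assms unfolding Kn_edges_def by blast
  thus "u < n" "v < n" "u \<noteq> v"
    by (auto simp: doubleton_eq_iff)
qed

lemma frac_move_sum:
  assumes "(frac_move E)\<^sup>*\<^sup>* w w'" "E \<subseteq> Kn_edges n"
  shows "sum w' {..<n} = sum w {..<n}"
  using assms(1)
proof induction
  case (step y z)
  have "frac_move E y z"
    by (rule step.hyps(2))
  then obtain u v x where uv: "{u, v} \<in> E" and z: "z = y(u := y u - x, v := y v + x)"
    unfolding frac_move_def by (elim exE conjE) (rule that)
  have "u < n" "v < n" "u \<noteq> v"
    by (rule Kn_edges_endpoints[OF uv assms(2)])+
  hence "sum z {..<n} = sum y {..<n}"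
    unfolding z by (intro sum_move) auto
  thus ?case
    using step.IH by simp
qed simp

lemma unit_move_imp_frac_move:
  assumes "unit_move E w w'"
  shows "frac_move E (\<lambda>v. real (w v)) (\<lambda>v. real (w' v))"
proof -
  obtain u v where "{u, v} \<in> E" "u \<noteq> v" "1 \<le> w u" "w u \<le> w v"
    "w' = w(u := w u - 1, v := w v + 1)"
    using assms unfolding unit_move_def by blast
  thus ?thesis
    unfolding frac_move_def
    by (intro exI[of _ u] exI[of _ v] exI[of _ "1::real"]) (auto simp: fun_eq_iff)
qed

lemma unit_moves_imp_frac_moves:
  assumes "(unit_move E)\<^sup>*\<^sup>* w w'"
  shows "(frac_move E)\<^sup>*\<^sup>* (\<lambda>v. real (w v)) (\<lambda>v. real (w' v))"
  using assms
proof induction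
  case (step y z)
  thus ?case
    using unit_move_imp_frac_move[OF step.hyps(2)] by (rule_tac rtranclp.rtrancl_into_rtrancl)
qed simp

lemma frac_moves_residual_nonempty:
  assumes "(frac_move E)\<^sup>*\<^sup>* (\<lambda>v. if v < n then 1 else 0) w" "E \<subseteq> Kn_edges n" "n > 0"
  shows "card {v. v < n \<and> 0 < w v} \<ge> 1"
proof -
  have "sum w {..<n} = real n"
    using frac_move_sum[OF assms(1,2)] by simp
  hence "\<exists>v<n. 0 < w v"
    using assms(3) by (metis lessThan_iff not_less of_nat_0_less_iff sum_nonpos)
  hence "{v. v < n \<and> 0 < w v} \<noteq> {}"
    by blast
  thus ?thesis
    by (simp add: Suc_le_eq card_gt_0_iff)
qed

lemma unit_moves_residual_nonempty:
  assumes "(unit_move E)\<^sup>*\<^sup>* (\<lambda>v. if v < n then 1 else 0) w" "E \<subseteq> Kn_edges n" "n > 0"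
  shows "card {v. v < n \<and> 0 < w v} \<ge> 1"
proof -
  have "(\<lambda>v. real (if v < n then 1 else 0)) = (\<lambda>v. if v < n then 1 else 0)"
    by auto
  hence "(frac_move E)\<^sup>*\<^sup>* (\<lambda>v. if v < n then 1 else 0) (\<lambda>v. real (w v))"
    using unit_moves_imp_frac_moves[OF assms(1)] by simp
  from frac_moves_residual_nonempty[OF this assms(2,3)] show ?thesis
    by simp
qed

lemma Inf_nat_eq_1:
  fixes A :: "nat set"
  assumes "1 \<in> A" "\<And>x. x \<in> A \<Longrightarrow> 1 \<le> x"
  shows "Inf A = 1"
  using assms by (intro cInf_eq_minimum) auto

text \<open>A configuration supported on one vertex is terminal: in a move both ends carry positive
  weight, and they differ. So the one reached by unit moves serves both numbers; conservation of the
  total weight excludes an empty residual set.\<close>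

lemma acq_numbers_eq_1:
  assumes "collects_all n E" "E \<subseteq> Kn_edges n" "n > 0"
  shows "unit_acq_number n E = 1" "frac_acq_number n E = 1"
proof -
  obtain w r where w: "(unit_move E)\<^sup>*\<^sup>* (\<lambda>v. if v < n then 1 else 0) w"
    and r: "\<And>v. v \<noteq> r \<Longrightarrow> w v = 0"
    using assms(1) unfolding collects_all_def by blast
  have "(\<lambda>v. real (if v < n then 1 else 0)) = (\<lambda>v. if v < n then 1 else 0)"
    by auto
  hence fw: "(frac_move E)\<^sup>*\<^sup>* (\<lambda>v. if v < n then 1 else 0) (\<lambda>v. real (w v))"
    using unit_moves_imp_frac_moves[OF w] by simp
  have "{v. v < n \<and> 0 < w v} \<subseteq> {r}"
    using r by force
  hence "card {v. v < n \<and> 0 < w v} \<le> 1"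
    using card_mono[of "{r}"] by fastforce
  hence one: "1 = card {v. v < n \<and> 0 < w v}" "1 = card {v. v < n \<and> 0 < real (w v)}"
    using unit_moves_residual_nonempty[OF w assms(2,3)] by simp_all
  have ustuck: "\<not> (\<exists>w'. unit_move E w w')"
    unfolding unit_move_def using r by (metis not_one_le_zero le_0_eq)
  have fstuck: "\<not> (\<exists>w'. frac_move E (\<lambda>v. real (w v)) w')"
    unfolding frac_move_def using r by (metis leD of_nat_0 order.trans)
  show "unit_acq_number n E = 1"
    unfolding unit_acq_number_def
    using w one(1) ustuck unit_moves_residual_nonempty[OF _ assms(2,3)]
    by (intro Inf_nat_eq_1) auto
  show "frac_acq_number n E = 1"
    unfolding frac_acq_number_def
  proof (rule Inf_nat_eq_1)
    show "1 \<in> {card {v. v < n \<and> 0 < w v} |w.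
        (frac_move E)\<^sup>*\<^sup>* (\<lambda>v. if v < n then 1 else 0) w \<and> \<not> (\<exists>w'. frac_move E w w')}"
      using fw one(2) fstuck by (intro CollectI exI[of _ "\<lambda>v. real (w v)"] conjI)
  qed (use frac_moves_residual_nonempty[OF _ assms(2,3)] in blast)
qed

lemma unit_moveI:
  assumes "{u, v} \<in> E" "u \<noteq> v" "1 \<le> w u" "w u \<le> w v" "w' = w(u := w u - 1, v := w v + 1)"
  shows "unit_move E w w'"
  using assms unfolding unit_move_def by blast

text \<open>One extra unit can be passed along a path towards the root if the weights increase strictly along it,
  because the move \<open>u \<rightarrow> par u\<close> needs \<open>w u + 1 \<le> w (par u)\<close>.\<close>

lemma carry_to_root:
  fixes w :: "nat \<Rightarrow> nat" and rk :: "nat \<Rightarrow> nat"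
  assumes rank: "\<And>v. v \<noteq> r \<Longrightarrow> w v > 0 \<Longrightarrow> rk (par v) < rk v"
    and edge: "\<And>v. v \<noteq> r \<Longrightarrow> w v > 0 \<Longrightarrow> {v, par v} \<in> E"
    and slack: "\<And>x. x \<noteq> r \<Longrightarrow> w x > 0 \<Longrightarrow> par x \<noteq> r \<Longrightarrow> w (par x) < w (par (par x))"
    and "u = r \<or> 0 < w u \<and> w u < w (par u)"
  shows "(unit_move E)\<^sup>*\<^sup>* (w(u := w u + 1)) (w(r := w r + 1))"
  using assms(4)
proof (induction "rk u" arbitrary: u rule: less_induct)
  case less
  show ?case
  proof (cases "u = r")
    case False
    hence u: "0 < w u" "w u < w (par u)"
      using less.prems by auto
    have ne: "par u \<noteq> u"
      using rank[OF False u(1)] by auto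
    have "unit_move E (w(u := w u + 1)) (w(par u := w (par u) + 1))"
      by (rule unit_moveI[OF edge[OF False u(1)]]) (use u ne in auto)
    moreover have "(unit_move E)\<^sup>*\<^sup>* (w(par u := w (par u) + 1)) (w(r := w r + 1))"
      using slack[OF False u(1)] u by (intro less.hyps rank[OF False u(1)]) auto
    ultimately show ?thesis
      by (rule converse_rtranclp_into_rtranclp)
  qed simp
qed

text \<open>Each round takes one unit from a positive vertex of largest rank and carries it to
  \<open>r\<close>, so the weight off the root drops. Such a vertex is the parent of no positive
  vertex, hence its loss violates no comparison. \<open>le\<close> and \<open>slack\<close> together
  demand strict growth except at vertices without a positive child.\<close>

lemma gather_to_root:
  fixes w :: "nat \<Rightarrow> nat" and rk :: "nat \<Rightarrow> nat"
  assumes "finite V" "r \<in> V" "\<And>v. v \<notin> V \<Longrightarrow> w v = 0"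
    and rank: "\<And>v. v \<noteq> r \<Longrightarrow> w v > 0 \<Longrightarrow> rk (par v) < rk v"
    and edge: "\<And>v. v \<noteq> r \<Longrightarrow> w v > 0 \<Longrightarrow> {v, par v} \<in> E"
    and le: "\<And>v. v \<noteq> r \<Longrightarrow> w v > 0 \<Longrightarrow> w v \<le> w (par v)"
    and slack: "\<And>x. x \<noteq> r \<Longrightarrow> w x > 0 \<Longrightarrow> par x \<noteq> r \<Longrightarrow> w (par x) < w (par (par x))"
  shows "\<exists>w'. (unit_move E)\<^sup>*\<^sup>* w w' \<and> (\<forall>v. v \<noteq> r \<longrightarrow> w' v = 0)"
  using assms(3-)
proof (induction "sum w (V - {r})" arbitrary: w rule: less_induct)
  case less
  note rank = less.prems(2) and edge = less.prems(3) and le = less.prems(4)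
    and slack = less.prems(5)
  define P where "P = {v \<in> V. v \<noteq> r \<and> 0 < w v}"
  have P: "v \<in> P" if "v \<noteq> r" "w v > 0" for v
    using that less.prems(1) unfolding P_def by force
  show ?case
  proof (cases "P = {}")
    case True
    thus ?thesis
      using P by (intro exI[of _ w]) auto
  next
    case False
    have "finite P"
      using assms(1) unfolding P_def by simp
    hence "Max (rk ` P) \<in> rk ` P" "\<And>x. x \<in> P \<Longrightarrow> rk x \<le> Max (rk ` P)"
      using False by auto
    then obtain v where v: "v \<in> P" "\<And>x. x \<in> P \<Longrightarrow> rk x \<le> rk v"
      by (metis imageE)
    hence vr: "v \<noteq> r" "w v > 0" "v \<in> V"
      unfolding P_def by auto
    have leaf: "par x \<noteq> v" if "x \<noteq> r" "w x > 0" for x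
      using rank[OF that] v(2)[OF P[OF that]] by auto
    define w1 where "w1 = w(v := w v - 1)"
    have w1_le: "w1 x \<le> w x" for x
      unfolding w1_def by simp
    have w1_pos: "w x > 0" if "w1 x > 0" for x
      using that w1_le[of x] by linarith
    have w1_eq: "w1 x = w x" if "x \<noteq> v" for x
      using that unfolding w1_def by simp
    have ne: "par v \<noteq> v"
      using leaf[OF vr(1,2)] .
    have rank1: "rk (par x) < rk x" if "x \<noteq> r" "w1 x > 0" for x
      using rank that w1_pos by blast
    have edge1: "{x, par x} \<in> E" if "x \<noteq> r" "w1 x > 0" for x
      using edge that w1_pos by blast
    have slack0: "w1 (par x) < w1 (par (par x))" if x: "x \<noteq> r" "w x > 0" "par x \<noteq> r" for x
    proof -
      have "w (par x) > 0"
        using le[OF x(1,2)] x(2) by linarith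
      hence "par (par x) \<noteq> v"
        using leaf x(3) by blast
      thus ?thesis
        using slack[OF x] leaf[OF x(1,2)] by (simp add: w1_eq)
    qed
    have le1: "w1 x \<le> w1 (par x)" if "x \<noteq> r" "w1 x > 0" for x
      using le[OF that(1) w1_pos[OF that(2)]] leaf[OF that(1) w1_pos[OF that(2)]] w1_le[of x]
      by (simp add: w1_eq)
    have "unit_move E w (w1(par v := w1 (par v) + 1))"
      by (rule unit_moveI[OF edge[OF vr(1,2)]])
        (use vr ne le[OF vr(1,2)] in \<open>auto simp: w1_def\<close>)
    \<comment> \<open>Once the unit has left \<open>v\<close>, the vertex \<open>par v\<close> holds
      one unit above \<open>w1\<close>, which is the shape of configuration that
      \<open>carry_to_root\<close> moves on.\<close>
    moreover have "(unit_move E)\<^sup>*\<^sup>* (w1(par v := w1 (par v) + 1)) (w1(r := w1 r + 1))"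
    proof (rule carry_to_root[of r w1 rk par E])
      have "w1 (par v) > 0"
        using le[OF vr(1,2)] vr(2) ne by (simp add: w1_eq)
      thus "par v = r \<or> 0 < w1 (par v) \<and> w1 (par v) < w1 (par (par v))"
        using slack0[OF vr(1,2)] by blast
    qed (use rank1 edge1 slack0 w1_pos in auto)
    ultimately have 1: "(unit_move E)\<^sup>*\<^sup>* w (w1(r := w1 r + 1))"
      by (rule converse_rtranclp_into_rtranclp)
    define w2 where "w2 = w1(r := w1 r + 1)"
    have w2_eq: "w2 x = w1 x" if "x \<noteq> r" for x
      using that unfolding w2_def by simp
    have w2_ge: "w1 x \<le> w2 x" for x
      unfolding w2_def by simp
    have "\<exists>w'. (unit_move E)\<^sup>*\<^sup>* w2 w' \<and> (\<forall>v. v \<noteq> r \<longrightarrow> w' v = 0)"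
    proof (rule less.hyps)
      have "sum w2 (V - {r}) = sum w1 (V - {r})"
        by (rule sum.cong) (auto simp: w2_def)
      also have "\<dots> < sum w (V - {r})"
        by (rule sum_strict_mono_ex1)
          (use assms(1) vr w1_le in \<open>auto simp: w1_def intro!: bexI[of _ v]\<close>)
      finally show "sum w2 (V - {r}) < sum w (V - {r})" .
    next
      show "w2 x = 0" if "x \<notin> V" for x
        using that less.prems(1) vr(3) \<open>r \<in> V\<close> by (metis w1_eq w2_eq)
    next
      fix x assume x: "x \<noteq> r" "w2 x > 0"
      hence x1: "w1 x > 0"
        by (simp add: w2_eq)
      show "rk (par x) < rk x" "{x, par x} \<in> E"
        using rank1 edge1 x x1 by auto
      show "w2 x \<le> w2 (par x)"
        using le1[OF x(1) x1] w2_ge[of "par x"] x(1) by (simp add: w2_eq)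
      assume "par x \<noteq> r"
      thus "w2 (par x) < w2 (par (par x))"
        using slack0[OF x(1) w1_pos[OF x1]] w2_ge[of "par (par x)"] by (simp add: w2_eq)
    qed
    then obtain w' where "(unit_move E)\<^sup>*\<^sup>* w2 w'" "\<forall>v. v \<noteq> r \<longrightarrow> w' v = 0"
      by blast
    thus ?thesis
      using 1 unfolding w2_def by (meson rtranclp_trans)
  qed
qed

text \<open>The order of the moves is arbitrary: owners lie outside \<open>X\<close> and only gain,
  so a leaf of weight 1 can always pass its unit on.\<close>

lemma gather_stars:
  assumes "finite X"
    and "\<And>x. x \<in> X \<Longrightarrow> {x, ow x} \<in> E \<and> ow x \<notin> X \<and> w x = 1 \<and> 1 \<le> w (ow x)"
  shows "(unit_move E)\<^sup>*\<^sup>* w (\<lambda>v. if v \<in> X then 0 else w v + card {x \<in> X. ow x = v})"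
  using assms
proof (induction X rule: finite_induct)
  case (insert a X)
  let ?w = "\<lambda>v. if v \<in> X then 0 else w v + card {x \<in> X. ow x = v}"
  let ?w' = "\<lambda>v. if v \<in> insert a X then 0 else w v + card {x \<in> insert a X. ow x = v}"
  have a: "{a, ow a} \<in> E" "ow a \<noteq> a" "ow a \<notin> X" "w a = 1" "1 \<le> w (ow a)"
    using insert.prems[of a] by auto
  have "{x \<in> X. ow x = a} = {}"
    using insert.prems by auto
  hence na: "card {x \<in> X. ow x = a} = 0"
    by (simp only: card.empty)
  have "card {x \<in> insert a X. ow x = v} = card {x \<in> X. ow x = v} + (if ow a = v then 1 else 0)"
    for v
  proof (cases "ow a = v")
    case True
    hence "{x \<in> insert a X. ow x = v} = insert a {x \<in> X. ow x = v}"
      by auto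
    thus ?thesis
      using True insert.hyps by simp
  next
    case False
    hence "{x \<in> insert a X. ow x = v} = {x \<in> X. ow x = v}"
      by auto
    thus ?thesis
      using False by simp
  qed
  hence eq: "?w' = ?w(a := ?w a - 1, ow a := ?w (ow a) + 1)"
    using a insert.hyps na by (auto simp: fun_eq_iff)
  have "unit_move E ?w ?w'"
    by (rule unit_moveI[OF a(1) a(2)[symmetric] _ _ eq]) (use a insert.hyps in \<open>simp_all add: na\<close>)
  moreover have "(unit_move E)\<^sup>*\<^sup>* w ?w"
    by (rule insert.IH) (use insert.prems in blast)
  ultimately show ?case
    by (meson rtranclp.rtrancl_into_rtrancl)
qed simp

text \<open>Spending the stars leaves weight \<open>wt v\<close> on \<open>U\<close>, 0 on the stars
  and 1 on \<open>S\<close> and the rest of \<open>R\<close>. A path through \<open>S\<close>,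
  \<open>R\<close>, \<open>U\<close> then meets weights 1, 1, at least 2, with a tie only at its
  start. A vertex of \<open>S\<close> must not hang off a star leaf, which has weight 0 by
  then.\<close>

lemma collects_all_of_layers:
  fixes wt :: "nat \<Rightarrow> nat"
  assumes part: "{..<n} = U \<union> R \<union> S" "U \<inter> R = {}" "(U \<union> R) \<inter> S = {}"
    and "r \<in> U"
    and par: "\<And>v. v \<in> U \<Longrightarrow> v \<noteq> r \<Longrightarrow> par v \<in> U \<and> {v, par v} \<in> E \<and> wt v < wt (par v)"
    and wt2: "\<And>v. v \<in> U \<Longrightarrow> 2 \<le> wt v"
    and star: "\<And>v. v \<in> U \<Longrightarrow> star v \<subseteq> R \<and> card (star v) = wt v - 1 \<and> (\<forall>x\<in>star v. {x, v} \<in> E)"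
    and disj: "\<And>u v. u \<in> U \<Longrightarrow> v \<in> U \<Longrightarrow> u \<noteq> v \<Longrightarrow> star u \<inter> star v = {}"
    and h: "\<And>y. y \<in> R \<Longrightarrow> h y \<in> U \<and> {y, h y} \<in> E"
    and f: "\<And>s. s \<in> S \<Longrightarrow> f s \<in> U \<union> R - \<Union>(star ` U) \<and> {s, f s} \<in> E"
  shows "collects_all n E"
proof -
  define X where "X = \<Union>(star ` U)"
  have XR: "X \<subseteq> R"
    unfolding X_def using star by blast
  have fin: "finite {..<n}" "finite U" "finite R" "finite X"
  proof -
    show "finite {..<n}"
      by simp
    thus "finite U" "finite R"
      unfolding part(1) by simp_all
    thus "finite X"
      using XR finite_subset by blast
  qed
  define ow where "ow x = (THE u. u \<in> U \<and> x \<in> star u)" for x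
  have ow: "ow x = u" if "u \<in> U" "x \<in> star u" for x u
    unfolding ow_def using that disj by (intro the_equality) blast+
  define w0 :: "nat \<Rightarrow> nat" where "w0 v = (if v < n then 1 else 0)" for v
  define w where "w v = (if v \<in> X then 0 else w0 v + card {x \<in> X. ow x = v})" for v
  have ltn: "v < n" if "v \<in> U \<union> R \<union> S" for v
    using that part(1) by blast
  have 1: "(unit_move E)\<^sup>*\<^sup>* w0 w"
    unfolding w_def[abs_def]
  proof (rule gather_stars[OF fin(4)])
    fix x assume "x \<in> X"
    then obtain u where u: "u \<in> U" "x \<in> star u"
      unfolding X_def by blast
    thus "{x, ow x} \<in> E \<and> ow x \<notin> X \<and> w0 x = 1 \<and> 1 \<le> w0 (ow x)"
      using ow[OF u] star[OF u(1)] XR part(2) ltn unfolding w0_def by auto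
  qed
  have owU: "ow x \<in> U" if "x \<in> X" for x
    using that ow unfolding X_def by auto
  have wU: "w v = wt v" if v: "v \<in> U" for v
  proof -
    have "{x \<in> X. ow x = v} = star v"
      using v ow unfolding X_def by blast
    moreover have "v \<notin> X"
      using v XR part(2) by blast
    ultimately show ?thesis
      using star[OF v] wt2[OF v] ltn[of v] v unfolding w_def w0_def by simp
  qed
  have w_other: "w v = (if v \<in> R \<union> S - X then 1 else 0)" if "v \<notin> U" for v
  proof -
    have "{x \<in> X. ow x = v} = {}"
      using that owU by blast
    hence "card {x \<in> X. ow x = v} = 0"
      by (simp only: card.empty)
    moreover have "v < n \<longleftrightarrow> v \<in> R \<union> S"
      using that part(1) by blast
    ultimately show ?thesis
      unfolding w_def w0_def by simp
  qed
  define p where "p v = (if v \<in> U then par v else if v \<in> R then h v else f v)" for v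
  define m where "m = Max (wt ` U)"
  have m: "wt v \<le> m" if "v \<in> U" for v
    unfolding m_def using that fin by simp
  \<comment> \<open>Inside \<open>U\<close> the weights themselves measure progress towards the
    root; \<open>R\<close> and \<open>S\<close> rank behind.\<close>
  define rk where "rk v = (if v \<in> U then m - wt v else if v \<in> R then m + 1 else m + 2)" for v
  have "\<exists>w'. (unit_move E)\<^sup>*\<^sup>* w w' \<and> (\<forall>v. v \<noteq> r \<longrightarrow> w' v = 0)"
  proof (rule gather_to_root[where V = "{..<n}" and rk = rk and par = p])
    show "r \<in> {..<n}"
      using \<open>r \<in> U\<close> part(1) by blast
    show "w v = 0" if "v \<notin> {..<n}" for v
      using that part(1) w_other[of v] by auto
  next
    fix v assume v: "v \<noteq> r" "0 < w v"
    have "v \<in> U \<or> v \<in> R \<union> S - X"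
      using v w_other[of v] by (metis less_numeral_extra(3))
    then consider (U) "v \<in> U" | (R) "v \<notin> U" "v \<in> R" "v \<notin> X" | (S) "v \<notin> U" "v \<notin> R" "v \<in> S"
      using part(3) by blast
    note cs = this
    have pU: "p v \<in> U \<and> wt v < wt (p v) \<and> {v, p v} \<in> E" if "v \<in> U"
      using par[OF that v(1)] that unfolding p_def by simp
    have pR: "p v \<in> U \<and> {v, p v} \<in> E" if "v \<notin> U" "v \<in> R"
      using h[of v] that unfolding p_def by simp
    have pS: "p v \<in> U \<union> R - X \<and> {v, p v} \<in> E" if "v \<notin> U" "v \<notin> R" "v \<in> S"
      using f[of v] that unfolding p_def X_def by simp
    show "rk (p v) < rk v"
    proof (cases rule: cs)
      case U
      thus ?thesis
        using pU m[of "p v"] unfolding rk_def by (simp add: diff_less_mono2)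
    next
      case R
      thus ?thesis
        using pR unfolding rk_def by simp
    next
      case S
      thus ?thesis
        using pS unfolding rk_def by auto
    qed
    show "{v, p v} \<in> E"
      using cs pU pR pS by cases blast+
    show "w v \<le> w (p v)"
    proof (cases rule: cs)
      case U
      thus ?thesis
        using pU wU by simp
    next
      case R
      thus ?thesis
        using pR wU wt2[of "p v"] w_other[of v] by simp
    next
      case S
      hence "p v \<in> U \<or> p v \<notin> U \<and> p v \<in> R - X"
        using pS by blast
      thus ?thesis
        using S wU wt2[of "p v"] w_other[of v] w_other[of "p v"] by auto
    qed
    assume ppr: "p v \<noteq> r"
    have "p v \<in> U \<or> p v \<notin> U \<and> p v \<in> R - X"
      using cs pU pR pS by cases blast+
    thus "w (p v) < w (p (p v))"
    proof
      assume "p v \<in> U"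
      thus ?thesis
        using par[OF _ ppr] wU unfolding p_def[of "p v"] by simp
    next
      assume "p v \<notin> U \<and> p v \<in> R - X"
      thus ?thesis
        using h[of "p v"] wt2[of "p (p v)"] wU w_other[of "p v"] unfolding p_def[of "p v"] by simp
    qed
  qed simp
  thus ?thesis
    using 1 unfolding collects_all_def w0_def[abs_def] by (meson rtranclp_trans)
qed

section \<open>Hall's theorem\<close>

text \<open>Induction after Halmos and Vaughan. If a proper nonempty subfamily \<open>J\<close> has
  exactly \<open>card J\<close> elements available, it is matched on its own; otherwise every such
  subfamily has one to spare, and any choice for a single index is safe.\<close>

theorem hall_marriage:
  assumes "finite I" "\<And>i. i \<in> I \<Longrightarrow> finite (A i)"
    and "\<And>J. J \<subseteq> I \<Longrightarrow> card J \<le> card (\<Union>(A ` J))"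
  shows "\<exists>f. inj_on f I \<and> (\<forall>i\<in>I. f i \<in> A i)"
  using assms
proof (induction "card I" arbitrary: I A rule: less_induct)
  case less
  note fin = less.prems(1,2) and hall = less.prems(3)
  show ?case
  proof (cases "I = {}")
    case False
    show ?thesis
    proof (cases "\<exists>J. J \<subset> I \<and> J \<noteq> {} \<and> card (\<Union>(A ` J)) = card J")
      case True
      then obtain J where J: "J \<subset> I" "J \<noteq> {}" "card (\<Union>(A ` J)) = card J"
        by blast
      have finJ: "finite J" "card J < card I" "finite (\<Union>(A ` J))"
      proof -
      show "finite J" "card J < card I"
        using J(1) fin(1) by (auto intro: finite_subset psubset_card_mono)
      thus "finite (\<Union>(A ` J))"
        using J(1) fin(2) by blast
    qed
      have "\<exists>f. inj_on f J \<and> (\<forall>i\<in>J. f i \<in> A i)"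
        by (rule less.hyps[OF finJ(2,1)]) (use fin hall J in auto)
      then obtain f where f: "inj_on f J" "\<And>i. i \<in> J \<Longrightarrow> f i \<in> A i"
        by blast
      \<comment> \<open>Without the elements used by \<open>J\<close>, the other indices still
        satisfy the condition: apply it to \<open>L \<union> J\<close> and subtract the tight
        equality for \<open>J\<close>.\<close>
      let ?B = "\<lambda>i. A i - \<Union>(A ` J)"
      have "\<exists>g. inj_on g (I - J) \<and> (\<forall>i\<in>I - J. g i \<in> ?B i)"
      proof (rule less.hyps)
        show "card (I - J) < card I"
          using J fin(1) by (intro psubset_card_mono) auto
        fix L assume L: "L \<subseteq> I - J"
        have finL: "finite L"
          using L fin(1) finite_subset by blast
        have "card L + card J = card (L \<union> J)"
          using L finL finJ by (subst card_Un_disjoint) auto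
        also have "\<dots> \<le> card (\<Union>(A ` (L \<union> J)))"
          using L J by (intro hall) auto
        also have "\<Union>(A ` (L \<union> J)) = \<Union>(?B ` L) \<union> \<Union>(A ` J)"
          by auto
        also have "card \<dots> \<le> card (\<Union>(?B ` L)) + card (\<Union>(A ` J))"
          by (rule card_Un_le)
        finally show "card L \<le> card (\<Union>(?B ` L))"
          using J(3) by simp
      qed (use fin in auto)
      then obtain g where g: "inj_on g (I - J)" "\<And>i. i \<in> I - J \<Longrightarrow> g i \<in> ?B i"
        by (elim exE conjE) (rule that, assumption, erule bspec)
      let ?h = "\<lambda>i. if i \<in> J then f i else g i"
      have "f ` J \<inter> g ` (I - J) = {}"
        using f(2) g(2) by (force simp: disjoint_iff)
      hence "inj_on ?h (J \<union> (I - J))"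
        using f(1) g(1) by (intro inj_on_disjoint_Un) auto
      hence "inj_on ?h I"
        using J(1) by (simp add: Un_absorb1 psubset_imp_subset)
      moreover have "\<forall>i\<in>I. ?h i \<in> A i"
        using f(2) g(2) by auto
      ultimately show ?thesis
        by blast
    next
      case ntight: False
      obtain i where i: "i \<in> I"
        using False by blast
      have "card {i} \<le> card (\<Union>(A ` {i}))"
        using i by (intro hall) auto
      then obtain x where x: "x \<in> A i"
        by fastforce
      have "\<exists>g. inj_on g (I - {i}) \<and> (\<forall>j\<in>I - {i}. g j \<in> A j - {x})"
      proof (rule less.hyps)
        show "card (I - {i}) < card I"
          using i fin(1) by (meson card_Diff1_less)
        fix L assume L: "L \<subseteq> I - {i}"
        show "card L \<le> card (\<Union>((\<lambda>j. A j - {x}) ` L))"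
        proof (cases "L = {}")
          case Lne: False
          have "L \<subset> I"
            using L i by blast
          hence "card (\<Union>(A ` L)) \<noteq> card L" "card L \<le> card (\<Union>(A ` L))"
            using ntight Lne by (metis, intro hall) simp
          hence "card L \<le> card (\<Union>(A ` L)) - card {x}"
            by simp
          also have "\<dots> \<le> card (\<Union>(A ` L) - {x})"
            by (rule diff_card_le_card_Diff) simp
          also have "\<Union>(A ` L) - {x} = \<Union>((\<lambda>j. A j - {x}) ` L)"
            by auto
          finally show ?thesis .
        qed simp
      qed (use fin in auto)
      then obtain g where g: "inj_on g (I - {i})" "\<And>j. j \<in> I - {i} \<Longrightarrow> g j \<in> A j - {x}"
        by (elim exE conjE) (rule that, assumption, erule bspec)
      have gx: "x \<notin> g ` (I - {i})"
        using g(2) by force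
      have "inj_on (g(i := x)) (insert i (I - {i}))"
        using gx g(1) by (auto simp: inj_on_def)
      hence "inj_on (g(i := x)) I"
        using i by (simp add: insert_absorb)
      moreover have "\<forall>j\<in>I. (g(i := x)) j \<in> A j"
        using g(2) x by auto
      ultimately show ?thesis
        by blast
    qed
  qed simp
qed

text \<open>Hall's theorem for \<open>dem i\<close> copies of each \<open>i\<close>. A set of copies
  is no larger than the set of all copies of the indices it involves, so it is enough to test sets
  of indices.\<close>

lemma disjoint_stars:
  fixes dem :: "'a \<Rightarrow> nat"
  assumes "finite I" "\<And>i. i \<in> I \<Longrightarrow> finite (A i)"
    and hall: "\<And>J. J \<subseteq> I \<Longrightarrow> sum dem J \<le> card (\<Union>(A ` J))"
  shows "\<exists>T. (\<forall>i\<in>I. T i \<subseteq> A i \<and> card (T i) = dem i) \<and>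
             (\<forall>i\<in>I. \<forall>j\<in>I. i \<noteq> j \<longrightarrow> T i \<inter> T j = {})"
proof -
  let ?P = "Sigma I (\<lambda>i. {..<dem i})"
  have "\<exists>f. inj_on f ?P \<and> (\<forall>p\<in>?P. f p \<in> A (fst p))"
  proof (rule hall_marriage)
    fix J assume J: "J \<subseteq> ?P"
    have fin: "finite (fst ` J)"
      using J assms(1) by (auto intro!: finite_subset[of "fst ` J" I])
    have "card J \<le> card (Sigma (fst ` J) (\<lambda>i. {..<dem i}))"
      using J fin by (intro card_mono) force+
    also have "\<dots> = sum dem (fst ` J)"
      using fin by simp
    also have "\<dots> \<le> card (\<Union>(A ` fst ` J))"
      using J by (intro hall) auto
    finally show "card J \<le> card (\<Union>((\<lambda>p. A (fst p)) ` J))"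
      by (simp add: image_image)
  qed (use assms in auto)
  then obtain f where f: "inj_on f ?P" "\<And>p. p \<in> ?P \<Longrightarrow> f p \<in> A (fst p)"
    by blast
  define T where "T i = (\<lambda>k. f (i, k)) ` {..<dem i}" for i
  have "T i \<subseteq> A i \<and> card (T i) = dem i" if "i \<in> I" for i
  proof -
    have "inj_on (\<lambda>k. f (i, k)) {..<dem i}"
      using f(1) that by (auto simp: inj_on_def)
    moreover have "T i \<subseteq> A i"
      using f(2) that unfolding T_def by force
    ultimately show ?thesis
      unfolding T_def by (simp add: card_image)
  qed
  moreover have "T i \<inter> T j = {}" if "i \<in> I" "j \<in> I" "i \<noteq> j" for i j
    using inj_onD[OF f(1)] that unfolding T_def by fastforce
  ultimately show ?thesis
    by blast
qed

section \<open>Spanning trees of expanding graphs\<close>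

text \<open>Cumulative: despite the name these are balls around \<open>A\<close>, not
  spheres.\<close>

primrec layer :: "('a \<Rightarrow> 'a set) \<Rightarrow> 'a set \<Rightarrow> nat \<Rightarrow> 'a set" where
  "layer N A 0 = A"
| "layer N A (Suc j) = layer N A j \<union> \<Union>(N ` layer N A j)"

text \<open>For a vertex in no layer the \<open>LEAST\<close> is unspecified; hence the membership
  premises in the lemmas about it.\<close>

definition ldist :: "('a \<Rightarrow> 'a set) \<Rightarrow> 'a set \<Rightarrow> 'a \<Rightarrow> nat" where
  "ldist N A v = (LEAST j. v \<in> layer N A j)"

lemma layer_mono: "i \<le> j \<Longrightarrow> layer N A i \<subseteq> layer N A j"
  by (rule lift_Suc_mono_le[of "layer N A"]) auto

lemma layer_subset:
  assumes "A \<subseteq> U" "\<And>v. v \<in> U \<Longrightarrow> N v \<subseteq> U"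
  shows "layer N A j \<subseteq> U"
  using assms by (induction j) (simp_all, blast)

lemma ldist_le: "v \<in> layer N A j \<Longrightarrow> ldist N A v \<le> j"
  unfolding ldist_def by (rule Least_le)

lemma in_layer_ldist: "v \<in> layer N A j \<Longrightarrow> v \<in> layer N A (ldist N A v)"
  unfolding ldist_def by (rule LeastI)

lemma ldist_0_iff: "v \<in> layer N A j \<Longrightarrow> ldist N A v = 0 \<longleftrightarrow> v \<in> A"
  using in_layer_ldist[of v N A j] ldist_le[of v N A 0] by auto

lemma ldist_pred:
  assumes "v \<in> layer N A j" "v \<notin> A"
  shows "\<exists>u. v \<in> N u \<and> Suc (ldist N A u) = ldist N A v \<and> u \<in> layer N A (ldist N A u)"
proof -
  obtain i where i: "ldist N A v = Suc i"
    using ldist_0_iff[OF assms(1)] assms(2) not0_implies_Suc by blast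
  have "v \<in> layer N A (Suc i)"
    using in_layer_ldist[OF assms(1)] i by simp
  moreover have "v \<notin> layer N A i"
    using ldist_le[of v N A i] i by auto
  ultimately obtain u where u: "u \<in> layer N A i" "v \<in> N u"
    by auto
  have 1: "ldist N A u \<le> i" "u \<in> layer N A (ldist N A u)"
    using ldist_le[OF u(1)] in_layer_ldist[OF u(1)] by auto
  hence "v \<in> layer N A (Suc (ldist N A u))"
    using u(2) by auto
  hence "ldist N A v \<le> Suc (ldist N A u)"
    by (rule ldist_le)
  thus ?thesis
    using 1 i u(2) by (intro exI[of _ u]) auto
qed

text \<open>Only vertices with a grandchild and those of the initial ball \<open>B\<close> get weights above 3. Beyond distance
  two from \<open>B\<close> there are fewer than \<open>b\<close> vertices, hence few vertices outside \<open>B\<close> have a grandchild.\<close>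

lemma increasing_weights_tree:
  fixes U :: "'a set" and N :: "'a \<Rightarrow> 'a set"
  assumes fin: "finite U" and r: "r \<in> U"
    and NU: "\<And>v. v \<in> U \<Longrightarrow> N v \<subseteq> U"
    and sym: "\<And>u v. v \<in> N u \<Longrightarrow> u \<in> N v"
    and a0: "1 \<le> a" and b0: "b \<le> g * a"
    and expand: "\<And>A. A \<subseteq> U \<Longrightarrow> A \<noteq> {} \<Longrightarrow> card A \<le> a \<Longrightarrow> g * card A < card (\<Union>(N ` A))"
    and dense: "\<And>X Y. X \<subseteq> U \<Longrightarrow> Y \<subseteq> U \<Longrightarrow> X \<inter> Y = {} \<Longrightarrow> g * a < card X \<Longrightarrow> b \<le> card Y \<Longrightarrow>
       \<exists>x\<in>X. \<exists>y\<in>Y. y \<in> N x"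
    and k: "card U < g ^ k"
  shows "\<exists>par wt. (\<forall>v\<in>U. v \<noteq> r \<longrightarrow> par v \<in> U \<and> par v \<in> N v \<and> wt v < wt (par v)) \<and>
     (\<forall>v\<in>U. 2 \<le> wt v \<and> wt v \<le> 2 * k + 6) \<and> card {v \<in> U. 3 < (wt v :: nat)} \<le> a + b"
proof -
  let ?ball = "layer N {r}"
  have ballU: "?ball i \<subseteq> U" for i
    using layer_subset[of "{r}" U N i, OF _ NU] r by simp
  have fin_ball: "finite (?ball i)" for i
    using ballU fin finite_subset by blast
  \<comment> \<open>Up to size \<open>a\<close> a ball gains a factor \<open>g\<close> per step, so
    it exceeds \<open>a\<close> within \<open>k\<close> steps, as
    \<open>card U < g ^ k\<close>.\<close>
  have growth: "g ^ i \<le> card (?ball i)" if "\<And>j. j < i \<Longrightarrow> card (?ball j) \<le> a" for i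
    using that
  proof (induction i)
    case (Suc i)
    have "?ball i \<noteq> {}"
      using layer_mono[of 0 i N "{r}"] by auto
    hence "g * card (?ball i) < card (\<Union>(N ` ?ball i))"
      using Suc.prems ballU by (intro expand) auto
    also have "\<dots> \<le> card (?ball (Suc i))"
      using fin_ball[of "Suc i"] by (intro card_mono) auto
    finally have "g * card (?ball i) \<le> card (?ball (Suc i))"
      by simp
    moreover have "g ^ i \<le> card (?ball i)"
      using Suc by simp
    ultimately show ?case
      by (metis mult_le_mono2 order.trans power_Suc)
  qed simp
  have "\<exists>i\<le>k. a < card (?ball i)"
  proof (rule ccontr)
    assume "\<not> ?thesis"
    hence "g ^ k \<le> card (?ball k)"
      by (intro growth) (auto simp: not_less)
    also have "\<dots> \<le> card U"
      using ballU fin by (intro card_mono)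
    finally show False
      using k by simp
  qed
  then obtain i0 where i0: "i0 \<le> k" "a < card (?ball i0)" "\<And>j. j < i0 \<Longrightarrow> card (?ball j) \<le> a"
  proof -
    let ?i = "LEAST i. a < card (?ball i)"
    from \<open>\<exists>i\<le>k. a < card (?ball i)\<close> obtain i where i: "i \<le> k" "a < card (?ball i)"
      by blast
    have "?i \<le> k"
      using Least_le[of "\<lambda>i. a < card (?ball i)", OF i(2)] i(1) by simp
    moreover have "a < card (?ball ?i)"
      using i(2) by (rule LeastI)
    moreover have "card (?ball j) \<le> a" if "j < ?i" for j
      using not_less_Least[OF that] by simp
    ultimately show ?thesis
      by (rule that)
  qed
  have "i0 \<noteq> 0"
    using i0(2) a0 by (intro notI) simp
  then obtain i1 where i1: "i0 = Suc i1"
    using not0_implies_Suc by blast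
  have "card (?ball i1) \<le> a" "a \<le> card (?ball i0)" "?ball i1 \<subseteq> ?ball i0"
    using i0 i1 by (auto intro: order_less_imp_le)
  \<comment> \<open>Size exactly \<open>a\<close> makes \<open>B\<close> small enough for
    \<open>expand\<close> and its neighbourhood large enough for \<open>dense\<close>. As
    \<open>B\<close> lies between two consecutive balls, the vertices preceding it on shortest paths
    to \<open>r\<close> are in the smaller ball, hence in \<open>B\<close>.\<close>
  then obtain B where B: "?ball i1 \<subseteq> B" "B \<subseteq> ?ball i0" "card B = a"
    using exists_subset_between[OF _ _ _ fin_ball] by metis
  have rB: "r \<in> B"
    using B(1) layer_mono[of 0 i1 N "{r}"] by auto
  have BU: "B \<subseteq> U"
    using B(2) ballU by blast
  have finB: "finite B"
    using BU fin finite_subset by blast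
  let ?D = "layer N B"
  have DU: "?D j \<subseteq> U" for j
    using layer_subset[of B U N j, OF BU NU] .
  have fin_D: "finite (?D j)" for j
    using DU fin finite_subset by blast
  have "g * card B < card (\<Union>(N ` B))"
    using BU rB B(3) by (intro expand) auto
  also have "\<dots> \<le> card (?D 1)"
    using fin_D[of 1] by (intro card_mono) auto
  finally have D1: "g * a < card (?D 1)"
    using B(3) by simp
  define W where "W j = U - ?D (j + 2)" for j
  have WU: "W j \<subseteq> U" "finite (W j)" for j
    unfolding W_def using fin by auto
  \<comment> \<open>An edge from the ball of radius 1 around \<open>B\<close> to \<open>W 0\<close>
    would put its end into the ball of radius 2, so \<open>dense\<close> bounds
    \<open>W 0\<close>.\<close>
  have W0: "card (W 0) < b"
  proof (rule ccontr)
    assume "\<not> ?thesis"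
    moreover have "?D 1 \<inter> W 0 = {}"
      using layer_mono[of 1 2 N B] unfolding W_def by (auto simp: numeral_2_eq_2)
    moreover have "b \<le> card (W 0)"
      using \<open>\<not> card (W 0) < b\<close> by simp
    ultimately obtain x y where "x \<in> ?D 1" "y \<in> W 0" "y \<in> N x"
      using dense[OF DU[of 1] WU(1)[of 0] _ D1] by blast
    thus False
      unfolding W_def by (auto simp: numeral_2_eq_2)
  qed
  \<comment> \<open>Far away from \<open>B\<close> the expansion is read inwards: neighbours of
    \<open>W (Suc j)\<close> lie in \<open>W j\<close>, so these sets shrink by the factor
    \<open>g\<close> per step.\<close>
  have NW: "\<Union>(N ` W (Suc j)) \<subseteq> W j" for j
  proof
    fix u assume "u \<in> \<Union>(N ` W (Suc j))"
    then obtain x where x: "x \<in> W (Suc j)" "u \<in> N x"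
      by blast
    hence "u \<notin> ?D (j + 2)"
      using sym[OF x(2)] unfolding W_def by auto
    moreover have "u \<in> U"
      using x NU[of x] WU(1) by blast
    ultimately show "u \<in> W j"
      unfolding W_def by simp
  qed
  have W_mono: "card (W j) \<le> card (W 0)" for j
  proof -
    have "?D 2 \<subseteq> ?D (j + 2)"
      by (rule layer_mono) simp
    hence "W j \<subseteq> W 0"
      unfolding W_def by (simp only: add_0) blast
    thus ?thesis
      using WU(2) by (intro card_mono)
  qed
  have W_decay: "card (W j) * g ^ j \<le> card (W 0)" for j
  proof (induction j)
    case (Suc j)
    show ?case
    proof (cases "W (Suc j) = {}")
      case False
      \<comment> \<open>\<open>expand\<close> applies to at most \<open>a\<close> vertices. Were
        there more, some \<open>a\<close> of them would have over \<open>g * a \<ge> b\<close>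
        neighbours inside \<open>W j\<close>, which has fewer than \<open>b\<close>
        elements.\<close>
      have "card (W (Suc j)) \<le> a"
      proof (rule ccontr)
        assume "\<not> ?thesis"
        then obtain A where A: "A \<subseteq> W (Suc j)" "card A = a"
          by (metis nat_le_linear obtain_subset_with_card_n)
        have "g * card A < card (\<Union>(N ` A))"
          using A WU a0 by (intro expand) auto
        also have "\<dots> \<le> card (W j)"
          using NW[of j] A WU by (intro card_mono) auto
        also have "\<dots> < b"
          using W_mono W0 order.strict_trans1 by blast
        finally show False
          using b0 A(2) by simp
      qed
      hence "g * card (W (Suc j)) < card (\<Union>(N ` W (Suc j)))"
        using WU False by (intro expand) auto
      also have "\<dots> \<le> card (W j)"
        using NW WU by (intro card_mono) auto
      finally have "g * card (W (Suc j)) \<le> card (W j)"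
        by simp
      hence "g * card (W (Suc j)) * g ^ j \<le> card (W j) * g ^ j"
        by (rule mult_le_mono1)
      also have "\<dots> \<le> card (W 0)"
        by (rule Suc)
      finally show ?thesis
        by (simp add: mult_ac)
    qed simp
  qed simp
  have "W k = {}"
  proof (rule ccontr)
    assume "W k \<noteq> {}"
    hence "1 * g ^ k \<le> card (W k) * g ^ k"
      using WU[of k] by (intro mult_right_mono) (auto simp: Suc_le_eq card_gt_0_iff)
    also have "\<dots> \<le> card (W 0)"
      by (rule W_decay)
    also have "\<dots> \<le> card U"
      using WU fin by (intro card_mono) auto
    finally show False
      using k by simp
  qed
  hence UD: "v \<in> ?D (k + 2)" if "v \<in> U" for v
    using that unfolding W_def by blast
  let ?d1 = "ldist N {r}" and ?d2 = "ldist N B"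
  have "\<exists>u\<in>U. u \<in> N v \<and> (if v \<in> B then u \<in> B \<and> ?d1 u < ?d1 v else Suc (?d2 u) = ?d2 v)"
    if v: "v \<in> U" "v \<noteq> r" for v
  proof (cases "v \<in> B")
    case True
    hence vb: "v \<in> ?ball i0"
      using B(2) by blast
    then obtain u where u: "v \<in> N u" "Suc (?d1 u) = ?d1 v" "u \<in> ?ball (?d1 u)"
      using ldist_pred[of v N "{r}" i0] v(2) by blast
    have "?d1 u \<le> i1"
      using ldist_le[OF vb] u(2) i1 by simp
    hence "u \<in> ?ball i1"
      using subsetD[OF layer_mono u(3)] by blast
    thus ?thesis
      using True u(2) subsetD[OF B(1)] subsetD[OF BU] sym[OF u(1)] by (intro bexI[of _ u]) simp_all
  next
    case False
    then obtain u where u: "v \<in> N u" "Suc (?d2 u) = ?d2 v" "u \<in> ?D (?d2 u)"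
      using ldist_pred[OF UD[OF v(1)]] by blast
    thus ?thesis
      using False u(2) subsetD[OF DU u(3)] sym[OF u(1)] by (intro bexI[of _ u]) simp_all
  qed
  then obtain par where par: "\<And>v. v \<in> U \<Longrightarrow> v \<noteq> r \<Longrightarrow> par v \<in> U \<and> par v \<in> N v \<and>
      (if v \<in> B then par v \<in> B \<and> ?d1 (par v) < ?d1 v else Suc (?d2 (par v)) = ?d2 v)"
    by metis
  \<comment> \<open>Depths in \<open>B\<close> are at most \<open>i0\<close>; offsetting the others
    by \<open>i0\<close> makes the depth drop also where a path enters \<open>B\<close>.\<close>
  define dep where "dep v = (if v \<in> B then ?d1 v else i0 + ?d2 v)" for v
  have d1_le: "?d1 v \<le> i0" if "v \<in> B" for v
    using that B(2) by (intro ldist_le) auto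
  have d2_le: "?d2 v \<le> k + 2" if "v \<in> U" for v
    using UD[OF that] by (rule ldist_le)
  have dep_le: "dep v \<le> 2 * k + 2" if "v \<in> U" for v
    using d1_le[of v] d2_le[OF that] i0(1) unfolding dep_def by auto
  have dep_par: "dep (par v) < dep v" if "v \<in> U" "v \<noteq> r" for v
    using par[OF that] d1_le[of "par v"] unfolding dep_def by (auto split: if_splits)
  define inner where "inner v \<longleftrightarrow> (\<exists>x\<in>U. x \<noteq> r \<and> par x = v)" for v
  define tall where "tall v \<longleftrightarrow> (\<exists>x\<in>U. x \<noteq> r \<and> inner x \<and> par x = v)" for v
  define Q where "Q = {v \<in> U. v \<in> B \<or> tall v}"
  \<comment> \<open>Weight 2 suffices for leaves and 3 for vertices whose children are all leaves.
    \<open>Q\<close> is closed under \<open>par\<close>, and there the depth is at most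
    \<open>2 * k + 2\<close>, so \<open>2 * k + 6 - dep v\<close> is at least 4 and tops
    both.\<close>
  define wt where "wt v = (if v \<in> Q then 2 * k + 6 - dep v else if inner v then 3 else 2)" for v
  have parQ: "par v \<in> Q" if "v \<in> U" "v \<noteq> r" "v \<in> Q" for v
  proof (cases "v \<in> B")
    case True
    thus ?thesis
      using par[OF that(1,2)] unfolding Q_def by simp
  next
    case False
    hence "tall v"
      using that unfolding Q_def by blast
    hence "inner v"
      unfolding tall_def inner_def by blast
    thus ?thesis
      using par[OF that(1,2)] that unfolding Q_def tall_def by blast
  qed
  have wtQ: "4 \<le> wt v" if "v \<in> Q" for v
    using that dep_le[of v] unfolding wt_def Q_def by auto
  have wt_le3: "wt v \<le> 3" if "v \<notin> Q" for v
    using that unfolding wt_def by simp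
  have wt_par: "wt v < wt (par v)" if v: "v \<in> U" "v \<noteq> r" for v
  proof -
    have pU: "par v \<in> U"
      using par[OF v] by blast
    consider "v \<in> Q" | "v \<notin> Q" "inner v" | "v \<notin> Q" "\<not> inner v"
      by blast
    thus ?thesis
    proof cases
      case 1
      thus ?thesis
        using parQ[OF v 1] dep_par[OF v] dep_le[OF v(1)] unfolding wt_def by auto
    next
      case 2
      hence "par v \<in> Q"
        using v pU unfolding Q_def tall_def by blast
      thus ?thesis
        using wtQ wt_le3[OF 2(1)] by fastforce
    next
      case 3
      have "inner (par v)"
        using v unfolding inner_def by blast
      hence "3 \<le> wt (par v)"
        using wtQ[of "par v"] unfolding wt_def by (auto split: if_splits)
      thus ?thesis
        using 3 unfolding wt_def by simp
    qed
  qed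
  \<comment> \<open>A vertex outside \<open>B\<close> is at distance at least 1 from it. If it has a
    grandchild, that one is at distance at least 3, so in \<open>W 0\<close>, and the vertex is
    charged to it.\<close>
  have "Q \<subseteq> B \<union> (\<lambda>y. par (par y)) ` W 0"
  proof
    fix v assume v: "v \<in> Q"
    show "v \<in> B \<union> (\<lambda>y. par (par y)) ` W 0"
    proof (cases "v \<in> B")
      case False
      then obtain x where x: "x \<in> U" "x \<noteq> r" "inner x" "par x = v"
        using v unfolding Q_def tall_def by blast
      then obtain y where y: "y \<in> U" "y \<noteq> r" "par y = x"
        unfolding inner_def by blast
      have "x \<notin> B" "Suc (?d2 v) = ?d2 x"
        using par[OF x(1,2)] False x(4) by (auto split: if_splits)
      moreover from this have "y \<notin> B" "Suc (?d2 x) = ?d2 y"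
        using par[OF y(1,2)] y(3) by (auto split: if_splits)
      moreover have "?d2 v \<noteq> 0"
        using ldist_0_iff[OF UD] v False unfolding Q_def by blast
      ultimately have "2 < ?d2 y"
        by linarith
      hence "y \<notin> ?D (0 + 2)"
        using ldist_le[of y N B "0 + 2"] by linarith
      hence "y \<in> W 0"
        using y unfolding W_def by blast
      thus ?thesis
        using x y by blast
    qed simp
  qed
  hence "card Q \<le> card (B \<union> (\<lambda>y. par (par y)) ` W 0)"
    using finB WU by (intro card_mono) auto
  also have "\<dots> \<le> card B + card (W 0)"
    using card_Un_le[of B "(\<lambda>y. par (par y)) ` W 0"] card_image_le[OF WU(2), of _ 0]
    by (meson add_left_mono order_trans)
  finally have "card Q \<le> a + b"
    using B(3) W0 by simp
  moreover have "{v \<in> U. 3 < wt v} \<subseteq> Q"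
    using wt_le3 by (auto simp: not_less[symmetric])
  ultimately have "card {v \<in> U. 3 < wt v} \<le> a + b"
    using card_mono[of Q "{v \<in> U. 3 < wt v}"] fin unfolding Q_def by simp
  moreover have "2 \<le> wt v \<and> wt v \<le> 2 * k + 6" for v
    using wtQ[of v] unfolding wt_def by auto
  ultimately show ?thesis
    using par wt_par by (intro exI[of _ par] exI[of _ wt]) blast
qed

section \<open>Typical graphs\<close>

definition nbrs :: "nat set set \<Rightarrow> nat \<Rightarrow> nat set" where
  "nbrs E v = {u. {v, u} \<in> E}"

text \<open>The vertices below \<open>q\<close> carry the tree that collects the weight; the vertices from \<open>q\<close> on are spent
  to raise the weights of the tree vertices. A good vertex sees enough of both kinds.\<close>

definition good :: "nat \<Rightarrow> nat \<Rightarrow> nat \<Rightarrow> nat set set \<Rightarrow> nat \<Rightarrow> bool" where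
  "good n q d E v \<longleftrightarrow> d \<le> card (nbrs E v \<inter> {..<q}) \<and> d \<le> card (nbrs E v \<inter> {q..<n})"

definition poor :: "nat \<Rightarrow> nat \<Rightarrow> nat \<Rightarrow> nat set set \<Rightarrow> nat set" where
  "poor n q d E = {v. v < n \<and> \<not> good n q d E v}"

definition isolated :: "nat \<Rightarrow> nat set set \<Rightarrow> nat set" where
  "isolated n E = {v. v < n \<and> nbrs E v = {}}"

text \<open>In \<open>num\<close>, \<open>a\<close> is the size at which the search tree stops growing as a ball, after which all but \<open>b\<close>
  vertices are within two further steps; \<open>2 * k + 6\<close> bounds the weights along the tree.\<close>

locale typical_graph =
  fixes n q d c h y0 y1 b g a k :: nat and E :: "nat set set"
  assumes E: "E \<subseteq> Kn_edges n"
    and few_poor: "v < n \<Longrightarrow> card (nbrs E v \<inter> poor n q d E) \<le> c"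
    and few_poor2: "\<lbrakk>v < n; v \<notin> poor n q d E; Y \<subseteq> nbrs E v; Y \<inter> poor n q d E = {}; inj_on f Y;
       \<And>y. y \<in> Y \<Longrightarrow> f y \<in> nbrs E y \<inter> poor n q d E\<rbrakk> \<Longrightarrow> card Y \<le> c"
    and low: "\<lbrakk>s < n; card (nbrs E s) \<le> c\<rbrakk> \<Longrightarrow> nbrs E s \<inter> poor n q d E = {}"
    and sparse: "\<lbrakk>A \<subseteq> {..<n}; Y \<subseteq> {..<n}; A \<noteq> {}; 1 \<le> m; 4 * m \<le> h; card Y = m * card A;
       m * card A \<le> y0\<rbrakk> \<Longrightarrow> \<exists>x\<in>A. card (nbrs E x \<inter> Y) < 2 * h"
    and dense: "\<lbrakk>X \<subseteq> {..<n}; Y \<subseteq> {..<n}; X \<inter> Y = {}; y1 \<le> card X; b \<le> card Y\<rbrakk> \<Longrightarrow>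
       \<exists>x\<in>X. \<exists>y\<in>Y. {x, y} \<in> E"
    and num: "card (poor n q d E) < q" "2 * h + 2 * c \<le> d" "24 \<le> h" "1 \<le> g" "4 * g \<le> h"
      "g * a \<le> y0" "1 \<le> a" "y1 \<le> g * a" "b \<le> g * a" "n < g ^ k" "y0 \<le> n"
      "6 * y1 \<le> y0" "7 * q + 2 * card (poor n q d E) + b \<le> n"
      "2 * (2 * k + 6) * (a + b) \<le> y0" "4 * (2 * (2 * k + 6)) \<le> h"
begin

abbreviation "S \<equiv> poor n q d E"
abbreviation "Ugood \<equiv> {..<q} - S"
abbreviation "Rgood \<equiv> {q..<n} - S"

lemma q_le_n: "q \<le> n"
  using num(13) by linarith

lemma nbrs_props:
  "u \<in> nbrs E v \<Longrightarrow> u < n \<and> v < n \<and> u \<noteq> v"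
  "u \<in> nbrs E v \<longleftrightarrow> v \<in> nbrs E u"
  "nbrs E v \<subseteq> {..<n}" "finite (nbrs E v)"
proof -
  show *: "u < n \<and> v < n \<and> u \<noteq> v" if "u \<in> nbrs E v" for u v
    using Kn_edges_endpoints[of v u E n] that E unfolding nbrs_def by auto
  show "u \<in> nbrs E v \<longleftrightarrow> v \<in> nbrs E u"
    unfolding nbrs_def by (simp add: insert_commute)
  show "nbrs E v \<subseteq> {..<n}"
    using * by blast
  thus "finite (nbrs E v)"
    using finite_subset by blast
qed

lemma nbrs_sym: "u \<in> nbrs E v \<Longrightarrow> v \<in> nbrs E u"
  using nbrs_props(2) by simp

lemma S_props: "S \<subseteq> {..<n}" "finite S"
proof -
  show "S \<subseteq> {..<n}"
    unfolding poor_def by blast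
  thus "finite S"
    using finite_subset by blast
qed

text \<open>Contrapositive of \<open>sparse\<close>: a smaller neighbourhood, padded to a set of
  size exactly \<open>m * card A\<close>, would contain \<open>2 * h\<close> neighbours of every
  vertex of \<open>A\<close>.\<close>

lemma expansion:
  assumes "A \<subseteq> {..<n}" "A \<noteq> {}" "1 \<le> m" "4 * m \<le> h" "m * card A \<le> y0"
    and "\<And>x. x \<in> A \<Longrightarrow> 2 * h \<le> card (nbrs E x \<inter> P)"
  shows "m * card A < card (\<Union>x\<in>A. nbrs E x \<inter> P)"
proof (rule ccontr)
  let ?N = "\<Union>x\<in>A. nbrs E x \<inter> P"
  assume "\<not> ?thesis"
  moreover have "?N \<subseteq> {..<n}"
    using nbrs_props(3) by blast
  moreover have "m * card A \<le> card {..<n}"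
    using assms(5) num(11) by simp
  ultimately obtain Y where Y: "?N \<subseteq> Y" "Y \<subseteq> {..<n}" "card Y = m * card A"
    using exists_subset_between[of ?N "m * card A" "{..<n}"] by auto
  obtain x where x: "x \<in> A" "card (nbrs E x \<inter> Y) < 2 * h"
    using sparse[OF assms(1) Y(2) assms(2-4) Y(3) assms(5)] by blast
  have "card (nbrs E x \<inter> P) \<le> card (nbrs E x \<inter> Y)"
    using x Y(1) nbrs_props(4) by (intro card_mono) auto
  thus False
    using x assms(6) by fastforce
qed

text \<open>Of the \<open>d \<ge> 2 * h + 2 * c\<close> neighbours on a side at most
  \<open>c\<close> are poor. Another \<open>c\<close> may later be lost to attachment points, and
  \<open>2 * h\<close> is what \<open>expansion\<close> needs.\<close>

lemma good_nbrs:
  assumes "v < n" "v \<notin> S"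
  shows "2 * h + c \<le> card (nbrs E v \<inter> Ugood)" "2 * h + c \<le> card (nbrs E v \<inter> Rgood)"
proof -
  have *: "2 * h + c \<le> card (nbrs E v \<inter> (P - S))" if "d \<le> card (nbrs E v \<inter> P)" for P
  proof -
    have "card (nbrs E v \<inter> P) \<le> card (nbrs E v \<inter> (P - S)) + card (nbrs E v \<inter> S)"
      using nbrs_props(4) by (intro order.trans[OF card_mono card_Un_le]) auto
    thus ?thesis
      using that few_poor[OF assms(1)] num(2) by linarith
  qed
  show "2 * h + c \<le> card (nbrs E v \<inter> Ugood)" "2 * h + c \<le> card (nbrs E v \<inter> Rgood)"
    using assms by (intro *; simp add: poor_def good_def)+
qed

text \<open>A vertex of degree at most \<open>c\<close> has no poor neighbour by \<open>low\<close>;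
  one of larger degree cannot have poor neighbours only, by \<open>few_poor\<close>.\<close>

lemma ex_attachments:
  "\<exists>f. \<forall>s\<in>S. nbrs E s \<noteq> {} \<longrightarrow> f s \<in> nbrs E s - S"
proof -
  have "\<exists>y. y \<in> nbrs E s - S" if s: "s \<in> S" "nbrs E s \<noteq> {}" for s
  proof (cases "card (nbrs E s) \<le> c")
    case True
    thus ?thesis
      using low[of s] s S_props by blast
  next
    case False
    have "nbrs E s \<subseteq> S \<Longrightarrow> False"
      using few_poor[of s] False s(1) S_props by (auto simp: inf.absorb1)
    thus ?thesis
      by blast
  qed
  thus ?thesis
    by metis
qed

lemma ex_root: "\<exists>r. r \<in> Ugood"
proof (rule ccontr)
  assume "\<not> ?thesis"
  hence "card {..<q} \<le> card S"
    using S_props by (intro card_mono) auto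
  thus False
    using num(1) by simp
qed

lemma ex_tree:
  assumes "r \<in> Ugood"
  shows "\<exists>par wt. (\<forall>v\<in>Ugood. v \<noteq> r \<longrightarrow> par v \<in> Ugood \<and> par v \<in> nbrs E v \<inter> Ugood \<and> wt v < wt (par v)) \<and>
     (\<forall>v\<in>Ugood. 2 \<le> wt v \<and> wt v \<le> 2 * k + 6) \<and> card {v \<in> Ugood. 3 < (wt v :: nat)} \<le> a + b"
proof -
  \<comment> \<open>Empty outside \<open>Ugood\<close>, because the symmetry hypothesis of
    \<open>increasing_weights_tree\<close> ranges over all vertices.\<close>
  define N where "N v = (if v \<in> Ugood then nbrs E v \<inter> Ugood else {})" for v
  have "\<exists>par wt. (\<forall>v\<in>Ugood. v \<noteq> r \<longrightarrow> par v \<in> Ugood \<and> par v \<in> N v \<and> wt v < wt (par v)) \<and>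
     (\<forall>v\<in>Ugood. 2 \<le> wt v \<and> wt v \<le> 2 * k + 6) \<and> card {v \<in> Ugood. 3 < (wt v :: nat)} \<le> a + b"
  proof (rule increasing_weights_tree)
    show "N v \<subseteq> Ugood" for v
      unfolding N_def by simp
    show "u \<in> N v" if "v \<in> N u" for u v
      using that nbrs_sym unfolding N_def by (auto split: if_splits)
    show "b \<le> g * a" "1 \<le> a"
      by (fact num)+
    fix A assume A: "A \<subseteq> Ugood" "A \<noteq> {}" "card A \<le> a"
    have "g * card A < card (\<Union>x\<in>A. nbrs E x \<inter> Ugood)"
    proof (rule expansion)
      show "g * card A \<le> y0"
        using A(3) num(6) by (meson mult_le_mono2 order_trans)
      show "2 * h \<le> card (nbrs E x \<inter> Ugood)" if "x \<in> A" for x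
        using good_nbrs(1)[of x] that A(1) q_le_n by force
    qed (use A q_le_n num in auto)
    also have "(\<Union>x\<in>A. nbrs E x \<inter> Ugood) = \<Union>(N ` A)"
      using A unfolding N_def by (intro SUP_cong) auto
    finally show "g * card A < card (\<Union>(N ` A))" .
  next
    fix X Y assume XY: "X \<subseteq> Ugood" "Y \<subseteq> Ugood" "X \<inter> Y = {}" "g * a < card X" "b \<le> card Y"
    obtain x y where "x \<in> X" "y \<in> Y" "{x, y} \<in> E"
      using dense[of X Y] XY num(8) q_le_n by force
    thus "\<exists>x\<in>X. \<exists>y\<in>Y. y \<in> N x"
      using XY unfolding N_def nbrs_def by auto
  next
    have "card Ugood \<le> card {..<q}"
      by (intro card_mono) auto
    thus "card Ugood < g ^ k"
      using num(10) q_le_n by simp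
  qed (use assms in auto)
  thus ?thesis
    unfolding N_def by (auto split: if_splits)
qed

text \<open>Each star has one vertex more than its centre needs, so that it survives when one of its vertices
  becomes the attachment point of a vertex that was isolated.\<close>

lemma ex_stars:
  fixes wt :: "nat \<Rightarrow> nat"
  assumes f: "\<forall>s\<in>S. nbrs E s \<noteq> {} \<longrightarrow> f s \<in> nbrs E s - S"
    and wt: "\<And>v. v \<in> Ugood \<Longrightarrow> wt v \<le> 2 * k + 6" "card {v \<in> Ugood. 3 < wt v} \<le> a + b"
  shows "\<exists>star. (\<forall>v\<in>Ugood. star v \<subseteq> nbrs E v \<inter> (Rgood - f ` (S - isolated n E)) \<and> card (star v) = wt v) \<and>
     (\<forall>u\<in>Ugood. \<forall>v\<in>Ugood. u \<noteq> v \<longrightarrow> star u \<inter> star v = {})"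
proof -
  \<comment> \<open>These vertices must keep their weight 1 for the poor vertices that hang off
    them, so they are withheld from the stars.\<close>
  define F where "F = f ` (S - isolated n E)"
  define P where "P = Rgood - F"
  have finF: "finite F" "card F \<le> card S"
  proof -
    show "finite F"
      unfolding F_def using S_props by simp
    have "card F \<le> card (S - isolated n E)"
      unfolding F_def using S_props by (intro card_image_le) simp
    also have "\<dots> \<le> card S"
      using S_props by (intro card_mono) auto
    finally show "card F \<le> card S" .
  qed
  have fS: "f s \<in> nbrs E s - S" if "s \<in> S - isolated n E" for s
    using that f unfolding isolated_def poor_def by auto
  have deg: "2 * h \<le> card (nbrs E v \<inter> P)" if v: "v \<in> Ugood" for v
  proof -
    define Y where "Y = nbrs E v \<inter> F"
    have "\<exists>s. s \<in> S - isolated n E \<and> f s = y" if "y \<in> Y" for y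
      using that unfolding Y_def F_def by blast
    \<comment> \<open>\<open>s\<close> is injective since \<open>f (s y) = y\<close>. Many
      neighbours of \<open>v\<close> lost to \<open>F\<close> would give many paths of length 2 from
      \<open>v\<close> to distinct poor vertices, against \<open>few_poor2\<close>.\<close>
    then obtain s where s: "\<And>y. y \<in> Y \<Longrightarrow> s y \<in> S - isolated n E \<and> f (s y) = y"
      by metis
    have "card Y \<le> c"
    proof (rule few_poor2)
      show "Y \<inter> S = {}"
        using s fS by fastforce
      show "inj_on s Y"
        using s by (metis inj_onI)
      show "s y \<in> nbrs E y \<inter> S" if "y \<in> Y" for y
        using s[OF that] fS[of "s y"] nbrs_props(2)[of y "s y"] by simp
    qed (use v q_le_n in \<open>auto simp: Y_def\<close>)
    moreover have "card (nbrs E v \<inter> Rgood) \<le> card (nbrs E v \<inter> P) + card Y"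
      using nbrs_props(4) unfolding P_def Y_def
      by (intro order.trans[OF card_mono card_Un_le]) auto
    moreover have "2 * h + c \<le> card (nbrs E v \<inter> Rgood)"
      using v q_le_n by (intro good_nbrs(2)) auto
    ultimately show ?thesis
      by linarith
  qed
  have cardP: "n - q - 2 * card S \<le> card P"
  proof -
    have "card {q..<n} \<le> card P + card (S \<union> F)"
      using S_props finF unfolding P_def
      by (intro order.trans[OF card_mono card_Un_le]) auto
    moreover have "card (S \<union> F) \<le> card S + card F"
      by (rule card_Un_le)
    ultimately show ?thesis
      using finF by simp
  qed
  have "\<exists>T. (\<forall>v\<in>Ugood. T v \<subseteq> nbrs E v \<inter> P \<and> card (T v) = wt v) \<and>
     (\<forall>u\<in>Ugood. \<forall>v\<in>Ugood. u \<noteq> v \<longrightarrow> T u \<inter> T v = {})"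
  proof (rule disjoint_stars)
    fix J assume J: "J \<subseteq> Ugood"
    let ?N = "\<lambda>A. \<Union>x\<in>A. nbrs E x \<inter> P"
    have finN: "finite (?N A)" for A
      by (rule finite_subset[of _ P]) (auto simp: P_def)
    define J1 where "J1 = {v \<in> J. wt v \<le> 3}"
    define J2 where "J2 = {v \<in> J. 3 < wt v}"
    have J12: "J = J1 \<union> J2" "J1 \<inter> J2 = {}" "finite J1" "finite J2" "J1 \<subseteq> Ugood" "J2 \<subseteq> Ugood"
      using J finite_subset[OF J] unfolding J1_def J2_def by auto
    \<comment> \<open>The neighbourhoods of \<open>J1\<close> and \<open>J2\<close> may overlap, so
      each is compared with twice the demand of its part and the two halves are added; 6 is twice
      the weight 3.\<close>
    have N1: "6 * card J1 \<le> card (?N J1)"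
    proof (cases "J1 = {} \<or> 6 * card J1 \<le> y0")
      case True
      have "6 * card J1 < card (?N J1)" if "J1 \<noteq> {}"
        using that True J12 deg q_le_n num(3) by (intro expansion) auto
      thus ?thesis
        by fastforce
    next
      case False
      \<comment> \<open>Now \<open>J1\<close> has more than \<open>y0 / 6\<close>, hence at least
        \<open>y1\<close> vertices, so fewer than \<open>b\<close> vertices of \<open>P\<close> are
        not adjacent to it. By \<open>7 * q + 2 * card S + b \<le> n\<close> at least
        \<open>6 * q\<close> neighbours are left.\<close>
      have "card (P - ?N J1) < b"
      proof (rule ccontr)
        assume "\<not> ?thesis"
        hence "\<exists>x\<in>J1. \<exists>y\<in>P - ?N J1. {x, y} \<in> E"
          using False num(12) J12 q_le_n by (intro dense) (auto simp: P_def)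
        thus False
          unfolding nbrs_def by blast
      qed
      moreover have "card P \<le> card (P - ?N J1) + card (?N J1)"
        using finN by (intro order.trans[OF card_mono card_Un_le]) (auto simp: P_def)
      moreover have "card J1 \<le> card {..<q}"
        using J12 by (intro card_mono) auto
      ultimately show ?thesis
        using cardP num(13) by simp
    qed
    have N2: "2 * (2 * k + 6) * card J2 \<le> card (?N J2)"
    proof (cases "J2 = {}")
      case False
      have "card J2 \<le> card {v \<in> Ugood. 3 < wt v}"
        using J12 by (intro card_mono) (auto simp: J2_def)
      hence "2 * (2 * k + 6) * card J2 \<le> 2 * (2 * k + 6) * (a + b)"
        using wt(2) by (intro mult_left_mono) auto
      also have "\<dots> \<le> y0"
        by (fact num(14))
      finally have "2 * (2 * k + 6) * card J2 < card (?N J2)"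
        using num(15) False J12 deg q_le_n by (intro expansion) auto
      thus ?thesis
        by simp
    qed simp
    have N12: "card (?N J1) \<le> card (?N J)" "card (?N J2) \<le> card (?N J)"
      unfolding J12(1) by (rule card_mono[OF finN], blast)+
    have "sum wt J = sum wt J1 + sum wt J2"
      using J12 by (simp add: sum.union_disjoint)
    also have "\<dots> \<le> (\<Sum>v\<in>J1. 3) + (\<Sum>v\<in>J2. 2 * k + 6)"
      using wt(1) J12 by (intro add_mono sum_mono) (auto simp: J1_def)
    finally have "2 * sum wt J \<le> 6 * card J1 + 2 * (2 * k + 6) * card J2"
      by (simp add: algebra_simps)
    thus "sum wt J \<le> card (?N J)"
      using N1 N2 N12 by linarith
  qed (auto simp: P_def)
  thus ?thesis
    unfolding P_def F_def by blast
qed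

text \<open>The order of the quantifiers matters: the stars depend on \<open>E\<close> alone and are
  fixed before the later edges are drawn. That \<open>f2\<close> meets a star twice is then an event
  of the fresh randomness only.\<close>

theorem ex_skeleton:
  "\<exists>star. (\<forall>v\<in>Ugood. star v \<subseteq> Rgood \<and> card (star v) \<le> 2 * k + 6) \<and>
     (\<forall>u\<in>Ugood. \<forall>v\<in>Ugood. u \<noteq> v \<longrightarrow> star u \<inter> star v = {}) \<and>
     (\<forall>E2 f2. E \<subseteq> E2 \<longrightarrow> (\<forall>s\<in>isolated n E. f2 s < n \<and> f2 s \<notin> S \<and> {s, f2 s} \<in> E2) \<longrightarrow>
        (\<forall>v\<in>Ugood. card (star v \<inter> f2 ` isolated n E) \<le> 1) \<longrightarrow> collects_all n E2)"
proof -
  obtain r where r: "r \<in> Ugood"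
    using ex_root by blast
  obtain f where f: "\<forall>s\<in>S. nbrs E s \<noteq> {} \<longrightarrow> f s \<in> nbrs E s - S"
    using ex_attachments by blast
  obtain par and wt :: "nat \<Rightarrow> nat" where tree:
      "\<And>v. v \<in> Ugood \<Longrightarrow> v \<noteq> r \<Longrightarrow> par v \<in> Ugood \<and> par v \<in> nbrs E v \<inter> Ugood \<and> wt v < wt (par v)"
      "\<And>v. v \<in> Ugood \<Longrightarrow> 2 \<le> wt v \<and> wt v \<le> 2 * k + 6" "card {v \<in> Ugood. 3 < wt v} \<le> a + b"
    using ex_tree[OF r] by blast
  have "\<exists>star. (\<forall>v\<in>Ugood. star v \<subseteq> nbrs E v \<inter> (Rgood - f ` (S - isolated n E)) \<and> card (star v) = wt v) \<and>
     (\<forall>u\<in>Ugood. \<forall>v\<in>Ugood. u \<noteq> v \<longrightarrow> star u \<inter> star v = {})"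
    using tree by (intro ex_stars[OF f]) auto
  then obtain star where star:
      "\<And>v. v \<in> Ugood \<Longrightarrow> star v \<subseteq> nbrs E v \<inter> (Rgood - f ` (S - isolated n E)) \<and> card (star v) = wt v"
      "\<And>u v. u \<in> Ugood \<Longrightarrow> v \<in> Ugood \<Longrightarrow> u \<noteq> v \<Longrightarrow> star u \<inter> star v = {}"
    by metis
  have "\<exists>y. y \<in> nbrs E v \<inter> Ugood" if "v \<in> Rgood" for v
    using good_nbrs(1)[of v] that num(3) by (cases "nbrs E v \<inter> Ugood = {}") auto
  then obtain h' where h': "\<And>y. y \<in> Rgood \<Longrightarrow> h' y \<in> nbrs E y \<inter> Ugood"
    by metis
  have "collects_all n E2" if E2: "E \<subseteq> E2"
    "\<And>s. s \<in> isolated n E \<Longrightarrow> f2 s < n \<and> f2 s \<notin> S \<and> {s, f2 s} \<in> E2"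
    "\<And>v. v \<in> Ugood \<Longrightarrow> card (star v \<inter> f2 ` isolated n E) \<le> 1" for E2 f2
  proof -
    have nE: "{v, u} \<in> E2" if "u \<in> nbrs E v" for u v
      using that E2(1) unfolding nbrs_def by blast
    have "\<exists>T. T \<subseteq> star v - f2 ` isolated n E \<and> card T = wt v - 1" if v: "v \<in> Ugood" for v
    proof -
      have fin: "finite (star v)"
        using star(1)[OF v] nbrs_props(4) finite_subset by blast
      have "card (star v) \<le> card (star v - f2 ` isolated n E) + card (star v \<inter> f2 ` isolated n E)"
        using fin by (intro order.trans[OF card_mono card_Un_le]) auto
      hence "wt v - 1 \<le> card (star v - f2 ` isolated n E)"
        using E2(3)[OF v] star(1)[OF v] by linarith
      thus ?thesis
        by (metis obtain_subset_with_card_n)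
    qed
    then obtain T where T: "\<And>v. v \<in> Ugood \<Longrightarrow> T v \<subseteq> star v - f2 ` isolated n E \<and> card (T v) = wt v - 1"
      by metis
    define f' where "f' s = (if nbrs E s = {} then f2 s else f s)" for s
    show ?thesis
    proof (rule collects_all_of_layers)
      show "{..<n} = Ugood \<union> Rgood \<union> S"
        using S_props q_le_n by auto
      show "Ugood \<inter> Rgood = {}" "(Ugood \<union> Rgood) \<inter> S = {}"
        by auto
      show "r \<in> Ugood"
        by (fact r)
      show "par v \<in> Ugood \<and> {v, par v} \<in> E2 \<and> wt v < wt (par v)" if "v \<in> Ugood" "v \<noteq> r" for v
        using tree(1)[OF that] nE by blast
      show "2 \<le> wt v" if "v \<in> Ugood" for v
        using tree(2)[OF that] by blast
      show "T v \<subseteq> Rgood \<and> card (T v) = wt v - 1 \<and> (\<forall>x\<in>T v. {x, v} \<in> E2)" if "v \<in> Ugood" for v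
      proof -
        have "T v \<subseteq> nbrs E v \<inter> Rgood" "card (T v) = wt v - 1"
          using T[OF that] star(1)[OF that] by blast+
        thus ?thesis
          using nE nbrs_sym by (metis IntD1 IntD2 subsetD subsetI)
      qed
      show "T u \<inter> T v = {}" if "u \<in> Ugood" "v \<in> Ugood" "u \<noteq> v" for u v
      proof -
        have "T u \<subseteq> star u" "T v \<subseteq> star v"
          using T that by blast+
        thus ?thesis
          using star(2)[OF that] by blast
      qed
      show "h' y \<in> Ugood \<and> {y, h' y} \<in> E2" if "y \<in> Rgood" for y
        using h'[OF that] nE by blast
      show "f' s \<in> Ugood \<union> Rgood - \<Union>(T ` Ugood) \<and> {s, f' s} \<in> E2" if s: "s \<in> S" for s
      proof (cases "nbrs E s = {}")
        case True
        hence iso: "s \<in> isolated n E"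
          using s S_props unfolding isolated_def by blast
        have "f2 s \<notin> \<Union>(T ` Ugood)"
          using T iso by blast
        thus ?thesis
          using E2(2)[OF iso] True unfolding f'_def by auto
      next
        case False
        hence "s \<in> S - isolated n E"
          using s unfolding isolated_def by blast
        hence "f s \<in> f ` (S - isolated n E)"
          by (rule imageI)
        moreover have "T v \<inter> f ` (S - isolated n E) = {}" if "v \<in> Ugood" for v
          using T[OF that] star(1)[OF that] by blast
        ultimately have "f s \<notin> \<Union>(T ` Ugood)"
          by blast
        moreover have "f s \<in> nbrs E s - S"
          using f s False by blast
        ultimately show ?thesis
          using False nE[of "f s" s] nbrs_props(1)[of "f s" s] unfolding f'_def by auto
      qed
    qed
  qed
  note collects = this
  have "star v \<subseteq> Rgood \<and> card (star v) \<le> 2 * k + 6" if "v \<in> Ugood" for v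
    using star(1)[OF that] tree(2)[OF that] by auto
  note small = this
  show ?thesis
  proof (rule exI[of _ star], intro conjI)
    show "\<forall>v\<in>Ugood. star v \<subseteq> Rgood \<and> card (star v) \<le> 2 * k + 6"
      using small by (intro ballI)
    show "\<forall>u\<in>Ugood. \<forall>v\<in>Ugood. u \<noteq> v \<longrightarrow> star u \<inter> star v = {}"
      using star(2) by (intro ballI impI)
    show "\<forall>E2 f2. E \<subseteq> E2 \<longrightarrow> (\<forall>s\<in>isolated n E. f2 s < n \<and> f2 s \<notin> S \<and> {s, f2 s} \<in> E2) \<longrightarrow>
        (\<forall>v\<in>Ugood. card (star v \<inter> f2 ` isolated n E) \<le> 1) \<longrightarrow> collects_all n E2"
      by (intro allI impI, rule collects, assumption, erule bspec, assumption, erule bspec)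
  qed
qed

end

section \<open>Uniformly random sets of fixed size\<close>

definition subsets_of_card :: "'a set \<Rightarrow> nat \<Rightarrow> 'a set set" where
  "subsets_of_card K m = {E. E \<subseteq> K \<and> card E = m}"

text \<open>The uniform distribution on \<open>m\<close>-subsets, kept as a quotient of counts so
  that all estimates are finite sums. For finite \<open>K\<close> and \<open>m > card K\<close> it
  is 0 / 0 = 0.\<close>

definition rprob :: "'a set \<Rightarrow> nat \<Rightarrow> ('a set \<Rightarrow> bool) \<Rightarrow> real" where
  "rprob K m P = card {E \<in> subsets_of_card K m. P E} / (card K choose m)"

lemma finite_subsets_of_card: "finite K \<Longrightarrow> finite (subsets_of_card K m)"
  unfolding subsets_of_card_def by simp

lemma card_subsets_of_card: "finite K \<Longrightarrow> card (subsets_of_card K m) = card K choose m"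
  unfolding subsets_of_card_def by (rule n_subsets)

lemma rprob_nonneg: "0 \<le> rprob K m P"
  unfolding rprob_def by simp

lemma rprob_mono:
  assumes "finite K" "\<And>E. E \<subseteq> K \<Longrightarrow> card E = m \<Longrightarrow> P E \<Longrightarrow> Q E"
  shows "rprob K m P \<le> rprob K m Q"
  unfolding rprob_def using assms finite_subsets_of_card[OF assms(1)]
  by (intro divide_right_mono) (auto intro!: card_mono simp: subsets_of_card_def)

lemma rprob_UN:
  assumes "finite K" "finite I"
  shows "rprob K m (\<lambda>E. \<exists>i\<in>I. P i E) \<le> (\<Sum>i\<in>I. rprob K m (P i))"
proof -
  have "card {E \<in> subsets_of_card K m. \<exists>i\<in>I. P i E} = card (\<Union>i\<in>I. {E \<in> subsets_of_card K m. P i E})"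
    by (rule arg_cong[of _ _ card]) auto
  also have "\<dots> \<le> (\<Sum>i\<in>I. card {E \<in> subsets_of_card K m. P i E})"
    by (rule card_UN_le[OF assms(2)])
  finally show ?thesis
    unfolding rprob_def sum_divide_distrib[symmetric]
    by (intro divide_right_mono) (simp_all flip: of_nat_sum)
qed

lemma rprob_UN_bound:
  assumes "finite K" "finite I" "\<And>i. i \<in> I \<Longrightarrow> rprob K m (P i) \<le> B" "real (card I) \<le> M" "0 \<le> B"
  shows "rprob K m (\<lambda>E. \<exists>i\<in>I. P i E) \<le> M * B"
proof -
  have "(\<Sum>i\<in>I. rprob K m (P i)) \<le> (\<Sum>i\<in>I. B)"
    by (intro sum_mono assms)
  also have "\<dots> \<le> M * B"
    using assms(4,5) by (simp add: mult_right_mono)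
  finally show ?thesis
    using rprob_UN[OF assms(1,2), of m P] by simp
qed

lemma rprob_disj:
  assumes "finite K"
  shows "rprob K m (\<lambda>E. P E \<or> Q E) \<le> rprob K m P + rprob K m Q"
proof -
  have "card {E \<in> subsets_of_card K m. P E \<or> Q E} =
      card ({E \<in> subsets_of_card K m. P E} \<union> {E \<in> subsets_of_card K m. Q E})"
    by (rule arg_cong[of _ _ card]) auto
  also have "\<dots> \<le> card {E \<in> subsets_of_card K m. P E} + card {E \<in> subsets_of_card K m. Q E}"
    by (rule card_Un_le)
  finally show ?thesis
    unfolding rprob_def add_divide_distrib[symmetric]
    by (intro divide_right_mono) (simp_all flip: of_nat_add)
qed

text \<open>Markov's inequality, by double counting pairs of an outcome \<open>E\<close> and an
  element \<open>v\<close> with \<open>Q v E\<close>.\<close>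

lemma rprob_markov:
  assumes "finite K" "finite V" "0 < t"
  shows "rprob K m (\<lambda>E. t \<le> real (card {v \<in> V. Q v E})) \<le> (\<Sum>v\<in>V. rprob K m (Q v)) / t"
proof -
  let ?A = "subsets_of_card K m"
  let ?B = "{E \<in> ?A. t \<le> real (card {v \<in> V. Q v E})}"
  note fin = finite_subsets_of_card[OF assms(1), of m]
  have "t * card ?B = (\<Sum>E\<in>?B. t)"
    by simp
  also have "\<dots> \<le> (\<Sum>E\<in>?B. real (card {v \<in> V. Q v E}))"
    by (intro sum_mono) simp
  also have "\<dots> \<le> (\<Sum>E\<in>?A. real (card {v \<in> V. Q v E}))"
    using fin by (intro sum_mono2) auto
  also have "\<dots> = (\<Sum>E\<in>?A. \<Sum>v\<in>V. if Q v E then 1 else 0)"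
    using assms(2) by (intro sum.cong refl) (simp add: sum.If_cases Int_def)
  also have "\<dots> = (\<Sum>v\<in>V. \<Sum>E\<in>?A. if Q v E then 1 else 0)"
    by (rule sum.swap)
  also have "\<dots> = (\<Sum>v\<in>V. real (card {E \<in> ?A. Q v E}))"
    using fin by (intro sum.cong refl) (simp add: sum.If_cases Int_def)
  finally have "real (card ?B) \<le> (\<Sum>v\<in>V. real (card {E \<in> ?A. Q v E})) / t"
    using assms(3) by (simp add: field_simps)
  hence "real (card ?B) / (card K choose m) \<le>
      (\<Sum>v\<in>V. real (card {E \<in> ?A. Q v E})) / t / (card K choose m)"
    by (rule divide_right_mono) simp
  thus ?thesis
    unfolding rprob_def sum_divide_distrib[symmetric] by (simp add: field_simps)
qed

text \<open>The quotient of the two binomials is a product of factors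
  \<open>(m - i) / (N - i)\<close>, each at most \<open>m / N\<close>.\<close>

lemma binomial_pick_le:
  assumes "f \<le> m" "m \<le> N"
  shows "real ((N - f) choose (m - f)) \<le> (m / N) ^ f * (N choose m)"
  using assms(1)
proof (induction f)
  case (Suc f)
  let ?N = "N - f" and ?m = "m - f"
  have pos: "0 < ?m" "0 < ?N" "?m \<le> ?N"
    using Suc.prems assms(2) by auto
  have "?N * ((?N - 1) choose (?m - 1)) = ?m * (?N choose ?m)"
    using times_binomial_minus1_eq[OF pos(1), of ?N] by simp
  hence "real ?N * real ((?N - 1) choose (?m - 1)) = real ?m * real (?N choose ?m)"
    by (metis of_nat_mult)
  hence "real ((?N - 1) choose (?m - 1)) = (real ?m / real ?N) * real (?N choose ?m)"
    using pos by (simp add: field_simps)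
  also have "\<dots> \<le> (m / N) * ((m / N) ^ f * (N choose m))"
  proof (rule mult_mono)
    have "real f * real m \<le> real f * real N"
      using assms(2) by (intro mult_left_mono) auto
    thus "real ?m / real ?N \<le> m / N"
      using Suc.prems assms(2) by (simp add: of_nat_diff field_simps)
    show "real (?N choose ?m) \<le> (m / N) ^ f * (N choose m)"
      using Suc by simp
  qed auto
  finally show ?case
    by simp
qed simp

text \<open>Here the factors are \<open>1 - l / (M - i)\<close>, each at most
  \<open>1 - l / M\<close>.\<close>

lemma binomial_avoid_le:
  assumes "l \<le> M" "y \<le> M"
  shows "real ((M - y) choose l) \<le> (1 - l / M) ^ y * (M choose l)"
  using assms(2)
proof (induction y)
  case (Suc y)
  let ?M = "M - y"
  have pos: "0 < ?M"
    using Suc.prems by simp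
  show ?case
  proof (cases "l \<le> ?M - 1")
    case True
    have "(?M - l) * (?M choose l) = ?M * ((?M - 1) choose l)"
      by (rule binomial_absorb_comp)
    hence "real (?M - l) * real (?M choose l) = real ?M * real ((?M - 1) choose l)"
      by (metis of_nat_mult)
    hence "real ((?M - 1) choose l) = (1 - real l / real ?M) * real (?M choose l)"
      using pos True by (simp add: field_simps of_nat_diff)
    also have "\<dots> \<le> (1 - l / M) * real (?M choose l)"
      using pos by (intro mult_right_mono diff_mono divide_left_mono) auto
    also have "\<dots> \<le> (1 - l / M) * ((1 - l / M) ^ y * (M choose l))"
      using Suc assms(1) by (intro mult_left_mono) (auto simp: divide_le_eq)
    finally show ?thesis
      by simp
  next
    case False
    hence *: "(M - Suc y) choose l = 0"
      using pos by (intro binomial_eq_0) simp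
    have "0 \<le> (1 - l / M) ^ Suc y * (M choose l)"
      using assms(1) by (intro mult_nonneg_nonneg zero_le_power) (auto simp: divide_le_eq)
    thus ?thesis
      unfolding * by simp
  qed
qed simp

lemma card_subsets_contain_avoid:
  assumes "finite K" "F \<subseteq> K" "Y \<subseteq> K" "F \<inter> Y = {}" "card F \<le> m"
  shows "card {E \<in> subsets_of_card K m. F \<subseteq> E \<and> E \<inter> Y = {}} =
    (card K - card F - card Y) choose (m - card F)"
proof -
  note fin = finite_subset[OF assms(2,1)] finite_subset[OF assms(3,1)]
  have "card {E \<in> subsets_of_card K m. F \<subseteq> E \<and> E \<inter> Y = {}} =
      card (subsets_of_card (K - F - Y) (m - card F))"
  proof (rule bij_betw_same_card[of "\<lambda>E. E - F"], rule bij_betwI[where g = "\<lambda>E. E \<union> F"])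
    show "(\<lambda>E. E - F) \<in> {E \<in> subsets_of_card K m. F \<subseteq> E \<and> E \<inter> Y = {}} \<rightarrow>
        subsets_of_card (K - F - Y) (m - card F)"
      using fin by (auto simp: subsets_of_card_def card_Diff_subset)
    show "(\<lambda>E. E \<union> F) \<in> subsets_of_card (K - F - Y) (m - card F) \<rightarrow>
        {E \<in> subsets_of_card K m. F \<subseteq> E \<and> E \<inter> Y = {}}"
    proof (intro funcsetI CollectI conjI)
      fix E assume E: "E \<in> subsets_of_card (K - F - Y) (m - card F)"
      hence E': "E \<subseteq> K - F - Y" "card E = m - card F" "finite E"
        using assms(1) finite_subset unfolding subsets_of_card_def by auto
      have "card (E \<union> F) = card E + card F"
        using E' fin by (intro card_Un_disjoint) auto
      thus "E \<union> F \<in> subsets_of_card K m"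
        using E' assms unfolding subsets_of_card_def by auto
    qed (use assms in \<open>auto simp: subsets_of_card_def\<close>)
  qed (auto simp: subsets_of_card_def)
  also have "\<dots> = card (K - F - Y) choose (m - card F)"
    using assms(1) by (intro card_subsets_of_card) simp
  also have "card (K - F - Y) = card K - card F - card Y"
  proof -
    have "Y \<subseteq> K - F"
      using assms(3,4) by blast
    thus ?thesis
      using fin assms(2) by (simp add: card_Diff_subset)
  qed
  finally show ?thesis .
qed

text \<open>Given \<open>F \<subseteq> E\<close>, the rest of \<open>E\<close> is a uniform subset
  of \<open>K - F\<close> of size \<open>m - card F\<close>; writing \<open>card K\<close> for
  \<open>card K - card F\<close> in its density only weakens the bound. If
  \<open>card F > m\<close>, the event is empty.\<close>

lemma rprob_contain_avoid:
  assumes "finite K" "F \<subseteq> K" "Y \<subseteq> K" "F \<inter> Y = {}" "m \<le> card K"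
  shows "rprob K m (\<lambda>E. F \<subseteq> E \<and> E \<inter> Y = {}) \<le>
    (m / card K) ^ card F * (1 - real (m - card F) / card K) ^ card Y"
proof (cases "card F \<le> m")
  case True
  let ?N = "card K" and ?f = "card F" and ?y = "card Y"
  have le: "?f + ?y \<le> ?N"
    using assms finite_subset[OF assms(2,1)] finite_subset[OF assms(3,1)]
    by (metis card_Un_disjoint card_mono le_sup_iff)
  have "card {E \<in> subsets_of_card K m. F \<subseteq> E \<and> E \<inter> Y = {}} = (?N - ?f - ?y) choose (m - ?f)"
    using assms True by (intro card_subsets_contain_avoid)
  also have "real \<dots> \<le> (1 - real (m - ?f) / real (?N - ?f)) ^ ?y * real ((?N - ?f) choose (m - ?f))"
    using le assms(5) by (intro binomial_avoid_le) auto
  also have "\<dots> \<le> (1 - real (m - ?f) / real ?N) ^ ?y * ((m / ?N) ^ ?f * (?N choose m))"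
  proof (intro mult_mono power_mono)
    show "real ((?N - ?f) choose (m - ?f)) \<le> (m / ?N) ^ ?f * (?N choose m)"
      using True assms(5) by (rule binomial_pick_le)
    have "real (m - ?f) / real ?N \<le> real (m - ?f) / real (?N - ?f)"
      by (cases "?N - ?f = 0") (use True assms(5) in \<open>auto intro!: divide_left_mono\<close>)
    thus "1 - real (m - ?f) / real (?N - ?f) \<le> 1 - real (m - ?f) / real ?N"
      by simp
    show "0 \<le> 1 - real (m - ?f) / real (?N - ?f)"
      using assms(5) True by (simp add: divide_le_eq of_nat_diff)
    show "0 \<le> (1 - real (m - ?f) / real ?N) ^ ?y"
      using assms(5) by (intro zero_le_power) (auto simp: divide_le_eq)
  qed auto
  finally show ?thesis
    using assms(5) unfolding rprob_def by (simp add: field_simps)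
next
  case False
  have "\<not> F \<subseteq> E" if "E \<in> subsets_of_card K m" for E
    using that False card_mono[of E F] finite_subset[of E K] assms(1) unfolding subsets_of_card_def
    by auto
  hence "{E \<in> subsets_of_card K m. F \<subseteq> E \<and> E \<inter> Y = {}} = {}"
    by blast
  hence "rprob K m (\<lambda>E. F \<subseteq> E \<and> E \<inter> Y = {}) = 0"
    unfolding rprob_def by (simp only: card.empty of_nat_0 div_0)
  also have "0 \<le> (m / card K) ^ card F * (1 - real (m - card F) / card K) ^ card Y"
    using assms(5) by (intro mult_nonneg_nonneg zero_le_power) (auto simp: divide_le_eq)
  finally show ?thesis .
qed

lemma rprob_contain:
  assumes "finite K" "F \<subseteq> K" "m \<le> card K"
  shows "rprob K m (\<lambda>E. F \<subseteq> E) \<le> (m / card K) ^ card F"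
  using rprob_contain_avoid[OF assms(1,2), of "{}" m] assms(3) by simp

text \<open>Thinning: \<open>z ^ card (E \<inter> X)\<close> is the probability that \<open>E\<close> misses a random subset of \<open>X\<close>
  which contains each point independently with probability \<open>1 - z\<close>.\<close>

lemma rprob_contain_few:
  assumes "finite K" "F \<subseteq> K" "X \<subseteq> K" "F \<inter> X = {}" "m \<le> card K" "0 < z" "z \<le> 1"
  shows "rprob K m (\<lambda>E. F \<subseteq> E \<and> card (E \<inter> X) \<le> t) \<le>
    (1 / z) ^ t * (m / card K) ^ card F * exp (- ((1 - z) * (real (m - card F) / card K) * card X))"
proof -
  let ?A = "{E \<in> subsets_of_card K m. F \<subseteq> E}"
  define \<theta> where "\<theta> = real (m - card F) / card K"
  have \<theta>: "0 \<le> \<theta>" "\<theta> \<le> 1"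
    using assms(5) unfolding \<theta>_def by (auto simp: divide_le_eq)
  have fin: "finite X" "finite ?A"
    using finite_subset[OF assms(3,1)] finite_subsets_of_card[OF assms(1)] by auto
  \<comment> \<open>The factor of \<open>e\<close> is \<open>z\<close> if \<open>e \<in> E\<close>
    and \<open>(1 - z) + z = 1\<close> otherwise; expanding the product gives the sum over
    \<open>Y\<close>.\<close>
  have thin: "z ^ card (E \<inter> X) =
      (\<Sum>Y\<in>Pow X. (1 - z) ^ card Y * z ^ card (X - Y) * (if E \<inter> Y = {} then 1 else 0))" for E
  proof -
    have "z ^ card (E \<inter> X) = (\<Prod>e\<in>X. if e \<in> E then z else 1)"
      using fin(1) by (simp add: prod.If_cases Int_commute)
    also have "\<dots> = (\<Prod>e\<in>X. (if e \<in> E then 0 else 1 - z) + z)"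
      by (intro prod.cong) auto
    also have "\<dots> = (\<Sum>Y\<in>Pow X. (\<Prod>e\<in>Y. if e \<in> E then 0 else 1 - z) * (\<Prod>e\<in>X - Y. z))"
      by (rule prod_add[OF fin(1)])
    also have "\<dots> = (\<Sum>Y\<in>Pow X. (1 - z) ^ card Y * z ^ card (X - Y) * (if E \<inter> Y = {} then 1 else 0))"
    proof (rule sum.cong)
      fix Y assume "Y \<in> Pow X"
      hence finY: "finite Y"
        using fin(1) finite_subset by auto
      have "(\<Prod>e\<in>Y. if e \<in> E then 0 else 1 - z) = (1 - z) ^ card Y * (if E \<inter> Y = {} then 1 else 0)"
      proof (cases "E \<inter> Y = {}")
        case True
        hence "(\<Prod>e\<in>Y. if e \<in> E then 0 else 1 - z) = (\<Prod>e\<in>Y. 1 - z)"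
          by (intro prod.cong) auto
        thus ?thesis
          using True by simp
      next
        case False
        then obtain e where "e \<in> Y" "e \<in> E"
          by blast
        hence "(\<Prod>e\<in>Y. if e \<in> E then 0 else 1 - z) = 0"
          using finY by (intro prod_zero bexI[of _ e]) auto
        thus ?thesis
          using False by simp
      qed
      thus "(\<Prod>e\<in>Y. if e \<in> E then 0 else 1 - z) * (\<Prod>e\<in>X - Y. z) =
          (1 - z) ^ card Y * z ^ card (X - Y) * (if E \<inter> Y = {} then 1 else 0)"
        by simp
    qed simp
    finally show ?thesis .
  qed
  \<comment> \<open>Exponential Markov inequality: on the event,
    \<open>z ^ t \<le> z ^ card (E \<inter> X)\<close>.\<close>
  have "z ^ t * card {E \<in> subsets_of_card K m. F \<subseteq> E \<and> card (E \<inter> X) \<le> t} =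
      (\<Sum>E\<in>{E \<in> ?A. card (E \<inter> X) \<le> t}. z ^ t)"
  proof -
    have "{E \<in> subsets_of_card K m. F \<subseteq> E \<and> card (E \<inter> X) \<le> t} = {E \<in> ?A. card (E \<inter> X) \<le> t}"
      by blast
    thus ?thesis
      by (simp add: mult.commute)
  qed
  also have "\<dots> \<le> (\<Sum>E\<in>{E \<in> ?A. card (E \<inter> X) \<le> t}. z ^ card (E \<inter> X))"
    using assms(6,7) by (intro sum_mono power_decreasing) auto
  also have "\<dots> \<le> (\<Sum>E\<in>?A. z ^ card (E \<inter> X))"
    using fin assms(6) by (intro sum_mono2) auto
  also have "\<dots> = (\<Sum>Y\<in>Pow X. \<Sum>E\<in>?A. (1 - z) ^ card Y * z ^ card (X - Y) * (if E \<inter> Y = {} then 1 else 0))"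
    unfolding thin by (rule sum.swap)
  also have "\<dots> = (\<Sum>Y\<in>Pow X. (1 - z) ^ card Y * z ^ card (X - Y) *
      (rprob K m (\<lambda>E. F \<subseteq> E \<and> E \<inter> Y = {}) * (card K choose m)))"
  proof (rule sum.cong)
    fix Y
    have "(\<Sum>E\<in>?A. if E \<inter> Y = {} then 1 else 0) =
        real (card {E \<in> subsets_of_card K m. F \<subseteq> E \<and> E \<inter> Y = {}})"
      using fin(2) by (simp add: sum.If_cases Int_def conj_assoc)
    thus "(\<Sum>E\<in>?A. (1 - z) ^ card Y * z ^ card (X - Y) * (if E \<inter> Y = {} then 1 else 0)) =
        (1 - z) ^ card Y * z ^ card (X - Y) *
        (rprob K m (\<lambda>E. F \<subseteq> E \<and> E \<inter> Y = {}) * (card K choose m))"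
      using assms(5) unfolding rprob_def sum_distrib_left[symmetric] by simp
  qed simp
  also have "\<dots> \<le> (\<Sum>Y\<in>Pow X. (1 - z) ^ card Y * z ^ card (X - Y) *
      ((m / card K) ^ card F * (1 - \<theta>) ^ card Y * (card K choose m)))"
    using assms unfolding \<theta>_def
    by (intro sum_mono mult_left_mono mult_right_mono rprob_contain_avoid) auto
  \<comment> \<open>The bound for avoiding \<open>Y\<close> is itself a product over
    \<open>Y\<close>, so the expansion can be undone.\<close>
  also have "\<dots> = (m / card K) ^ card F * (card K choose m) *
      (\<Sum>Y\<in>Pow X. (\<Prod>e\<in>Y. (1 - z) * (1 - \<theta>)) * (\<Prod>e\<in>X - Y. z))"
    by (simp add: sum_distrib_left power_mult_distrib mult_ac)
  also have "(\<Sum>Y\<in>Pow X. (\<Prod>e\<in>Y. (1 - z) * (1 - \<theta>)) * (\<Prod>e\<in>X - Y. z)) =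
      (\<Prod>e\<in>X. (1 - z) * (1 - \<theta>) + z)"
    by (rule prod_add[OF fin(1), symmetric])
  also have "\<dots> = (1 - (1 - z) * \<theta>) ^ card X"
    by (simp add: algebra_simps)
  also have "\<dots> \<le> exp (- ((1 - z) * \<theta>)) ^ card X"
  proof (rule power_mono)
    show "1 - (1 - z) * \<theta> \<le> exp (- ((1 - z) * \<theta>))"
      using exp_ge_add_one_self[of "- ((1 - z) * \<theta>)"] by simp
    show "0 \<le> 1 - (1 - z) * \<theta>"
      using \<theta> assms(6,7) mult_le_one[of "1 - z" \<theta>] by simp
  qed
  also have "\<dots> = exp (- ((1 - z) * \<theta> * card X))"
    by (simp add: exp_of_nat_mult[symmetric] mult_ac)
  finally have "z ^ t * card {E \<in> subsets_of_card K m. F \<subseteq> E \<and> card (E \<inter> X) \<le> t} \<le>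
      (m / card K) ^ card F * (card K choose m) * exp (- ((1 - z) * \<theta> * card X))"
    by (simp add: mult_left_mono)
  also have "\<dots> = (m / card K) ^ card F * exp (- ((1 - z) * \<theta> * card X)) * (card K choose m)"
    by (simp add: mult_ac)
  finally have "real (card {E \<in> subsets_of_card K m. F \<subseteq> E \<and> card (E \<inter> X) \<le> t}) \<le>
      (m / card K) ^ card F * exp (- ((1 - z) * \<theta> * card X)) * (card K choose m) / z ^ t"
    using assms(6) by (simp add: pos_le_divide_eq mult.commute)
  hence "rprob K m (\<lambda>E. F \<subseteq> E \<and> card (E \<inter> X) \<le> t) \<le>
      (m / card K) ^ card F * exp (- ((1 - z) * \<theta> * card X)) * (card K choose m) / z ^ t / (card K choose m)"
    unfolding rprob_def by (rule divide_right_mono) simp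
  also have "\<dots> = (1 / z) ^ t * (m / card K) ^ card F * exp (- ((1 - z) * \<theta> * card X))"
    using assms(5) by (simp add: power_one_over)
  finally show ?thesis
    unfolding \<theta>_def .
qed

text \<open>Two-round exposure: an ordering amounts to the set \<open>E\<close> of its first
  \<open>m\<close> entries, an ordering of \<open>E\<close> and one of the rest.
  \<open>\<Phi>\<close> sees the beginning only as a set, which yields the factor
  \<open>fact m\<close>.\<close>

lemma card_permutations_split:
  assumes "finite K" "m \<le> card K"
  shows "card {\<sigma> \<in> permutations_of_set K. \<Phi> (set (take m \<sigma>)) (drop m \<sigma>)} =
    (\<Sum>E\<in>subsets_of_card K m. fact m * card {ys \<in> permutations_of_set (K - E). \<Phi> E ys})"
proof -
  let ?S = "\<lambda>E. (\<lambda>(xs, ys). xs @ ys) ` (permutations_of_set E \<times> {ys \<in> permutations_of_set (K - E). \<Phi> E ys})"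
  have len: "length xs = m" if "E \<in> subsets_of_card K m" "xs \<in> permutations_of_set E" for E xs
    using that length_finite_permutations_of_set unfolding subsets_of_card_def by auto
  have eq: "{\<sigma> \<in> permutations_of_set K. \<Phi> (set (take m \<sigma>)) (drop m \<sigma>)} = (\<Union>E\<in>subsets_of_card K m. ?S E)"
  proof (intro subset_antisym subsetI)
    fix \<sigma> assume "\<sigma> \<in> {\<sigma> \<in> permutations_of_set K. \<Phi> (set (take m \<sigma>)) (drop m \<sigma>)}"
    hence \<sigma>: "\<sigma> \<in> permutations_of_set K" "\<Phi> (set (take m \<sigma>)) (drop m \<sigma>)"
      by auto
    have d: "distinct \<sigma>" "set \<sigma> = K"
      using permutations_of_setD[OF \<sigma>(1)] by auto
    have "length \<sigma> = card K"
      using \<sigma>(1) by (rule length_finite_permutations_of_set)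
    hence "card (set (take m \<sigma>)) = m"
      using d(1) assms(2) by (simp add: distinct_card)
    hence 1: "set (take m \<sigma>) \<in> subsets_of_card K m"
      using d(2) set_take_subset[of m \<sigma>] unfolding subsets_of_card_def by simp
    have "set (take m \<sigma>) \<union> set (drop m \<sigma>) = K" "set (take m \<sigma>) \<inter> set (drop m \<sigma>) = {}"
      using d by (metis append_take_drop_id set_append, metis append_take_drop_id distinct_append)
    hence "set (drop m \<sigma>) = K - set (take m \<sigma>)"
      by blast
    hence "\<sigma> \<in> ?S (set (take m \<sigma>))"
      using d(1) \<sigma>(2) by (intro image_eqI[of _ _ "(take m \<sigma>, drop m \<sigma>)"]) auto
    thus "\<sigma> \<in> (\<Union>E\<in>subsets_of_card K m. ?S E)"
      using 1 by blast
  next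
    fix \<sigma> assume "\<sigma> \<in> (\<Union>E\<in>subsets_of_card K m. ?S E)"
    then obtain E xs ys where *: "E \<in> subsets_of_card K m" "\<sigma> = xs @ ys" "xs \<in> permutations_of_set E"
      "ys \<in> permutations_of_set (K - E)" "\<Phi> E ys"
      by auto
    thus "\<sigma> \<in> {\<sigma> \<in> permutations_of_set K. \<Phi> (set (take m \<sigma>)) (drop m \<sigma>)}"
      using len[OF *(1,3)] permutations_of_setD[OF *(3)] permutations_of_setD[OF *(4)]
      by (auto simp: subsets_of_card_def intro!: permutations_of_setI)
  qed
  have disj: "?S E \<inter> ?S E' = {}" if "E \<in> subsets_of_card K m" "E' \<in> subsets_of_card K m" "E \<noteq> E'" for E E'
  proof (rule ccontr)
    assume "?S E \<inter> ?S E' \<noteq> {}"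
    then obtain xs ys xs' ys' where *: "xs \<in> permutations_of_set E" "xs' \<in> permutations_of_set E'"
      "xs @ ys = xs' @ ys'"
      by auto
    hence "xs = xs'"
      using len that by (metis append_eq_append_conv)
    thus False
      using *(1,2) that(3) permutations_of_setD(1) by metis
  qed
  have "card (?S E) = fact m * card {ys \<in> permutations_of_set (K - E). \<Phi> E ys}"
    if E: "E \<in> subsets_of_card K m" for E
  proof -
    have "finite E"
      using E assms(1) finite_subset unfolding subsets_of_card_def by auto
    have "inj_on (\<lambda>(xs, ys). xs @ ys) (permutations_of_set E \<times> {ys \<in> permutations_of_set (K - E). \<Phi> E ys})"
      using len[OF E] by (auto simp: inj_on_def)
    thus ?thesis
      using E \<open>finite E\<close> by (subst card_image) (auto simp: card_cartesian_product subsets_of_card_def)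
  qed
  hence "(\<Sum>E\<in>subsets_of_card K m. card (?S E)) =
    (\<Sum>E\<in>subsets_of_card K m. fact m * card {ys \<in> permutations_of_set (K - E). \<Phi> E ys})"
    by (intro sum.cong) auto
  moreover have "card (\<Union>E\<in>subsets_of_card K m. ?S E) = (\<Sum>E\<in>subsets_of_card K m. card (?S E))"
    by (rule card_UN_disjoint)
      (use disj finite_subsets_of_card[OF assms(1)] in \<open>auto simp: finite_cartesian_product\<close>)
  ultimately show ?thesis
    unfolding eq by simp
qed

lemma card_permutations_prefix:
  assumes "finite K" "m \<le> card K"
  shows "card {\<sigma> \<in> permutations_of_set K. P (set (take m \<sigma>))} = fact (card K) * rprob K m P"
proof -
  have "card {\<sigma> \<in> permutations_of_set K. P (set (take m \<sigma>))} =
      (\<Sum>E\<in>subsets_of_card K m. fact m * card {ys \<in> permutations_of_set (K - E). P E})"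
    by (rule card_permutations_split[OF assms, of "\<lambda>E _. P E"])
  also have "\<dots> = (\<Sum>E\<in>subsets_of_card K m. fact m * (if P E then fact (card K - m) else 0))"
  proof (intro sum.cong refl)
    fix E assume "E \<in> subsets_of_card K m"
    hence "card (K - E) = card K - m" "finite (K - E)"
      using assms(1) finite_subset[of E K] unfolding subsets_of_card_def by (auto simp: card_Diff_subset)
    thus "fact m * card {ys \<in> permutations_of_set (K - E). P E} =
        fact m * (if P E then fact (card K - m) else 0)"
      by simp
  qed
  also have "\<dots> = fact m * fact (card K - m) * card {E \<in> subsets_of_card K m. P E}"
    using finite_subsets_of_card[OF assms(1), of m]
    by (simp add: sum_distrib_left[symmetric] sum.If_cases Int_def mult_ac)
  finally have "real (card {\<sigma> \<in> permutations_of_set K. P (set (take m \<sigma>))}) =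
      real (fact m * fact (card K - m) * card {E \<in> subsets_of_card K m. P E})"
    by simp
  moreover have "real (fact m * fact (card K - m) * (card K choose m)) = real (fact (card K))"
    using binomial_fact_lemma[OF assms(2)] by simp
  moreover have "real (card K choose m) \<noteq> 0"
    using assms(2) by simp
  ultimately show ?thesis
    unfolding rprob_def by (simp add: field_simps)
qed

definition order_prob :: "'a set \<Rightarrow> ('a list \<Rightarrow> bool) \<Rightarrow> real" where
  "order_prob K P = measure_pmf.prob (pmf_of_set (permutations_of_set K)) {\<sigma>. P \<sigma>}"

lemma order_prob_altdef:
  assumes "finite K"
  shows "order_prob K P = card {\<sigma> \<in> permutations_of_set K. P \<sigma>} / fact (card K)"
  unfolding order_prob_def using assms
  by (subst measure_pmf_of_set) (auto simp: Int_def)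

lemma order_prob_prefix:
  assumes "finite K" "m \<le> card K"
  shows "order_prob K (\<lambda>\<sigma>. P (set (take m \<sigma>))) = rprob K m P"
  using card_permutations_prefix[OF assms, of P] order_prob_altdef[OF assms(1)] by simp

text \<open>Given the set \<open>E\<close> of the first \<open>m\<close> entries, the next
  \<open>j\<close> form a uniform \<open>j\<close>-subset of \<open>K - E\<close>. A bound valid for
  every \<open>E\<close> with \<open>P E\<close> survives averaging over \<open>E\<close>.\<close>

lemma order_prob_two_prefixes:
  assumes "finite K" "m + j \<le> card K" "0 \<le> \<beta>"
    and "\<And>E. E \<subseteq> K \<Longrightarrow> card E = m \<Longrightarrow> P E \<Longrightarrow> rprob (K - E) j (Q E) \<le> \<beta>"
  shows "order_prob K (\<lambda>\<sigma>. P (set (take m \<sigma>)) \<and> Q (set (take m \<sigma>)) (set (take j (drop m \<sigma>)))) \<le> \<beta>"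
proof -
  let ?N = "card K"
  let ?\<Phi> = "\<lambda>E ys. P E \<and> Q E (set (take j ys))"
  have mN: "m \<le> ?N"
    using assms(2) by simp
  have "real (card {\<sigma> \<in> permutations_of_set K. ?\<Phi> (set (take m \<sigma>)) (drop m \<sigma>)}) =
      (\<Sum>E\<in>subsets_of_card K m. fact m * real (card {ys \<in> permutations_of_set (K - E). ?\<Phi> E ys}))"
    by (subst card_permutations_split[OF assms(1) mN]) simp
  also have "\<dots> \<le> (\<Sum>E\<in>subsets_of_card K m. fact m * (fact (?N - m) * \<beta>))"
  proof (intro sum_mono mult_left_mono)
    fix E assume "E \<in> subsets_of_card K m"
    hence E: "E \<subseteq> K" "card E = m" "card (K - E) = ?N - m" "finite (K - E)"
      using assms(1) finite_subset[of E K] unfolding subsets_of_card_def by (auto simp: card_Diff_subset)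
    show "real (card {ys \<in> permutations_of_set (K - E). ?\<Phi> E ys}) \<le> fact (?N - m) * \<beta>"
    proof (cases "P E")
      case True
      have "real (card {ys \<in> permutations_of_set (K - E). Q E (set (take j ys))}) =
          fact (?N - m) * rprob (K - E) j (Q E)"
        using card_permutations_prefix[OF E(4), of j "Q E"] E(3) assms(2) by simp
      also have "\<dots> \<le> fact (?N - m) * \<beta>"
        using assms(4)[OF E(1,2) True] by (intro mult_left_mono) auto
      finally show ?thesis
        using True by simp
    qed (use assms(3) in auto)
  qed auto
  also have "\<dots> = real (?N choose m) * (fact m * (fact (?N - m) * \<beta>))"
    using card_subsets_of_card[OF assms(1), of m] by simp
  also have "\<dots> = real (fact m * fact (?N - m) * (?N choose m)) * \<beta>"
    by simp
  also have "\<dots> = fact ?N * \<beta>"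
    by (subst binomial_fact_lemma[OF mN]) simp
  finally show ?thesis
    using order_prob_altdef[OF assms(1)] by (simp add: divide_le_eq mult.commute)
qed

section \<open>Poor and isolated vertices of a random graph\<close>

lemma Kn_edges_altdef: "Kn_edges n = {e. e \<subseteq> {..<n} \<and> card e = 2}"
  unfolding Kn_edges_def card_2_iff by auto

lemma finite_Kn_edges: "finite (Kn_edges n)"
  unfolding Kn_edges_altdef by simp

lemma card_Kn_edges: "card (Kn_edges n) = n choose 2"
  unfolding Kn_edges_altdef using n_subsets[of "{..<n}" 2] by simp

lemma edge_in_Kn: "u < n \<Longrightarrow> v < n \<Longrightarrow> u \<noteq> v \<Longrightarrow> {u, v} \<in> Kn_edges n"
  unfolding Kn_edges_def by blast

lemma nbrs_subset: "E \<subseteq> Kn_edges n \<Longrightarrow> nbrs E v \<subseteq> {..<n} - {v}"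
  using Kn_edges_endpoints[of v _ E n] unfolding nbrs_def by fastforce

lemma finite_nbrs: "E \<subseteq> Kn_edges n \<Longrightarrow> finite (nbrs E v)"
  by (rule finite_subset[OF nbrs_subset]) auto

text \<open>By \<open>Zdisj\<close> the edges from \<open>s\<close> to \<open>Z s\<close> are
  different for different \<open>s\<close>, so the conditions merge into one bound on
  \<open>card (E \<inter> X)\<close> and no independence is required.\<close>

lemma rprob_few_nbrs:
  fixes n m :: nat and t :: "nat \<Rightarrow> nat"
  defines "K \<equiv> Kn_edges n"
  assumes FK: "F \<subseteq> K" and T: "T \<subseteq> {..<n}"
    and Z: "\<And>s. s \<in> T \<Longrightarrow> Z s \<subseteq> {..<n} \<and> s \<notin> Z s"
    and Zdisj: "\<And>s s'. s \<in> T \<Longrightarrow> s' \<in> T \<Longrightarrow> s \<noteq> s' \<Longrightarrow> s' \<notin> Z s"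
    and ZF: "\<And>s z. s \<in> T \<Longrightarrow> z \<in> Z s \<Longrightarrow> {s, z} \<notin> F"
    and m: "m \<le> card K" and z: "0 < z" "z \<le> 1"
  shows "rprob K m (\<lambda>E. F \<subseteq> E \<and> (\<forall>s\<in>T. card (nbrs E s \<inter> Z s) \<le> t s)) \<le>
    (1 / z) ^ sum t T * (m / card K) ^ card F *
    exp (- ((1 - z) * (real (m - card F) / card K) * (\<Sum>s\<in>T. card (Z s))))"
proof -
  define X where "X = (\<Union>s\<in>T. (\<lambda>z. {s, z}) ` Z s)"
  have finT: "finite T"
    using T finite_subset by blast
  have finZ: "finite (Z s)" if "s \<in> T" for s
    using Z[OF that] finite_subset by blast
  have inj: "inj_on (\<lambda>z. {s, z}) A" for s and A :: "nat set"
    by (auto simp: inj_on_def doubleton_eq_iff)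
  have cardX: "card X = (\<Sum>s\<in>T. card (Z s))"
  proof -
    have "card X = (\<Sum>s\<in>T. card ((\<lambda>z. {s, z}) ` Z s))"
      unfolding X_def
    proof (rule card_UN_disjoint[OF finT])
      show "\<forall>s\<in>T. finite ((\<lambda>z. {s, z}) ` Z s)"
        using finZ by blast
      show "\<forall>s\<in>T. \<forall>s'\<in>T. s \<noteq> s' \<longrightarrow> (\<lambda>z. {s, z}) ` Z s \<inter> (\<lambda>z. {s', z}) ` Z s' = {}"
        using Zdisj by (fastforce simp: doubleton_eq_iff)
    qed
    thus ?thesis
      using inj by (simp add: card_image)
  qed
  have XK: "X \<subseteq> K"
    unfolding X_def K_def using Z T by (fastforce intro!: edge_in_Kn)
  have FX: "F \<inter> X = {}"
    unfolding X_def using ZF by blast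
  have "rprob K m (\<lambda>E. F \<subseteq> E \<and> (\<forall>s\<in>T. card (nbrs E s \<inter> Z s) \<le> t s)) \<le>
      rprob K m (\<lambda>E. F \<subseteq> E \<and> card (E \<inter> X) \<le> sum t T)"
  proof (rule rprob_mono)
    fix E assume E: "F \<subseteq> E \<and> (\<forall>s\<in>T. card (nbrs E s \<inter> Z s) \<le> t s)"
    have "E \<inter> X = (\<Union>s\<in>T. (\<lambda>z. {s, z}) ` (nbrs E s \<inter> Z s))"
      unfolding X_def nbrs_def by blast
    hence "card (E \<inter> X) \<le> (\<Sum>s\<in>T. card ((\<lambda>z. {s, z}) ` (nbrs E s \<inter> Z s)))"
      using card_UN_le[OF finT] by simp
    also have "\<dots> = (\<Sum>s\<in>T. card (nbrs E s \<inter> Z s))"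
      using inj by (simp add: card_image)
    also have "\<dots> \<le> sum t T"
      using E by (intro sum_mono) blast
    finally show "F \<subseteq> E \<and> card (E \<inter> X) \<le> sum t T"
      using E by blast
  qed (simp add: K_def finite_Kn_edges)
  also have "\<dots> \<le> (1 / z) ^ sum t T * (m / card K) ^ card F *
      exp (- ((1 - z) * (real (m - card F) / card K) * card X))"
    using FK XK FX m z by (intro rprob_contain_few) (simp_all add: K_def finite_Kn_edges)
  finally show ?thesis
    unfolding cardX by simp
qed

text \<open>The exponential moment bound for a vertex to be poor, after at most \<open>w\<close> vertices and edges of a fixed
  configuration have been excluded.\<close>

definition poor_weight :: "nat \<Rightarrow> nat \<Rightarrow> nat \<Rightarrow> nat \<Rightarrow> real \<Rightarrow> nat \<Rightarrow> real" where
  "poor_weight n q d m z w = 2 * (1 / z) ^ d *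
     exp (- ((1 - z) * (real (m - w) / (n choose 2)) * real (q - w)))"

lemma poor_weight_nonneg: "0 < z \<Longrightarrow> 0 \<le> poor_weight n q d m z w"
  unfolding poor_weight_def by simp

text \<open>A poor vertex lacks neighbours on one of the two sides; \<open>T1\<close> guesses where
  it is the small one, and the \<open>2 ^ card T\<close> guesses are the factor 2 in
  \<open>poor_weight\<close>. Deleting \<open>W\<close> from the sides makes the rows disjoint from
  each other and from \<open>F\<close>. Both sides have at least \<open>q\<close> vertices because
  \<open>2 * q \<le> n\<close>.\<close>

lemma rprob_poor:
  fixes n m :: nat
  assumes W: "W \<subseteq> {..<n}" "card W \<le> w" "T \<subseteq> W" "F \<subseteq> Pow W" "F \<subseteq> Kn_edges n" "card F \<le> w"
    and m: "m \<le> n choose 2" and z: "0 < z" "z \<le> 1" and q: "2 * q \<le> n"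
  shows "rprob (Kn_edges n) m (\<lambda>E. F \<subseteq> E \<and> T \<subseteq> poor n q d E) \<le>
    (m / (n choose 2)) ^ card F * poor_weight n q d m z w ^ card T"
proof -
  let ?K = "Kn_edges n" and ?N = "n choose 2"
  define Z where "Z T1 s = (if s \<in> T1 then {..<q} else {q..<n}) - W" for T1 and s :: nat
  define P where "P T1 E \<longleftrightarrow> F \<subseteq> E \<and> (\<forall>s\<in>T. card (nbrs E s \<inter> Z T1 s) \<le> d)" for T1 E
  have finW: "finite W" "finite T"
    using W(1,3) finite_subset by (blast, metis finite_lessThan finite_subset)
  have "rprob ?K m (\<lambda>E. F \<subseteq> E \<and> T \<subseteq> poor n q d E) \<le> rprob ?K m (\<lambda>E. \<exists>T1\<in>Pow T. P T1 E)"
  proof (rule rprob_mono[OF finite_Kn_edges])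
    fix E assume E: "E \<subseteq> ?K" "F \<subseteq> E \<and> T \<subseteq> poor n q d E"
    define T1 where "T1 = {s \<in> T. card (nbrs E s \<inter> {..<q}) < d}"
    have "card (nbrs E s \<inter> Z T1 s) \<le> d" if s: "s \<in> T" for s
    proof -
      have "card (nbrs E s \<inter> Z T1 s) \<le> card (nbrs E s \<inter> (if s \<in> T1 then {..<q} else {q..<n}))"
        using finite_nbrs[OF E(1)] unfolding Z_def by (intro card_mono) auto
      also have "\<dots> \<le> d"
        using E(2) s unfolding T1_def poor_def good_def by auto
      finally show ?thesis .
    qed
    thus "\<exists>T1\<in>Pow T. P T1 E"
      using E(2) unfolding P_def T1_def by blast
  qed
  also have "\<dots> \<le> 2 ^ card T * ((1 / z) ^ (card T * d) * (m / ?N) ^ card F *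
      exp (- ((1 - z) * (real (m - w) / ?N) * real (card T * (q - w)))))"
  proof (rule rprob_UN_bound[OF finite_Kn_edges])
    show "finite (Pow T)" "real (card (Pow T)) \<le> 2 ^ card T"
      using finW by (simp_all add: card_Pow)
    fix T1 assume "T1 \<in> Pow T"
    have cardZ: "q - w \<le> card (Z T1 s)" for s
    proof -
      have "q \<le> card (if s \<in> T1 then {..<q} else {q..<n})"
        using q by auto
      also have "\<dots> \<le> card (Z T1 s) + card W"
        using finW unfolding Z_def by (intro order.trans[OF card_mono card_Un_le]) auto
      finally show ?thesis
        using W(2) by linarith
    qed
    have "card T * (q - w) \<le> (\<Sum>s\<in>T. card (Z T1 s))"
      using cardZ by (metis sum_bounded_below of_nat_id)
    hence sumZ: "real (card T * (q - w)) \<le> real (\<Sum>s\<in>T. card (Z T1 s))"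
      by (simp only: of_nat_le_iff)
    have "rprob ?K m (P T1) \<le> (1 / z) ^ sum (\<lambda>_. d) T * (m / card ?K) ^ card F *
        exp (- ((1 - z) * (real (m - card F) / card ?K) * (\<Sum>s\<in>T. card (Z T1 s))))"
      unfolding P_def
    proof (rule rprob_few_nbrs)
      show "T \<subseteq> {..<n}"
        using W by blast
      show "Z T1 s \<subseteq> {..<n} \<and> s \<notin> Z T1 s" if "s \<in> T" for s
        using that W(3) q unfolding Z_def by auto
      show "s' \<notin> Z T1 s" if "s' \<in> T" for s s'
        using that W(3) unfolding Z_def by auto
      show "{s, y} \<notin> F" if "y \<in> Z T1 s" for s y
        using that W(4) unfolding Z_def by auto
    qed (use W m z in \<open>auto simp: card_Kn_edges\<close>)
    also have "\<dots> \<le> (1 / z) ^ (card T * d) * (m / ?N) ^ card F *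
        exp (- ((1 - z) * (real (m - w) / ?N) * real (card T * (q - w))))"
    proof -
      have "(1 - z) * (real (m - w) / ?N) * real (card T * (q - w)) \<le>
          (1 - z) * (real (m - card F) / ?N) * (\<Sum>s\<in>T. card (Z T1 s))"
        using z W(6) sumZ by (intro mult_mono mult_left_mono divide_right_mono) auto
      thus ?thesis
        using z by (simp add: card_Kn_edges mult_left_mono)
    qed
    finally show "rprob ?K m (P T1) \<le> (1 / z) ^ (card T * d) * (m / ?N) ^ card F *
        exp (- ((1 - z) * (real (m - w) / ?N) * real (card T * (q - w))))" .
  qed (use z in simp)
  also have "\<dots> = (m / ?N) ^ card F * poor_weight n q d m z w ^ card T"
  proof -
    have "exp (- ((1 - z) * (real (m - w) / ?N) * real (card T * (q - w)))) =
        exp (- ((1 - z) * (real (m - w) / ?N) * real (q - w))) ^ card T"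
      by (simp add: exp_of_nat_mult[symmetric] mult_ac)
    thus ?thesis
      unfolding poor_weight_def by (simp add: power_mult_distrib power_mult[symmetric] mult_ac)
  qed
  finally show ?thesis .
qed

abbreviation many_poor_nbrs :: "nat \<Rightarrow> nat \<Rightarrow> nat \<Rightarrow> nat \<Rightarrow> nat set set \<Rightarrow> bool" where
  "many_poor_nbrs n q d c E \<equiv> \<exists>v<n. c \<le> card (nbrs E v \<inter> poor n q d E)"

abbreviation many_poor_paths :: "nat \<Rightarrow> nat \<Rightarrow> nat \<Rightarrow> nat \<Rightarrow> nat set set \<Rightarrow> bool" where
  "many_poor_paths n q d c E \<equiv> \<exists>v Y f. v < n \<and> v \<notin> poor n q d E \<and> Y \<subseteq> nbrs E v \<and>
     Y \<inter> poor n q d E = {} \<and> inj_on f Y \<and> (\<forall>y\<in>Y. f y \<in> nbrs E y \<inter> poor n q d E) \<and> c \<le> card Y"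

abbreviation low_next_to_poor :: "nat \<Rightarrow> nat \<Rightarrow> nat \<Rightarrow> nat \<Rightarrow> nat set set \<Rightarrow> bool" where
  "low_next_to_poor n q d c E \<equiv> \<exists>s<n. card (nbrs E s) \<le> c \<and> nbrs E s \<inter> poor n q d E \<noteq> {}"

abbreviation dense_pair :: "nat \<Rightarrow> nat \<Rightarrow> nat \<Rightarrow> nat set set \<Rightarrow> bool" where
  "dense_pair n h y0 E \<equiv> \<exists>A Y g. A \<subseteq> {..<n} \<and> Y \<subseteq> {..<n} \<and> A \<noteq> {} \<and> 1 \<le> g \<and> 4 * g \<le> h \<and>
     card Y = g * card A \<and> g * card A \<le> y0 \<and> (\<forall>x\<in>A. 2 * h \<le> card (nbrs E x \<inter> Y))"

abbreviation separated_pair :: "nat \<Rightarrow> nat \<Rightarrow> nat \<Rightarrow> nat set set \<Rightarrow> bool" where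
  "separated_pair n y1 b E \<equiv> \<exists>X Y. X \<subseteq> {..<n} \<and> Y \<subseteq> {..<n} \<and> X \<inter> Y = {} \<and> y1 \<le> card X \<and> b \<le> card Y \<and>
     (\<forall>x\<in>X. \<forall>y\<in>Y. {x, y} \<notin> E)"

context
  fixes n m q d w :: nat and z p \<beta> :: real
  assumes m: "m \<le> n choose 2" and z: "0 < z" "z \<le> 1" and q: "2 * q \<le> n"
  defines "p \<equiv> m / (n choose 2)" and "\<beta> \<equiv> poor_weight n q d m z w"
begin

lemma p_nonneg: "0 \<le> p"
  unfolding p_def by simp

lemma \<beta>_nonneg: "0 \<le> \<beta>"
  unfolding \<beta>_def using z by (intro poor_weight_nonneg)

lemma card_subsets_le_power: "real (card {T. T \<subseteq> A \<and> card T = c}) \<le> real (card A) ^ c"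
  if "finite A"
proof -
  have "card A choose c \<le> card A ^ c"
    using binomial_fact_pow[of "card A" c] by (metis fact_ge_1 mult.right_neutral mult_le_mono2 order.trans)
  thus ?thesis
    using that by (simp add: n_subsets flip: of_nat_power)
qed

text \<open>Union bound over \<open>v\<close> and \<open>c\<close> of its poor neighbours:
  \<open>n\<close> and at most \<open>n ^ c\<close> choices, \<open>p\<close> for each edge,
  \<open>\<beta>\<close> for each poor vertex.\<close>

lemma rprob_many_poor_nbrs:
  assumes "c + 1 \<le> w"
  shows "rprob (Kn_edges n) m (many_poor_nbrs n q d c) \<le>
    n * (n * p * \<beta>) ^ c"
proof -
  let ?K = "Kn_edges n"
  let ?I = "{..<n} \<times> {T. T \<subseteq> {..<n} \<and> card T = c}"
  let ?P = "\<lambda>(v, T) E. v \<notin> T \<and> (\<lambda>s. {v, s}) ` T \<subseteq> E \<and> T \<subseteq> poor n q d E"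
  have "rprob ?K m (many_poor_nbrs n q d c) \<le>
      rprob ?K m (\<lambda>E. \<exists>i\<in>?I. ?P i E)"
  proof (rule rprob_mono[OF finite_Kn_edges])
    fix E assume E: "E \<subseteq> ?K" "many_poor_nbrs n q d c E"
    then obtain v where v: "v < n" "c \<le> card (nbrs E v \<inter> poor n q d E)"
      by blast
    then obtain T where T: "T \<subseteq> nbrs E v \<inter> poor n q d E" "card T = c"
      by (metis obtain_subset_with_card_n)
    hence "(v, T) \<in> ?I" "?P (v, T) E"
      using v nbrs_subset[OF E(1), of v] by (auto simp: nbrs_def)
    thus "\<exists>i\<in>?I. ?P i E"
      by (rule bexI[rotated])
  qed
  also have "\<dots> \<le> real n * real n ^ c * (p ^ c * \<beta> ^ c)"
  proof (rule rprob_UN_bound[OF finite_Kn_edges])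
    show "finite ?I"
      by simp
    show "real (card ?I) \<le> real n * real n ^ c"
      using card_subsets_le_power[of "{..<n}" c] by (simp add: card_cartesian_product mult_left_mono)
    show "0 \<le> p ^ c * \<beta> ^ c"
      using p_nonneg \<beta>_nonneg by simp
    fix i assume i: "i \<in> ?I"
    obtain v T where vT: "i = (v, T)"
      by (cases i)
    show "rprob ?K m (?P i) \<le> p ^ c * \<beta> ^ c"
    proof (cases "v \<notin> T")
      case True
      let ?F = "(\<lambda>s. {v, s}) ` T"
      have T: "T \<subseteq> {..<n}" "card T = c" "v < n" "finite T"
        using i vT finite_subset[of T "{..<n}"] by auto
      have cF: "card ?F = c"
        using T(2) by (subst card_image) (auto simp: inj_on_def doubleton_eq_iff)
      have "rprob ?K m (\<lambda>E. ?F \<subseteq> E \<and> T \<subseteq> poor n q d E) \<le> p ^ card ?F * \<beta> ^ card T"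
        unfolding p_def \<beta>_def
      proof (rule rprob_poor[where W = "insert v T"])
        show "card (insert v T) \<le> w"
          using T True assms by simp
        show "card ?F \<le> w"
          using cF assms by simp
        show "?F \<subseteq> ?K"
          using T True by (auto intro!: edge_in_Kn)
      qed (use T m z q in auto)
      thus ?thesis
        using cF T(2) True vT by simp
    next
      case False
      thus ?thesis
        using p_nonneg \<beta>_nonneg vT by (simp add: rprob_def)
    qed
  qed
  also have "\<dots> = n * (n * p * \<beta>) ^ c"
    by (simp add: power_mult_distrib)
  finally show ?thesis .
qed

text \<open>A family of \<open>c\<close> vertex-disjoint paths \<open>v - y - f y\<close> with poor ends is encoded by the graph of \<open>f\<close>.\<close>

lemma rprob_many_poor_second_nbrs:
  assumes "2 * c + 1 \<le> w"
  shows "rprob (Kn_edges n) m (many_poor_paths n q d c) \<le>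
    n * ((n * p)\<^sup>2 * \<beta>) ^ c"
proof -
  let ?K = "Kn_edges n"
  let ?I = "{..<n} \<times> {G. G \<subseteq> {..<n} \<times> {..<n} \<and> card G = c}"
  let ?F = "\<lambda>v G. (\<lambda>(y, s). {v, y}) ` G \<union> (\<lambda>(y, s). {y, s}) ` G"
  let ?C = "\<lambda>v G. inj_on fst G \<and> inj_on snd G \<and> v \<notin> fst ` G \<union> snd ` G \<and> fst ` G \<inter> snd ` G = {}"
  let ?P = "\<lambda>(v, G) E. ?C v G \<and> ?F v G \<subseteq> E \<and> snd ` G \<subseteq> poor n q d E"
  have "rprob ?K m (many_poor_paths n q d c) \<le>
      rprob ?K m (\<lambda>E. \<exists>i\<in>?I. ?P i E)"
  proof (rule rprob_mono[OF finite_Kn_edges])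
    fix E assume E: "E \<subseteq> ?K" "many_poor_paths n q d c E"
    then obtain v Y f where *: "v < n" "v \<notin> poor n q d E" "Y \<subseteq> nbrs E v"
      "Y \<inter> poor n q d E = {}" "inj_on f Y" "\<And>y. y \<in> Y \<Longrightarrow> f y \<in> nbrs E y \<inter> poor n q d E" "c \<le> card Y"
      by auto
    obtain Y' where Y': "Y' \<subseteq> Y" "card Y' = c"
      using *(7) by (metis obtain_subset_with_card_n)
    define G where "G = (\<lambda>y. (y, f y)) ` Y'"
    have Yn: "y < n" "y \<noteq> v" if "y \<in> Y" for y
      using that *(3) nbrs_subset[OF E(1), of v] by auto
    have fn: "f y < n" if "y \<in> Y" for y
      using *(6)[OF that] nbrs_subset[OF E(1), of y] by auto
    have "card G = c"
      unfolding G_def using Y'(2) by (subst card_image) (auto simp: inj_on_def)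
    hence "(v, G) \<in> ?I"
      using *(1) Yn fn Y'(1) unfolding G_def by auto
    moreover have "inj_on fst G" "inj_on snd G"
      using *(5) Y'(1) unfolding G_def by (auto simp: inj_on_def)
    moreover have "v \<notin> fst ` G \<union> snd ` G"
      using Yn(2) Y'(1) *(2,6) unfolding G_def by (auto simp: image_image)
    moreover have "fst ` G \<inter> snd ` G = {}"
      using *(4,6) Y'(1) unfolding G_def by fastforce
    moreover have "?F v G \<subseteq> E" "snd ` G \<subseteq> poor n q d E"
      using *(3,6) Y'(1) unfolding G_def nbrs_def by auto
    ultimately show "\<exists>i\<in>?I. ?P i E"
      by (intro bexI[of _ "(v, G)"]) simp_all
  qed
  also have "\<dots> \<le> real n * (real n ^ 2) ^ c * (p ^ (2 * c) * \<beta> ^ c)"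
  proof (rule rprob_UN_bound[OF finite_Kn_edges])
    show "finite ?I"
      by simp
    show "real (card ?I) \<le> real n * (real n ^ 2) ^ c"
      using card_subsets_le_power[of "{..<n} \<times> {..<n}" c]
      by (simp add: card_cartesian_product mult_left_mono power2_eq_square)
    show "0 \<le> p ^ (2 * c) * \<beta> ^ c"
      using p_nonneg \<beta>_nonneg by simp
    fix i assume i: "i \<in> ?I"
    obtain v G where vG: "i = (v, G)"
      by (cases i)
    show "rprob ?K m (?P i) \<le> p ^ (2 * c) * \<beta> ^ c"
    proof (cases "?C v G")
      case True
      have G: "G \<subseteq> {..<n} \<times> {..<n}" "card G = c" "v < n" "finite G"
        using i vG finite_subset[of G "{..<n} \<times> {..<n}"] by auto
      let ?A = "(\<lambda>(y, s). {v, y}) ` G" and ?B = "(\<lambda>(y, s). {y, s}) ` G"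
      have mem: "y \<in> fst ` G" "s \<in> snd ` G" if "(y, s) \<in> G" for y s
        using that by force+
      have cA: "card ?A = c"
        unfolding G(2)[symmetric]
      proof (intro card_image inj_onI)
        fix a b assume ab: "a \<in> G" "b \<in> G" "(\<lambda>(y, s). {v, y}) a = (\<lambda>(y, s). {v, y}) b"
        hence "fst a = fst b"
          by (auto simp: doubleton_eq_iff case_prod_beta)
        thus "a = b"
          using True ab(1,2) by (auto dest: inj_onD)
      qed
      have cB: "card ?B = c"
        unfolding G(2)[symmetric]
      proof (intro card_image inj_onI)
        fix a b assume ab: "a \<in> G" "b \<in> G" "(\<lambda>(y, s). {y, s}) a = (\<lambda>(y, s). {y, s}) b"
        have "fst a \<noteq> snd b"
          using True ab(1,2) by blast
        hence "fst a = fst b"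
          using ab(3) by (auto simp: doubleton_eq_iff case_prod_beta)
        thus "a = b"
          using True ab(1,2) by (auto dest: inj_onD)
      qed
      \<comment> \<open>The first edges of the paths contain \<open>v\<close> and the second ones do
        not, so exactly \<open>2 * c\<close> edges are prescribed.\<close>
      have "v \<in> e" if "e \<in> ?A" for e
        using that by auto
      moreover have "v \<notin> e" if "e \<in> ?B" for e
        using that True mem by auto
      ultimately have "?A \<inter> ?B = {}"
        by (metis (no_types) disjoint_iff)
      hence cF: "card (?F v G) = 2 * c"
        using cA cB G(4) by (subst card_Un_disjoint) auto
      have cS: "card (snd ` G) = c"
        using True G(2) by (simp add: card_image)
      have cW: "card (insert v (fst ` G \<union> snd ` G)) \<le> w"
        using G(4) True G(2) card_Un_le[of "fst ` G" "snd ` G"] assms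
        by (simp add: card_image)
      have "rprob ?K m (\<lambda>E. ?F v G \<subseteq> E \<and> snd ` G \<subseteq> poor n q d E) \<le>
          p ^ card (?F v G) * \<beta> ^ card (snd ` G)"
        unfolding p_def \<beta>_def
      proof (rule rprob_poor[where W = "insert v (fst ` G \<union> snd ` G)"])
        show "insert v (fst ` G \<union> snd ` G) \<subseteq> {..<n}"
          using G by auto
        show "?F v G \<subseteq> Pow (insert v (fst ` G \<union> snd ` G))"
          using mem by auto
        show "?F v G \<subseteq> ?K"
        proof
          fix e assume "e \<in> ?F v G"
          then obtain y s where "(y, s) \<in> G" "e = {v, y} \<or> e = {y, s}"
            by auto
          moreover from this have "y \<noteq> v" "y \<noteq> s" "y < n" "s < n"
            using True mem[of y s] G(1) by auto
          ultimately show "e \<in> ?K"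
            using G(3) by (auto intro!: edge_in_Kn)
        qed
        show "card (?F v G) \<le> w"
          using cF assms by simp
      qed (use cW m z q in auto)
      thus ?thesis
        using cF cS True vG by simp
    next
      case False
      hence "rprob ?K m (?P i) = 0"
        unfolding vG rprob_def by (simp only: prod.case) simp
      thus ?thesis
        using p_nonneg \<beta>_nonneg by simp
    qed
  qed
  also have "\<dots> = n * ((n * p)\<^sup>2 * \<beta>) ^ c"
    by (simp add: power_mult_distrib power_mult)
  finally show ?thesis .
qed

text \<open>\<open>s\<close> is adjacent to few of all vertices and \<open>u\<close> to few on one
  side. These rows share no edge once \<open>s\<close> and \<open>u\<close> are removed, so the
  exponents add up to about \<open>p * (n + q)\<close>. The part \<open>p * n\<close> alone would
  not beat the factor \<open>n\<^sup>2 * p\<close> of the union bound.\<close>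

lemma rprob_low_next_to_poor:
  shows "rprob (Kn_edges n) m (low_next_to_poor n q d c) \<le>
    2 * (real n)\<^sup>2 * p * (1 / z) ^ (c + d) *
    exp (- ((1 - z) * (real (m - 1) / (n choose 2)) * real (n - 2 + (q - 2))))"
proof -
  let ?K = "Kn_edges n" and ?N = "n choose 2"
  let ?B = "p * (1 / z) ^ (c + d) * exp (- ((1 - z) * (real (m - 1) / ?N) * real (n - 2 + (q - 2))))"
  define side where "side b = (if b then {..<q} else {q..<n})" for b
  let ?I = "{..<n} \<times> {..<n} \<times> (UNIV :: bool set)"
  let ?P = "\<lambda>(s, u, b) E. s \<noteq> u \<and> {s, u} \<in> E \<and> card (nbrs E s) \<le> c \<and> card (nbrs E u \<inter> side b) \<le> d"
  have B0: "0 \<le> ?B"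
    using p_nonneg z by simp
  have "rprob ?K m (low_next_to_poor n q d c) \<le>
      rprob ?K m (\<lambda>E. \<exists>i\<in>?I. ?P i E)"
  proof (rule rprob_mono[OF finite_Kn_edges])
    fix E assume E: "E \<subseteq> ?K" "low_next_to_poor n q d c E"
    then obtain s u where *: "s < n" "card (nbrs E s) \<le> c" "u \<in> nbrs E s" "u \<in> poor n q d E"
      by blast
    hence "u < n" "s \<noteq> u" "{s, u} \<in> E"
      using nbrs_subset[OF E(1), of s] by (auto simp: nbrs_def)
    moreover have "card (nbrs E u \<inter> side True) \<le> d \<or> card (nbrs E u \<inter> side False) \<le> d"
      using *(4) unfolding poor_def good_def side_def by auto
    then obtain b where "card (nbrs E u \<inter> side b) \<le> d"
      by metis
    ultimately have "(s, u, b) \<in> ?I" "?P (s, u, b) E"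
      using * by auto
    thus "\<exists>i\<in>?I. ?P i E"
      by blast
  qed
  also have "\<dots> \<le> 2 * (real n)\<^sup>2 * ?B"
  proof (rule rprob_UN_bound[OF finite_Kn_edges])
    show "finite ?I" "real (card ?I) \<le> 2 * (real n)\<^sup>2"
      by (simp_all add: card_cartesian_product power2_eq_square)
    fix i assume i: "i \<in> ?I"
    obtain s u b where i_eq: "i = (s, u, b)"
      by (cases i)
    show "rprob ?K m (?P i) \<le> ?B"
    proof (cases "s = u")
      case False
      have su: "s < n" "u < n"
        using i i_eq by auto
      define Z where "Z x = (if x = s then {..<n} - {s, u} else side b - {s, u})" for x
      define t where "t x = (if x = s then c else d)" for x
      have side: "side b \<subseteq> {..<n}" "q \<le> card (side b)" "finite (side b)"
        using q unfolding side_def by auto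
      have "rprob ?K m (?P i) \<le>
          rprob ?K m (\<lambda>E. {{s, u}} \<subseteq> E \<and> (\<forall>x\<in>{s, u}. card (nbrs E x \<inter> Z x) \<le> t x))"
      proof (rule rprob_mono[OF finite_Kn_edges])
        fix E assume E: "E \<subseteq> ?K" "?P i E"
        have "card (nbrs E s \<inter> Z s) \<le> card (nbrs E s)" "card (nbrs E u \<inter> Z u) \<le> card (nbrs E u \<inter> side b)"
          using finite_nbrs[OF E(1)] False unfolding Z_def by (auto intro!: card_mono)
        thus "{{s, u}} \<subseteq> E \<and> (\<forall>x\<in>{s, u}. card (nbrs E x \<inter> Z x) \<le> t x)"
          using E(2) False unfolding i_eq t_def by auto
      qed
      also have "\<dots> \<le> (1 / z) ^ sum t {s, u} * (m / card ?K) ^ card {{s, u}} *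
          exp (- ((1 - z) * (real (m - card {{s, u}}) / card ?K) * (\<Sum>x\<in>{s, u}. card (Z x))))"
        by (rule rprob_few_nbrs)
          (use su False side m z in \<open>auto simp: Z_def doubleton_eq_iff card_Kn_edges intro!: edge_in_Kn\<close>)
      also have "\<dots> = (1 / z) ^ (c + d) * p *
          exp (- ((1 - z) * (real (m - 1) / ?N) * (card (Z s) + card (Z u))))"
        using False unfolding t_def p_def by (simp add: card_Kn_edges)
      also have "\<dots> \<le> (1 / z) ^ (c + d) * p *
          exp (- ((1 - z) * (real (m - 1) / ?N) * real (n - 2 + (q - 2))))"
      proof -
        have "card {s, u} = 2"
          using False by simp
        have "card (Z s) = n - 2"
          using su False unfolding Z_def by (simp add: card_Diff_subset)
        moreover have "q - 2 \<le> card (Z u)"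
          using diff_card_le_card_Diff[of "{s, u}" "side b"] side(2) False unfolding Z_def by simp
        ultimately have "real (n - 2 + (q - 2)) \<le> real (card (Z s) + card (Z u))"
          by simp
        hence "(1 - z) * (real (m - 1) / ?N) * real (n - 2 + (q - 2)) \<le>
            (1 - z) * (real (m - 1) / ?N) * (card (Z s) + card (Z u))"
          using z by (intro mult_left_mono) auto
        thus ?thesis
          using z p_nonneg by (intro mult_left_mono) auto
      qed
      finally show ?thesis
        by (simp add: mult_ac)
    next
      case True
      hence "rprob ?K m (?P i) = 0"
        unfolding i_eq rprob_def by simp
      thus ?thesis
        using B0 by simp
    qed
  qed (fact B0)
  finally show ?thesis
    by (simp add: mult_ac)
qed

lemma rprob_poor_large:
  assumes "1 \<le> w" "0 < t"
  shows "rprob (Kn_edges n) m (\<lambda>E. t \<le> real (card (poor n q d E))) \<le> n * \<beta> / t"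
proof -
  have eq: "{v \<in> {..<n}. v \<in> poor n q d E} = poor n q d E" for E
    unfolding poor_def by auto
  have "rprob (Kn_edges n) m (\<lambda>E. t \<le> real (card {v \<in> {..<n}. v \<in> poor n q d E})) \<le>
      (\<Sum>v<n. rprob (Kn_edges n) m (\<lambda>E. v \<in> poor n q d E)) / t"
    by (rule rprob_markov[OF finite_Kn_edges _ assms(2)]) simp
  also have "(\<Sum>v<n. rprob (Kn_edges n) m (\<lambda>E. v \<in> poor n q d E)) \<le> (\<Sum>v<n. \<beta>)"
  proof (rule sum_mono)
    fix v assume "v \<in> {..<n}"
    hence "rprob (Kn_edges n) m (\<lambda>E. {} \<subseteq> E \<and> {v} \<subseteq> poor n q d E) \<le>
        (m / (n choose 2)) ^ card ({} :: nat set set) * \<beta> ^ card {v}"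
      unfolding \<beta>_def using assms(1) m z q by (intro rprob_poor[where W = "{v}"]) auto
    thus "rprob (Kn_edges n) m (\<lambda>E. v \<in> poor n q d E) \<le> \<beta>"
      by simp
  qed
  finally show ?thesis
    unfolding eq using assms(2) by (simp add: divide_right_mono)
qed

end

lemma rprob_vertex_isolated:
  fixes n m :: nat
  defines "p \<equiv> m / (n choose 2)"
  assumes m: "m \<le> n choose 2" and "v < n"
  shows "rprob (Kn_edges n) m (\<lambda>E. v \<in> isolated n E) \<le> exp (- (p * real (n - 1)))"
proof -
  let ?Y = "(\<lambda>u. {v, u}) ` ({..<n} - {v})"
  have "rprob (Kn_edges n) m (\<lambda>E. v \<in> isolated n E) \<le> rprob (Kn_edges n) m (\<lambda>E. {} \<subseteq> E \<and> E \<inter> ?Y = {})"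
    by (rule rprob_mono[OF finite_Kn_edges]) (auto simp: isolated_def nbrs_def)
  also have "\<dots> \<le> (m / card (Kn_edges n)) ^ card ({} :: nat set set) *
      (1 - real (m - card ({} :: nat set set)) / card (Kn_edges n)) ^ card ?Y"
    using \<open>v < n\<close> m by (intro rprob_contain_avoid[OF finite_Kn_edges])
      (auto simp: card_Kn_edges intro!: edge_in_Kn)
  also have "\<dots> = (1 - p) ^ card ?Y"
    unfolding p_def by (simp add: card_Kn_edges)
  also have "card ?Y = n - 1"
    using \<open>v < n\<close> by (subst card_image) (auto simp: inj_on_def doubleton_eq_iff)
  also have "(1 - p) ^ (n - 1) \<le> exp (- p) ^ (n - 1)"
    using m exp_ge_add_one_self[of "- p"] unfolding p_def
    by (intro power_mono) (auto simp: divide_le_eq)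
  also have "\<dots> = exp (- (p * real (n - 1)))"
    by (simp add: exp_of_nat_mult[symmetric] mult_ac)
  finally show ?thesis .
qed

lemma rprob_isolated_large:
  fixes n m :: nat
  defines "p \<equiv> m / (n choose 2)"
  assumes m: "m \<le> n choose 2" and "0 < t"
  shows "rprob (Kn_edges n) m (\<lambda>E. t \<le> real (card (isolated n E))) \<le> n * exp (- (p * real (n - 1))) / t"
proof -
  have eq: "{v \<in> {..<n}. v \<in> isolated n E} = isolated n E" for E
    unfolding isolated_def by auto
  have "rprob (Kn_edges n) m (\<lambda>E. t \<le> real (card {v \<in> {..<n}. v \<in> isolated n E})) \<le>
      (\<Sum>v<n. rprob (Kn_edges n) m (\<lambda>E. v \<in> isolated n E)) / t"
    by (rule rprob_markov[OF finite_Kn_edges _ \<open>0 < t\<close>]) simp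
  also have "(\<Sum>v<n. rprob (Kn_edges n) m (\<lambda>E. v \<in> isolated n E)) \<le>
      of_nat (card {..<n}) * exp (- (p * real (n - 1)))"
    unfolding p_def using m by (intro sum_bounded_above rprob_vertex_isolated) auto
  finally show ?thesis
    unfolding eq using \<open>0 < t\<close> by (simp add: divide_right_mono)
qed

section \<open>Expansion of a random graph\<close>

text \<open>\<open>l ^ l / fact l\<close> is one term of the series of \<open>exp l\<close>.\<close>

lemma power_self_le_fact: "real l ^ l \<le> exp 1 ^ l * fact l"
proof -
  have sm: "summable (\<lambda>k. real l ^ k /\<^sub>R fact k)"
    using exp_converges[of "real l"] by (rule sums_summable)
  have "(\<Sum>k\<in>{l}. real l ^ k /\<^sub>R fact k) \<le> (\<Sum>k. real l ^ k /\<^sub>R fact k)"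
    by (rule sum_le_suminf[OF sm]) (auto intro: divide_nonneg_nonneg)
  also have "\<dots> = exp (real l)"
    using exp_converges[of "real l"] by (rule sums_unique[symmetric])
  also have "\<dots> = exp 1 ^ l"
    by (simp add: exp_of_nat_mult[symmetric])
  finally show ?thesis
    by (simp add: field_simps)
qed

lemma binomial_le_exp_power:
  assumes "0 < l"
  shows "real (M choose l) \<le> (exp 1 * M / l) ^ l"
proof -
  have "real ((M choose l) * fact l) \<le> real (M ^ l)"
    by (intro of_nat_mono binomial_fact_pow)
  hence 1: "real (M choose l) * fact l \<le> real M ^ l"
    by simp
  have "real (M choose l) * real l ^ l \<le> real (M choose l) * (exp 1 ^ l * fact l)"
    by (intro mult_left_mono power_self_le_fact) simp
  also have "\<dots> = exp 1 ^ l * (real (M choose l) * fact l)"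
    by simp
  also have "\<dots> \<le> exp 1 ^ l * real M ^ l"
    using 1 by (intro mult_left_mono) auto
  finally show ?thesis
    using assms by (simp add: power_divide power_mult_distrib field_simps)
qed

text \<open>Union bound over the \<open>l\<close>-subsets of \<open>P\<close>, each contained in
  \<open>E\<close> with probability at most \<open>(m / card K) ^ l\<close>.\<close>

lemma rprob_many_edges:
  assumes "finite K" "P \<subseteq> K" "m \<le> card K" "0 < l"
  shows "rprob K m (\<lambda>E. l \<le> card (E \<inter> P)) \<le> (exp 1 * card P * (m / card K) / l) ^ l"
proof -
  let ?I = "{F. F \<subseteq> P \<and> card F = l}"
  have finP: "finite P"
    using assms finite_subset by blast
  have "rprob K m (\<lambda>E. l \<le> card (E \<inter> P)) \<le> rprob K m (\<lambda>E. \<exists>F\<in>?I. F \<subseteq> E)"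
  proof (rule rprob_mono[OF assms(1)])
    fix E assume "l \<le> card (E \<inter> P)"
    then obtain F where "F \<subseteq> E \<inter> P" "card F = l"
      by (metis obtain_subset_with_card_n)
    thus "\<exists>F\<in>?I. F \<subseteq> E"
      by (intro bexI[of _ F]) auto
  qed
  also have "\<dots> \<le> (exp 1 * card P / l) ^ l * (m / card K) ^ l"
  proof (rule rprob_UN_bound[OF assms(1)])
    show "real (card ?I) \<le> (exp 1 * card P / l) ^ l"
      using binomial_le_exp_power[OF assms(4), of "card P"] finP by (simp add: n_subsets)
    show "rprob K m (\<lambda>E. F \<subseteq> E) \<le> (m / card K) ^ l" if "F \<in> ?I" for F
      using rprob_contain[OF assms(1), of F m] that assms(2,3) by auto
  qed (use finP in auto)
  also have "\<dots> = (exp 1 * card P * (m / card K) / l) ^ l"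
    by (simp only: power_mult_distrib[symmetric] times_divide_eq_left times_divide_eq_right)
      (simp add: mult_ac)
  finally show ?thesis .
qed

text \<open>Each pair is charged to its edge together with the end in \<open>A\<close>. The factor 2
  allows for edges seen from both ends, as \<open>A\<close> and \<open>Y\<close> may
  overlap.\<close>

lemma sum_nbrs_le_edges:
  assumes E: "E \<subseteq> Kn_edges n" and fin: "finite A" "finite Y"
  shows "(\<Sum>x\<in>A. card (nbrs E x \<inter> Y)) \<le> 2 * card (E \<inter> {{x, y} | x y. x \<in> A \<and> y \<in> Y \<and> x \<noteq> y})"
proof -
  let ?P = "E \<inter> {{x, y} | x y. x \<in> A \<and> y \<in> Y \<and> x \<noteq> y}"
  have finE: "finite ?P"
    using finite_subset[OF E finite_Kn_edges] by simp
  have "(\<Sum>x\<in>A. card (nbrs E x \<inter> Y)) = card (Sigma A (\<lambda>x. nbrs E x \<inter> Y))"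
    using fin by simp
  also have "\<dots> \<le> card (Sigma ?P (\<lambda>e. e))"
  proof (rule card_inj_on_le[of "\<lambda>(x, y). ({x, y}, x)"])
    show "inj_on (\<lambda>(x, y). ({x, y}, x)) (Sigma A (\<lambda>x. nbrs E x \<inter> Y))"
      by (auto simp: inj_on_def doubleton_eq_iff)
    show "(\<lambda>(x, y). ({x, y}, x)) ` Sigma A (\<lambda>x. nbrs E x \<inter> Y) \<subseteq> Sigma ?P (\<lambda>e. e)"
    proof
      fix p assume "p \<in> (\<lambda>(x, y). ({x, y}, x)) ` Sigma A (\<lambda>x. nbrs E x \<inter> Y)"
      then obtain x y where p: "p = ({x, y}, x)" "x \<in> A" "y \<in> Y" "{x, y} \<in> E"
        unfolding nbrs_def by auto
      hence "x \<noteq> y"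
        using Kn_edges_endpoints(3)[OF _ E] by blast
      thus "p \<in> Sigma ?P (\<lambda>e. e)"
        using p by blast
    qed
    have "finite e" if "e \<in> ?P" for e
      using that by auto
    thus "finite (Sigma ?P (\<lambda>e. e))"
      using finE by (intro finite_SigmaI)
  qed
  also have "\<dots> = (\<Sum>e\<in>?P. card e)"
    using finE by (intro card_SigmaI) auto
  also have "\<dots> = (\<Sum>e\<in>?P. 2)"
    by (intro sum.cong) (auto simp: card_insert_if)
  finally show ?thesis
    by simp
qed

text \<open>Union bound over \<open>a = card A\<close>, \<open>g\<close> and the sets, with
  \<open>y = g * a\<close>. There are at most \<open>(e n / y) ^ (2 y)\<close> pairs, and each must
  span \<open>h * a \<ge> 4 * y\<close> edges, with probability at most
  \<open>(C y / n) ^ (4 y)\<close>. The product is \<open>(D y / n) ^ (2 y)\<close> with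
  \<open>D = e C^2\<close>, and for \<open>y \<le> n / (2 D)\<close> it is at most its value at
  \<open>y = 1\<close>.\<close>

lemma rprob_dense_pair:
  fixes n m h y0 :: nat
  assumes m: "m \<le> n choose 2" and h: "0 < h" and n: "0 < n"
    and C: "1 \<le> C" "exp 1 * n * (m / (n choose 2)) / h \<le> C"
    and y0: "2 * (exp 1 * C\<^sup>2 * y0) \<le> n" "2 * y0 \<le> n"
  shows "rprob (Kn_edges n) m (dense_pair n h y0) \<le>
    n * h * (exp 1 * C\<^sup>2 / n)\<^sup>2"
proof -
  let ?K = "Kn_edges n" and ?p = "m / (n choose 2)"
  define D where "D = exp 1 * C\<^sup>2"
  let ?I = "{(a, g). 1 \<le> a \<and> a \<le> n \<and> 1 \<le> g \<and> 4 * g \<le> h \<and> g * a \<le> y0}"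
  let ?J = "\<lambda>(a, g). {A. A \<subseteq> {..<n} \<and> card A = a} \<times> {Y. Y \<subseteq> {..<n} \<and> card Y = g * a}"
  let ?pairs = "\<lambda>A Y. {{x, y} | x y. x \<in> A \<and> y \<in> Y \<and> x \<noteq> y} :: nat set set"
  let ?Q = "\<lambda>(A, Y) E. h * card A \<le> card (E \<inter> ?pairs A Y)"
  have finI: "finite ?I"
    by (rule finite_subset[of _ "{..n} \<times> {..h}"]) auto
  have "rprob ?K m (dense_pair n h y0) \<le>
      rprob ?K m (\<lambda>E. \<exists>i\<in>?I. \<exists>AY\<in>?J i. ?Q AY E)"
  proof (rule rprob_mono[OF finite_Kn_edges])
    fix E assume E: "E \<subseteq> ?K" and "dense_pair n h y0 E"
    then obtain A Y g where *: "A \<subseteq> {..<n}" "Y \<subseteq> {..<n}" "A \<noteq> {}" "1 \<le> g" "4 * g \<le> h"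
      "card Y = g * card A" "g * card A \<le> y0" "\<forall>x\<in>A. 2 * h \<le> card (nbrs E x \<inter> Y)"
      by (elim exE conjE) (rule that)
    have fin: "finite A" "finite Y"
      using *(1,2) finite_subset by blast+
    have "2 * (h * card A) = (\<Sum>x\<in>A. 2 * h)"
      by simp
    also have "\<dots> \<le> (\<Sum>x\<in>A. card (nbrs E x \<inter> Y))"
      using *(8) by (intro sum_mono) blast
    also have "\<dots> \<le> 2 * card (E \<inter> ?pairs A Y)"
      by (rule sum_nbrs_le_edges[OF E fin])
    finally have "?Q (A, Y) E"
      by simp
    moreover have "card A \<le> card {..<n}"
      using *(1) by (intro card_mono) auto
    hence "(card A, g) \<in> ?I"
      using * fin by (auto simp: Suc_le_eq card_gt_0_iff)
    moreover have "(A, Y) \<in> ?J (card A, g)"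
      using * by auto
    ultimately show "\<exists>i\<in>?I. \<exists>AY\<in>?J i. ?Q AY E"
      by (intro bexI[of _ "(card A, g)"] bexI[of _ "(A, Y)"])
  qed
  also have "\<dots> \<le> real (n * h) * (D / n)\<^sup>2"
  proof (rule rprob_UN_bound[OF finite_Kn_edges finI])
    have "card ?I \<le> card ({1..n} \<times> {1..h})"
      by (intro card_mono) auto
    thus "real (card ?I) \<le> real (n * h)"
      by (simp add: card_cartesian_product flip: of_nat_mult)
    fix i assume i: "i \<in> ?I"
    obtain a g where ag: "i = (a, g)"
      by (cases i)
    have 1: "1 \<le> a" "a \<le> n" "1 \<le> g" "4 * g \<le> h" "g * a \<le> y0"
      using i ag by auto
    define y where "y = g * a"
    have y: "1 \<le> y" "y \<le> y0" "2 * y \<le> n" "a \<le> y"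
      using 1 y0(2) unfolding y_def by auto
    have rat: "2 * (D * y) \<le> n"
    proof -
      have "2 * (D * y) \<le> 2 * (D * y0)"
        using y(2) unfolding D_def by (intro mult_left_mono) auto
      thus ?thesis
        using y0(1) unfolding D_def by linarith
    qed
    have Cy: "C * y / n \<le> 1"
    proof -
      have "1 \<le> exp 1 * C"
        using C(1) exp_ge_add_one_self[of "1 :: real"] mult_mono[of 1 "exp 1" 1 C] by simp
      hence "C * 1 \<le> C * (exp 1 * C)"
        using C(1) by (intro mult_left_mono) auto
      hence "C * y \<le> D * y"
        unfolding D_def by (intro mult_right_mono) (auto simp: power2_eq_square mult_ac)
      moreover have "0 \<le> D * y"
        unfolding D_def by simp
      ultimately show ?thesis
        using rat n by (simp add: divide_le_eq)
    qed
    have Cy0: "0 \<le> C * y / n"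
      using C(1) by simp
    have "rprob ?K m (\<lambda>E. \<exists>AY\<in>?J i. ?Q AY E) \<le> ((exp 1 * n / y) ^ y)\<^sup>2 * (C * y / n) ^ (4 * y)"
    proof (rule rprob_UN_bound[OF finite_Kn_edges])
      show "finite (?J i)"
        unfolding ag by simp
      have "card (?J i) = (n choose a) * (n choose y)"
        unfolding ag y_def by (simp add: card_cartesian_product n_subsets)
      \<comment> \<open>\<open>a \<le> y \<le> n / 2\<close>, the range where binomial coefficients
        increase.\<close>
      also have "\<dots> \<le> (n choose y) * (n choose y)"
        using y by (intro mult_right_mono binomial_mono) auto
      finally have "real (card (?J i)) \<le> (real (n choose y))\<^sup>2"
        by (simp add: power2_eq_square flip: of_nat_mult)
      also have "\<dots> \<le> ((exp 1 * n / y) ^ y)\<^sup>2"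
        using y by (intro power_mono binomial_le_exp_power) auto
      finally show "real (card (?J i)) \<le> ((exp 1 * n / y) ^ y)\<^sup>2" .
      fix AY assume "AY \<in> ?J i"
      then obtain A Y where AY: "AY = (A, Y)" "A \<subseteq> {..<n}" "card A = a" "Y \<subseteq> {..<n}" "card Y = y"
        unfolding ag y_def by auto
      have fin: "finite A" "finite Y"
        using AY finite_subset by blast+
      have pairs: "?pairs A Y \<subseteq> ?K"
        using AY by (auto intro!: edge_in_Kn)
      have "?pairs A Y \<subseteq> (\<lambda>(x, y). {x, y}) ` (A \<times> Y)"
        by auto
      hence "card (?pairs A Y) \<le> card (A \<times> Y)"
        using fin by (intro order.trans[OF card_mono card_image_le]) auto
      hence cp: "real (card (?pairs A Y)) \<le> real a * real y"
        using AY by (simp add: card_cartesian_product flip: of_nat_mult)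
      have "rprob ?K m (?Q AY) = rprob ?K m (\<lambda>E. h * a \<le> card (E \<inter> ?pairs A Y))"
        using AY by simp
      also have "\<dots> \<le> (exp 1 * card (?pairs A Y) * (m / card ?K) / real (h * a)) ^ (h * a)"
        using pairs m h 1 by (intro rprob_many_edges[OF finite_Kn_edges]) (auto simp: card_Kn_edges)
      also have "\<dots> \<le> (C * y / n) ^ (h * a)"
      proof (rule power_mono)
        have "exp 1 * card (?pairs A Y) * (m / card ?K) / real (h * a) \<le>
            exp 1 * (real a * real y) * ?p / real (h * a)"
          using cp unfolding card_Kn_edges
          by (intro divide_right_mono mult_right_mono mult_left_mono) auto
        also have "\<dots> = (exp 1 * n * ?p / h) * (y / n)"
          using 1 h n by (simp add: field_simps)
        also have "\<dots> \<le> C * (y / n)"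
          using C(2) by (intro mult_right_mono) auto
        finally show "exp 1 * card (?pairs A Y) * (m / card ?K) / real (h * a) \<le> C * y / n"
          by simp
      qed simp
      also have "\<dots> \<le> (C * y / n) ^ (4 * y)"
      proof (rule power_decreasing)
        have "4 * g * a \<le> h * a"
          using 1(4) by (intro mult_right_mono) auto
        thus "4 * y \<le> h * a"
          unfolding y_def by simp
      qed (use Cy Cy0 in auto)
      finally show "rprob ?K m (?Q AY) \<le> (C * y / n) ^ (4 * y)" .
    qed (use Cy0 in simp)
    also have "\<dots> = (D * y / n) ^ (2 * y)"
    proof -
      have "((exp 1 * n / y) ^ y)\<^sup>2 * (C * y / n) ^ (4 * y) = ((exp 1 * n / y)\<^sup>2 * (C * y / n) ^ 4) ^ y"
        by (simp add: power_mult_distrib power_mult[symmetric] mult.commute)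
      also have "(exp 1 * n / y)\<^sup>2 * (C * y / n) ^ 4 = (D * y / n)\<^sup>2"
        using n y(1) unfolding D_def by (simp add: field_simps power2_eq_square power4_eq_xxxx)
      finally show ?thesis
        by (simp add: power_mult)
    qed
    also have "\<dots> \<le> (D / n)\<^sup>2"
    proof -
      \<comment> \<open>Comparison with \<open>y = 1\<close> leaves a factor
        \<open>y\<^sup>2\<close>; the further factors \<open>(D * y / n)\<^sup>2 \<le> 1 / 4\<close>
        pay for it.\<close>
      have y_pow: "real y ^ 2 \<le> 4 ^ (y - 1)"
      proof -
        have "k + 1 \<le> 2 ^ k" for k :: nat
          by (induction k) auto
        from this[of "y - 1"] have "real y \<le> 2 ^ (y - 1)"
          using y(1) by (metis le_add_diff_inverse2 of_nat_le_iff of_nat_numeral of_nat_power)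
        hence "real y ^ 2 \<le> (2 ^ (y - 1)) ^ 2"
          by (intro power_mono) auto
        also have "((2 :: real) ^ (y - 1)) ^ 2 = (2 ^ 2) ^ (y - 1)"
          by (metis power_mult mult.commute)
        finally show ?thesis
          by simp
      qed
      have "2 * y = 2 + 2 * (y - 1)"
        using y(1) by simp
      hence "(D * y / n) ^ (2 * y) = (D * y / n)\<^sup>2 * ((D * y / n)\<^sup>2) ^ (y - 1)"
        by (metis power_add power_mult)
      also have "\<dots> = (D / n)\<^sup>2 * (real y ^ 2 * ((D * y / n)\<^sup>2) ^ (y - 1))"
        by (subst (1) times_divide_eq_left[symmetric]) (simp only: power_mult_distrib mult.assoc)
      also have "\<dots> \<le> (D / n)\<^sup>2 * (4 ^ (y - 1) * ((1 / 2)\<^sup>2) ^ (y - 1))"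
      proof (intro mult_left_mono mult_mono power_mono)
        show "D * y / n \<le> 1 / 2"
          using rat n by (simp add: field_simps)
        show "0 \<le> D * y / n"
          unfolding D_def by simp
      qed (use y_pow in auto)
      also have "\<dots> = (D / n)\<^sup>2"
        by (simp add: power2_eq_square flip: power_mult_distrib)
      finally show ?thesis .
    qed
    finally show "rprob ?K m (\<lambda>E. \<exists>AY\<in>?J i. ?Q AY E) \<le> (D / n)\<^sup>2" .
  qed simp
  finally show ?thesis
    unfolding D_def by simp
qed

text \<open>Counting all pairs by \<open>4 ^ n\<close> is affordable because at least
  \<open>y1 * b\<close> edges have to be missed.\<close>

lemma rprob_no_edges_between:
  fixes n m y1 b :: nat
  assumes m: "m \<le> n choose 2"
  shows "rprob (Kn_edges n) m (separated_pair n y1 b) \<le>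
    4 ^ n * exp (- (m / (n choose 2) * real (y1 * b)))"
proof -
  let ?K = "Kn_edges n" and ?p = "m / (n choose 2)"
  let ?I = "{(X, Y). X \<subseteq> {..<n} \<and> Y \<subseteq> {..<n} \<and> X \<inter> Y = {} \<and> y1 \<le> card X \<and> b \<le> card Y}"
  let ?pairs = "\<lambda>X Y. (\<lambda>(x, y). {x, y}) ` (X \<times> Y) :: nat set set"
  have sub: "?I \<subseteq> Pow {..<n} \<times> Pow {..<n}"
    by auto
  have finI: "finite ?I"
    by (rule finite_subset[OF sub]) simp
  have "rprob ?K m (separated_pair n y1 b) \<le>
      rprob ?K m (\<lambda>E. \<exists>i\<in>?I. E \<inter> ?pairs (fst i) (snd i) = {})"
  proof (rule rprob_mono[OF finite_Kn_edges])
    fix E assume "separated_pair n y1 b E"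
    then obtain X Y where "(X, Y) \<in> ?I" "\<forall>x\<in>X. \<forall>y\<in>Y. {x, y} \<notin> E"
      by auto
    thus "\<exists>i\<in>?I. E \<inter> ?pairs (fst i) (snd i) = {}"
      by (intro bexI[of _ "(X, Y)"]) auto
  qed
  also have "\<dots> \<le> 4 ^ n * exp (- (?p * real (y1 * b)))"
  proof (rule rprob_UN_bound[OF finite_Kn_edges finI])
    have "card ?I \<le> card (Pow {..<n} \<times> Pow {..<n})"
      using sub by (intro card_mono) auto
    also have "\<dots> = 2 ^ n * 2 ^ n"
      by (simp add: card_cartesian_product card_Pow)
    also have "(2 :: nat) ^ n * 2 ^ n = 4 ^ n"
      by (simp flip: power_mult_distrib)
    finally have "real (card ?I) \<le> real (4 ^ n)"
      by (simp only: of_nat_le_iff)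
    thus "real (card ?I) \<le> 4 ^ n"
      by simp
    fix i assume i: "i \<in> ?I"
    obtain X Y where XY: "i = (X, Y)"
      by (cases i)
    have X: "X \<subseteq> {..<n}" "Y \<subseteq> {..<n}" "X \<inter> Y = {}" "y1 \<le> card X" "b \<le> card Y"
      using i XY by auto
    have "inj_on (\<lambda>(x, y). {x, y}) (X \<times> Y)"
      using X(3) by (auto simp: inj_on_def doubleton_eq_iff)
    hence cp: "card (?pairs X Y) = card X * card Y"
      by (simp add: card_image card_cartesian_product)
    have sp: "?pairs X Y \<subseteq> ?K"
      using X by (fastforce intro!: edge_in_Kn)
    have p1: "0 \<le> ?p" "?p \<le> 1"
      using m by (auto simp: divide_le_eq)
    have "rprob ?K m (\<lambda>E. E \<inter> ?pairs X Y = {}) = rprob ?K m (\<lambda>E. {} \<subseteq> E \<and> E \<inter> ?pairs X Y = {})"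
      by simp
    also have "\<dots> \<le> (m / card ?K) ^ card ({} :: nat set set) *
        (1 - real (m - card ({} :: nat set set)) / card ?K) ^ card (?pairs X Y)"
      using sp m by (intro rprob_contain_avoid[OF finite_Kn_edges]) (auto simp: card_Kn_edges)
    also have "\<dots> = (1 - ?p) ^ (card X * card Y)"
      unfolding cp by (simp add: card_Kn_edges)
    also have "\<dots> \<le> (1 - ?p) ^ (y1 * b)"
      using X p1 by (intro power_decreasing mult_le_mono) auto
    also have "\<dots> \<le> exp (- ?p) ^ (y1 * b)"
      using p1 exp_ge_add_one_self[of "- ?p"] by (intro power_mono) auto
    also have "\<dots> = exp (- (?p * real (y1 * b)))"
      by (simp add: exp_of_nat_mult[symmetric] mult_ac)
    finally show "rprob ?K m (\<lambda>E. E \<inter> ?pairs (fst i) (snd i) = {}) \<le> exp (- (?p * real (y1 * b)))"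
      unfolding XY by simp
  qed simp
  finally show ?thesis .
qed

section \<open>The graph at the connectivity time\<close>

text \<open>Counterpart of \<open>binomial_avoid_le\<close>: the factors
  \<open>1 - l / (M - i)\<close> with \<open>i < Y\<close> are at least
  \<open>1 - l / (M - Y)\<close>.\<close>

lemma binomial_avoid_ge:
  assumes "y \<le> Y" "l + Y \<le> M" "Y < M"
  shows "(1 - real l / real (M - Y)) ^ y * (M choose l) \<le> real ((M - y) choose l)"
  using assms(1)
proof (induction y)
  case (Suc y)
  let ?M = "M - y"
  have pos: "0 < ?M" "l \<le> ?M" "M - Y \<le> ?M" "0 < M - Y" "l \<le> M - Y"
    using Suc.prems assms by auto
  have "(?M - l) * (?M choose l) = ?M * ((?M - 1) choose l)"
    by (rule binomial_absorb_comp)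
  hence "real (?M - l) * real (?M choose l) = real ?M * real ((?M - 1) choose l)"
    by (metis of_nat_mult)
  hence *: "real ((M - Suc y) choose l) = (1 - real l / real ?M) * real (?M choose l)"
    using pos by (simp add: field_simps of_nat_diff)
  have "(1 - real l / real (M - Y)) ^ Suc y * (M choose l) =
      (1 - real l / real (M - Y)) * ((1 - real l / real (M - Y)) ^ y * (M choose l))"
    by simp
  also have "\<dots> \<le> (1 - real l / real (M - Y)) * real (?M choose l)"
    using Suc pos by (intro mult_left_mono) (auto simp: divide_le_eq)
  also have "\<dots> \<le> (1 - real l / real ?M) * real (?M choose l)"
    using pos by (intro mult_right_mono diff_mono divide_left_mono) auto
  finally show ?case
    unfolding * .
qed simp

text \<open>Passing from \<open>A\<close> to \<open>Suc A\<close> multiplies the left side by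
  \<open>1 - m / (M - A)\<close> and the right side by the larger \<open>1 - m / (N - A)\<close>.
  For \<open>M = N - A\<close> this is negative correlation: a random \<open>m\<close>-set avoids
  two disjoint sets of size \<open>A\<close> at most as often as if the events were
  independent.\<close>

lemma binomial_top_log_concave:
  assumes "M \<le> N" "A \<le> M"
  shows "real ((M - A) choose m) * real (N choose m) \<le> real (M choose m) * real ((N - A) choose m)"
  using assms(2)
proof (induction A)
  case (Suc A)
  define x where "x = 1 - real m / real (M - A)"
  define y where "y = 1 - real m / real (N - A)"
  have step: "real ((L - 1) choose m) = (1 - real m / real L) * real (L choose m)" if "m < L" for L
  proof -
    have "real (L - m) * real (L choose m) = real L * real ((L - 1) choose m)"
      by (metis of_nat_mult binomial_absorb_comp)
    thus ?thesis
      using that by (simp add: field_simps of_nat_diff)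
  qed
  show ?case
  proof (cases "m < M - A")
    case True
    have "m < N - A"
      using True assms(1) by linarith
    have "0 \<le> x"
      unfolding x_def using True
      by (subst diff_ge_0_iff_ge, subst divide_le_eq_1_pos) (auto intro: of_nat_mono simp del: of_nat_diff)
    have "real m / real (N - A) \<le> real m / real (M - A)"
      using True assms(1) by (intro frac_le of_nat_mono diff_le_mono) auto
    hence "x \<le> y"
      unfolding x_def y_def by simp
    have "real ((M - Suc A) choose m) * real (N choose m) = x * (real ((M - A) choose m) * real (N choose m))"
      using step[OF True] unfolding x_def by simp
    also have "\<dots> \<le> y * (real (M choose m) * real ((N - A) choose m))"
      using \<open>0 \<le> x\<close> \<open>x \<le> y\<close> Suc.prems by (intro mult_mono Suc.IH) auto
    also have "\<dots> = real (M choose m) * real ((N - Suc A) choose m)"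
      using step[OF \<open>m < N - A\<close>] unfolding y_def by simp
    finally show ?thesis .
  next
    case False
    hence *: "(M - Suc A) choose m = 0"
      using Suc.prems by (intro binomial_eq_0) simp
    show ?thesis
      unfolding * by simp
  qed
qed simp

lemma isolated_eq: "isolated n E = {v. v < n \<and> E \<inter> (\<lambda>u. {v, u}) ` ({..<n} - {v}) = {}}"
  if "E \<subseteq> Kn_edges n"
  using Kn_edges_endpoints[OF _ that] unfolding isolated_def nbrs_def by fastforce

text \<open>Chebyshev's inequality: the events that two given vertices are isolated are almost uncorrelated.\<close>

lemma rprob_no_isolated:
  fixes n m :: nat
  defines "N \<equiv> n choose 2" and "A \<equiv> n - 1"
  assumes n: "4 \<le> n" and m: "m + 2 * A < N"
  shows "rprob (Kn_edges n) m (\<lambda>E. isolated n E = {}) \<le>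
    1 / (n * (1 - real m / real (N - A)) ^ A) + (1 / (1 - real m / real (N - 2 * A + 1)) - 1)"
proof -
  let ?K = "Kn_edges n"
  let ?T = "subsets_of_card ?K m"
  \<comment> \<open>The numbers of all outcomes, of those isolating a given vertex, and of those
    isolating two given vertices. Two full stars share one edge, hence
    \<open>2 * A - 1\<close>.\<close>
  define c0 c1 c2 where "c0 = real (N choose m)" "c1 = real ((N - A) choose m)"
    "c2 = real ((N - (2 * A - 1)) choose m)"
  note c_defs = this
  let ?Y = "\<lambda>v. (\<lambda>u. {v, u}) ` ({..<n} - {v})"
  let ?i = "\<lambda>v E. (if v \<in> isolated n E then 1 else 0 :: real)"
  define X where "X E = real (card (isolated n E))" for E
  define \<mu> where "\<mu> = n * c1 / c0"
  have finT: "finite ?T"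
    by (intro finite_subsets_of_card finite_Kn_edges)
  have cardT: "real (card ?T) = c0"
    unfolding c_defs N_def using card_subsets_of_card[OF finite_Kn_edges] by (simp add: card_Kn_edges)
  have YK: "?Y v \<subseteq> ?K" if "v < n" for v
    using that by (auto intro!: edge_in_Kn)
  have cY: "card (?Y v) = A" if "v < n" for v
    using that unfolding A_def by (subst card_image) (auto simp: inj_on_def doubleton_eq_iff)
  have cYY: "card (?Y v \<union> ?Y w) = 2 * A - 1" if "v < n" "w < n" "v \<noteq> w" for v w
  proof -
    have "?Y v \<inter> ?Y w = {{v, w}}"
      using that by (auto simp: doubleton_eq_iff)
    hence "card (?Y v \<union> ?Y w) + 1 = A + A"
      using card_Un_Int[of "?Y v" "?Y w"] cY that by simp
    thus ?thesis
      by simp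
  qed
  have iso: "v \<in> isolated n E \<longleftrightarrow> E \<inter> ?Y v = {}" if "v < n" "E \<in> ?T" for v E
    using isolated_eq[of E n] that unfolding subsets_of_card_def by auto
  have avoid: "real (card {E \<in> ?T. E \<inter> Y = {}}) = real ((N - card Y) choose m)" if "Y \<subseteq> ?K" for Y
    using card_subsets_contain_avoid[OF finite_Kn_edges _ that, of "{}" m] unfolding N_def
    by (simp add: card_Kn_edges)
  have s1: "(\<Sum>E\<in>?T. ?i v E) = c1" if "v < n" for v
  proof -
    have "(\<Sum>E\<in>?T. ?i v E) = real (card {E \<in> ?T. v \<in> isolated n E})"
      using finT by (simp add: sum.If_cases Int_def)
    also have "{E \<in> ?T. v \<in> isolated n E} = {E \<in> ?T. E \<inter> ?Y v = {}}"
      using iso[OF that] by blast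
    finally show ?thesis
      using avoid[OF YK[OF that]] cY[OF that] unfolding c_defs by simp
  qed
  have s2: "(\<Sum>E\<in>?T. ?i v E * ?i w E) = c2" if "v < n" "w < n" "v \<noteq> w" for v w
  proof -
    have "(\<Sum>E\<in>?T. ?i v E * ?i w E) = (\<Sum>E\<in>?T. if v \<in> isolated n E \<and> w \<in> isolated n E then 1 else 0)"
      by (intro sum.cong) auto
    also have "\<dots> = real (card {E \<in> ?T. v \<in> isolated n E \<and> w \<in> isolated n E})"
      using finT by (simp add: sum.If_cases Int_def)
    also have "{E \<in> ?T. v \<in> isolated n E \<and> w \<in> isolated n E} = {E \<in> ?T. E \<inter> (?Y v \<union> ?Y w) = {}}"
      using iso[OF that(1)] iso[OF that(2)] by (intro Collect_cong) (metis Int_Un_distrib Un_empty)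
    finally show ?thesis
      using avoid[of "?Y v \<union> ?Y w"] YK that(1,2) cYY[OF that] unfolding c_defs by simp
  qed
  have Xsum: "X E = (\<Sum>v<n. ?i v E)" for E
  proof -
    have "{..<n} \<inter> {v. v \<in> isolated n E} = isolated n E"
      unfolding isolated_def by auto
    thus ?thesis
      unfolding X_def by (simp add: sum.If_cases)
  qed
  have SX: "(\<Sum>E\<in>?T. X E) = n * c1"
    unfolding Xsum by (subst sum.swap) (simp add: s1)
  have SX2: "(\<Sum>E\<in>?T. (X E)\<^sup>2) \<le> n * c1 + n * n * c2"
  proof -
    have "(\<Sum>E\<in>?T. (X E)\<^sup>2) = (\<Sum>E\<in>?T. \<Sum>v<n. \<Sum>w<n. ?i v E * ?i w E)"
      unfolding Xsum by (simp add: power2_eq_square sum_product)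
    also have "\<dots> = (\<Sum>v<n. \<Sum>E\<in>?T. \<Sum>w<n. ?i v E * ?i w E)"
      by (rule sum.swap)
    also have "\<dots> = (\<Sum>v<n. \<Sum>w<n. \<Sum>E\<in>?T. ?i v E * ?i w E)"
      by (intro sum.cong refl sum.swap)
    also have "\<dots> \<le> (\<Sum>v<n. \<Sum>w<n. (if v = w then c1 else 0) + c2)"
    proof (intro sum_mono)
      fix v w assume vw: "v \<in> {..<n}" "w \<in> {..<n}"
      show "(\<Sum>E\<in>?T. ?i v E * ?i w E) \<le> (if v = w then c1 else 0) + c2"
      proof (cases "v = w")
        case True
        hence "(\<Sum>E\<in>?T. ?i v E * ?i w E) = (\<Sum>E\<in>?T. ?i v E)"
          by (intro sum.cong) auto
        thus ?thesis
          using True s1[of v] vw unfolding c_defs by simp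
      next
        case False
        thus ?thesis
          using s2[of v w] vw by simp
      qed
    qed
    also have "\<dots> = n * c1 + n * n * c2"
      by (simp add: sum.distrib algebra_simps)
    finally show ?thesis .
  qed
  have c0: "0 < c0" and c1: "0 < c1"
    using m unfolding c_defs by (auto simp: zero_less_binomial)
  have \<mu>: "0 < \<mu>"
    using c0 c1 n unfolding \<mu>_def by simp
  \<comment> \<open>Each outcome without isolated vertices contributes \<open>\<mu>\<^sup>2\<close>
    to the sum of squared deviations.\<close>
  have "real (card {E \<in> ?T. isolated n E = {}}) * \<mu>\<^sup>2 = (\<Sum>E\<in>{E \<in> ?T. isolated n E = {}}. (X E - \<mu>)\<^sup>2)"
    unfolding X_def by simp
  also have "\<dots> \<le> (\<Sum>E\<in>?T. (X E - \<mu>)\<^sup>2)"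
    using finT by (intro sum_mono2) auto
  also have "\<dots> = (\<Sum>E\<in>?T. (X E)\<^sup>2 - 2 * \<mu> * X E + \<mu>\<^sup>2)"
    by (intro sum.cong) (auto simp: power2_eq_square algebra_simps)
  also have "\<dots> = (\<Sum>E\<in>?T. (X E)\<^sup>2) - 2 * \<mu> * (n * c1) + \<mu>\<^sup>2 * c0"
    by (simp add: sum.distrib sum_subtractf sum_distrib_left[symmetric] SX cardT)
  also have "\<dots> \<le> n * c1 + n * n * c2 - 2 * \<mu> * (n * c1) + \<mu>\<^sup>2 * c0"
    using SX2 by simp
  also have "\<dots> = n * c1 + n * n * c2 - \<mu>\<^sup>2 * c0"
    using c0 unfolding \<mu>_def by (simp add: field_simps power2_eq_square)
  finally have "real (card {E \<in> ?T. isolated n E = {}}) \<le> (n * c1 + n * n * c2 - \<mu>\<^sup>2 * c0) / \<mu>\<^sup>2"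
    using \<mu> by (simp add: pos_le_divide_eq)
  hence "rprob ?K m (\<lambda>E. isolated n E = {}) \<le> (n * c1 + n * n * c2 - \<mu>\<^sup>2 * c0) / \<mu>\<^sup>2 / c0"
    unfolding rprob_def c_defs N_def card_Kn_edges by (rule divide_right_mono) simp
  also have "\<dots> = c0 / (n * c1) + (c2 * c0 / c1\<^sup>2 - 1)"
    using c0 c1 n unfolding \<mu>_def by (simp add: field_simps power2_eq_square)
  also have "\<dots> \<le> 1 / (n * (1 - real m / real (N - A)) ^ A) + (1 / (1 - real m / real (N - 2 * A + 1)) - 1)"
  proof (intro add_mono diff_mono order_refl)
    define x where "x = (1 - real m / real (N - A)) ^ A"
    have x: "0 < x"
      using m unfolding x_def by (simp add: divide_less_eq)
    have "x * c0 \<le> c1"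
      unfolding x_def c_defs using m by (intro binomial_avoid_ge) auto
    hence "n * (x * c0) \<le> n * c1"
      by (intro mult_left_mono) auto
    hence "c0 * (n * x) \<le> 1 * (n * c1)"
      by (simp add: mult_ac)
    thus "c0 / (n * c1) \<le> 1 / (n * x)"
      using x c1 n by (simp add: field_simps)
    \<comment> \<open>Avoiding \<open>2 * A\<close> edges instead of \<open>2 * A - 1\<close> costs
      the factor \<open>y\<close>; to \<open>2 * A\<close> edges the log-concavity applies.\<close>
    define y where "y = 1 - real m / real (N - 2 * A + 1)"
    have y: "0 < y"
      using m unfolding y_def by (simp add: divide_less_eq)
    have "N - 2 * A + 1 = N - (2 * A - 1)"
      using m n unfolding A_def by simp
    hence L: "N - (2 * A - 1) - 1 = N - 2 * A" "m < N - 2 * A + 1" "N - (2 * A - 1) = N - 2 * A + 1"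
      using m by auto
    have "(N - 2 * A + 1 - m) * ((N - 2 * A + 1) choose m) = (N - 2 * A + 1) * ((N - 2 * A) choose m)"
      using binomial_absorb_comp[of "N - 2 * A + 1" m] by simp
    hence "real (N - 2 * A + 1 - m) * c2 = real (N - 2 * A + 1) * real ((N - 2 * A) choose m)"
      unfolding c_defs L(3) by (metis of_nat_mult)
    hence "y * c2 = real ((N - 2 * A) choose m)"
      using L(2) unfolding y_def by (simp add: field_simps of_nat_diff)
    moreover have "real ((N - 2 * A) choose m) * c0 \<le> c1 * c1"
      using binomial_top_log_concave[of "N - A" N A m] m unfolding c_defs
      by (simp add: mult_2)
    ultimately have "y * (c2 * c0) \<le> c1\<^sup>2"
      by (simp add: power2_eq_square mult_ac)
    thus "c2 * c0 / c1\<^sup>2 \<le> 1 / y"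
      using y c1 by (simp add: field_simps)
  qed
  finally show ?thesis .
qed

context typical_graph
begin

lemma isolated_subset_poor: "isolated n E \<subseteq> S"
  using num(2,3) unfolding isolated_def poor_def good_def by auto

text \<open>Outside three events about \<open>E'\<close> alone all intermediate graphs are served at
  once: \<open>?A\<close>, an isolated vertex gets no new edge; \<open>?B\<close>, one gets a new
  edge to a poor vertex; \<open>?C\<close>, new edges lead to two vertices of one star. Edges
  between isolated vertices fall under \<open>?B\<close>, since isolated vertices are poor.\<close>

theorem second_round:
  fixes j :: nat
  defines "K' \<equiv> Kn_edges n - E"
  defines "p \<equiv> j / card K'"
  assumes j: "j \<le> card K'"
  shows "rprob K' j (\<lambda>E'. isolated n (E \<union> E') \<noteq> {} \<or>
      (\<exists>E2. E \<subseteq> E2 \<and> E2 \<subseteq> E \<union> E' \<and> isolated n E2 = {} \<and> \<not> collects_all n E2)) \<le>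
    card (isolated n E) * exp (- (p * real (n - 1))) +
    (real (card (isolated n E)) * real (card S) * p +
     (real q * (real (2 * k + 6))\<^sup>2 * (real (card (isolated n E)))\<^sup>2) * p\<^sup>2)"
proof -
  let ?I = "isolated n E"
  have finK': "finite K'"
    unfolding K'_def using finite_Kn_edges by simp
  have finI: "finite ?I"
    using isolated_subset_poor S_props finite_subset by blast
  have p: "0 \<le> p" "p \<le> 1"
    using j unfolding p_def by (auto simp: divide_le_eq)
  obtain star where star': "\<forall>v\<in>Ugood. star v \<subseteq> Rgood \<and> card (star v) \<le> 2 * k + 6"
    and "\<forall>u\<in>Ugood. \<forall>v\<in>Ugood. u \<noteq> v \<longrightarrow> star u \<inter> star v = {}"
    and collects: "\<forall>E2 f2. E \<subseteq> E2 \<longrightarrow> (\<forall>s\<in>?I. f2 s < n \<and> f2 s \<notin> S \<and> {s, f2 s} \<in> E2) \<longrightarrow>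
        (\<forall>v\<in>Ugood. card (star v \<inter> f2 ` ?I) \<le> 1) \<longrightarrow> collects_all n E2"
    using ex_skeleton by (elim exE conjE) (rule that)
  note star = bspec[OF star']
  have finstar: "finite (star v)" if "v \<in> Ugood" for v
    using star[OF that] finite_subset[of "star v" Rgood] by simp
  have inK': "{s, y} \<in> K'" if "s \<in> ?I" "y < n" "y \<noteq> s" for s y
    using that edge_in_Kn[of s n y] unfolding K'_def isolated_def nbrs_def by auto
  let ?A = "\<lambda>E'. \<exists>s\<in>?I. nbrs E' s = {}"
  let ?B = "\<lambda>E'. \<exists>i\<in>{(s, y). s \<in> ?I \<and> y \<in> S \<and> s \<noteq> y}. {{fst i, snd i}} \<subseteq> E'"
  let ?J = "(SIGMA v:Ugood. star v \<times> star v) \<times> (?I \<times> ?I)"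
  let ?Cp = "\<lambda>((v, y, y'), s, s') E'. y \<noteq> y' \<and> {{s, y}, {s', y'}} \<subseteq> E'"
  let ?C = "\<lambda>E'. \<exists>i\<in>?J. ?Cp i E'"
  have "rprob K' j (\<lambda>E'. isolated n (E \<union> E') \<noteq> {} \<or>
      (\<exists>E2. E \<subseteq> E2 \<and> E2 \<subseteq> E \<union> E' \<and> isolated n E2 = {} \<and> \<not> collects_all n E2)) \<le>
      rprob K' j (\<lambda>E'. ?A E' \<or> (?B E' \<or> ?C E'))"
  proof (rule rprob_mono[OF finK'], rule ccontr)
    fix E' assume E': "E' \<subseteq> K'" and bad: "isolated n (E \<union> E') \<noteq> {} \<or>
      (\<exists>E2. E \<subseteq> E2 \<and> E2 \<subseteq> E \<union> E' \<and> isolated n E2 = {} \<and> \<not> collects_all n E2)"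
      and "\<not> (?A E' \<or> (?B E' \<or> ?C E'))"
    hence nA: "\<not> ?A E'" and nB: "\<not> ?B E'" and nC: "\<not> ?C E'"
      by simp_all
    have "isolated n (E \<union> E') = {}"
      using nA unfolding isolated_def nbrs_def by auto
    then obtain E2 where E2: "E \<subseteq> E2" "E2 \<subseteq> E \<union> E'" "isolated n E2 = {}" "\<not> collects_all n E2"
      using bad by blast
    have "\<exists>y. {s, y} \<in> E' \<and> {s, y} \<in> E2" if s: "s \<in> ?I" for s
    proof -
      have "nbrs E2 s \<noteq> {}"
        using E2(3) s unfolding isolated_def by blast
      thus ?thesis
        using s E2(2) unfolding isolated_def nbrs_def by auto
    qed
    \<comment> \<open>\<open>f2\<close> depends on \<open>E2\<close>, but all its edges are in
      \<open>E'\<close>, so the exclusion of \<open>?B\<close> and \<open>?C\<close> covers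
      it.\<close>
    then obtain f2 where f2: "\<And>s. s \<in> ?I \<Longrightarrow> {s, f2 s} \<in> E' \<and> {s, f2 s} \<in> E2"
      by metis
    have E'K: "E' \<subseteq> Kn_edges n"
      using E' unfolding K'_def by blast
    have f2n: "f2 s < n" "f2 s \<noteq> s" if "s \<in> ?I" for s
      using f2[OF that] Kn_edges_endpoints[OF _ E'K, of s "f2 s"] by auto
    have f2S: "f2 s \<notin> S" if "s \<in> ?I" for s
      using nB f2[OF that] f2n[OF that] that by force
    have "collects_all n E2"
    proof (rule collects[THEN spec, THEN spec, THEN mp, THEN mp, THEN mp, OF E2(1), of f2])
      show "\<forall>s\<in>?I. f2 s < n \<and> f2 s \<notin> S \<and> {s, f2 s} \<in> E2"
        using f2 f2n f2S by simp
      show "\<forall>v\<in>Ugood. card (star v \<inter> f2 ` ?I) \<le> 1"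
      proof
        fix v assume v: "v \<in> Ugood"
        have "y = y'" if y: "y \<in> star v \<inter> f2 ` ?I" "y' \<in> star v \<inter> f2 ` ?I" for y y'
        proof (rule ccontr)
          assume "y \<noteq> y'"
          obtain s s' where "s \<in> ?I" "s' \<in> ?I" "y = f2 s" "y' = f2 s'"
            using y by blast
          hence "((v, y, y'), s, s') \<in> ?J" "?Cp ((v, y, y'), s, s') E'"
            using v y f2 \<open>y \<noteq> y'\<close> by auto
          thus False
            using nC by blast
        qed
        thus "card (star v \<inter> f2 ` ?I) \<le> 1"
          using finstar[OF v] by (simp add: card_le_Suc0_iff_eq)
      qed
    qed
    thus False
      using E2(4) by simp
  qed
  also have "\<dots> \<le> rprob K' j ?A + (rprob K' j ?B + rprob K' j ?C)"
    by (rule order.trans[OF rprob_disj[OF finK'] add_left_mono[OF rprob_disj[OF finK']]])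
  also have "\<dots> \<le> card ?I * exp (- (p * real (n - 1))) +
    (real (card ?I) * real (card S) * p +
     (real q * (real (2 * k + 6))\<^sup>2 * (real (card ?I))\<^sup>2) * p\<^sup>2)"
  proof (intro add_mono)
    show "rprob K' j ?A \<le> card ?I * exp (- (p * real (n - 1)))"
    proof (rule rprob_UN_bound[OF finK' finI])
      fix s assume s: "s \<in> ?I"
      hence sn: "s < n"
        unfolding isolated_def by simp
      let ?Y = "(\<lambda>u. {s, u}) ` ({..<n} - {s})"
      have "rprob K' j (\<lambda>E'. nbrs E' s = {}) \<le> rprob K' j (\<lambda>E'. {} \<subseteq> E' \<and> E' \<inter> ?Y = {})"
        by (rule rprob_mono[OF finK']) (auto simp: nbrs_def)
      also have "\<dots> \<le> (j / card K') ^ card ({} :: nat set set) *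
          (1 - real (j - card ({} :: nat set set)) / card K') ^ card ?Y"
        using inK'[OF s] j by (intro rprob_contain_avoid[OF finK']) auto
      also have "\<dots> = (1 - p) ^ card ?Y"
        unfolding p_def by simp
      also have "card ?Y = n - 1"
        using sn by (subst card_image) (auto simp: inj_on_def doubleton_eq_iff)
      also have "(1 - p) ^ (n - 1) \<le> exp (- p) ^ (n - 1)"
        using p exp_ge_add_one_self[of "- p"] by (intro power_mono) auto
      also have "\<dots> = exp (- (p * real (n - 1)))"
        by (simp add: exp_of_nat_mult[symmetric] mult_ac)
      finally show "rprob K' j (\<lambda>E'. nbrs E' s = {}) \<le> exp (- (p * real (n - 1)))" .
    qed auto
    show "rprob K' j ?B \<le> real (card ?I) * real (card S) * p"
    proof (rule rprob_UN_bound[OF finK'])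
      have sub: "{(s, y). s \<in> ?I \<and> y \<in> S \<and> s \<noteq> y} \<subseteq> ?I \<times> S"
        by auto
      show "finite {(s, y). s \<in> ?I \<and> y \<in> S \<and> s \<noteq> y}"
        using finite_subset[OF sub] finI S_props by simp
      have "card {(s, y). s \<in> ?I \<and> y \<in> S \<and> s \<noteq> y} \<le> card (?I \<times> S)"
        using finI S_props by (intro card_mono sub) simp
      thus "real (card {(s, y). s \<in> ?I \<and> y \<in> S \<and> s \<noteq> y}) \<le> real (card ?I) * real (card S)"
        by (simp add: card_cartesian_product flip: of_nat_mult)
      fix i assume "i \<in> {(s, y). s \<in> ?I \<and> y \<in> S \<and> s \<noteq> y}"
      hence i: "fst i \<in> ?I" "snd i \<in> S" "fst i \<noteq> snd i"
        by auto
      have "snd i < n"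
        using i(2) S_props by blast
      hence "{{fst i, snd i}} \<subseteq> K'"
        using inK'[OF i(1), of "snd i"] i(3) by auto
      from rprob_contain[OF finK' this j] show "rprob K' j (\<lambda>E'. {{fst i, snd i}} \<subseteq> E') \<le> p"
        unfolding p_def by simp
    qed (use p in auto)
    show "rprob K' j ?C \<le> (real q * (real (2 * k + 6))\<^sup>2 * (real (card ?I))\<^sup>2) * p\<^sup>2"
    proof (rule rprob_UN_bound[OF finK'])
      show "finite ?J"
        using finstar finI by auto
      have "card ?J = (\<Sum>v\<in>Ugood. (card (star v))\<^sup>2) * (card ?I)\<^sup>2"
        using finstar by (simp add: card_cartesian_product power2_eq_square)
      also have "\<dots> \<le> (\<Sum>v\<in>Ugood. (2 * k + 6)\<^sup>2) * (card ?I)\<^sup>2"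
        using star by (intro mult_right_mono sum_mono power_mono) auto
      also have "\<dots> = card Ugood * (2 * k + 6)\<^sup>2 * (card ?I)\<^sup>2"
        by simp
      also have "\<dots> \<le> q * (2 * k + 6)\<^sup>2 * (card ?I)\<^sup>2"
        using card_mono[of "{..<q}" Ugood] by (intro mult_right_mono) auto
      finally have "real (card ?J) \<le> real (q * (2 * k + 6)\<^sup>2 * (card ?I)\<^sup>2)"
        by (simp only: of_nat_le_iff)
      thus "real (card ?J) \<le> real q * (real (2 * k + 6))\<^sup>2 * (real (card ?I))\<^sup>2"
        by simp
      fix i assume "i \<in> ?J"
      then obtain v y y' s s' where i: "i = ((v, y, y'), s, s')" "v \<in> Ugood" "y \<in> star v" "y' \<in> star v"
        "s \<in> ?I" "s' \<in> ?I"
        by auto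
      have yS: "y \<notin> S" "y' \<notin> S" "y < n" "y' < n"
        using star[OF i(2)] i(3,4) by auto
      have sS: "s \<in> S" "s' \<in> S"
        using i(5,6) isolated_subset_poor by auto
      show "rprob K' j (?Cp i) \<le> p\<^sup>2"
      proof (cases "y = y'")
        case False
        \<comment> \<open>\<open>s\<close>, \<open>s'\<close> are poor and \<open>y\<close>,
          \<open>y'\<close> are not, so equal edges would force \<open>y = y'\<close>. Two different
          edges are needed for the factor \<open>p\<^sup>2\<close>.\<close>
        have "{s, y} \<noteq> {s', y'}"
          using False yS sS by (auto simp: doubleton_eq_iff)
        hence c: "card {{s, y}, {s', y'}} = 2"
          by simp
        have "{{s, y}, {s', y'}} \<subseteq> K'"
          using inK'[OF i(5) yS(3)] inK'[OF i(6) yS(4)] yS sS by auto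
        from rprob_contain[OF finK' this j] show ?thesis
          using False c i(1) unfolding p_def by simp
      next
        case True
        hence "rprob K' j (?Cp i) = 0"
          unfolding i(1) rprob_def by simp
        thus ?thesis
          by simp
      qed
    qed (use p in auto)
  qed
  finally show ?thesis .
qed

end

lemma connected_imp_not_isolated:
  assumes "graph_connected n E" "2 \<le> n"
  shows "isolated n E = {}"
proof (rule ccontr)
  assume "isolated n E \<noteq> {}"
  then obtain v where v: "v < n" "nbrs E v = {}"
    unfolding isolated_def by blast
  obtain u where u: "u < n" "u \<noteq> v"
    using assms(2) by (intro that[of "if v = 0 then 1 else 0"]) auto
  have "(v, u) \<in> {(x, y). {x, y} \<in> E}\<^sup>*"
    using assms(1) v u unfolding graph_connected_def by blast
  thus False
    using u(2) v(2) unfolding nbrs_def by (cases rule: converse_rtranclE) auto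
qed

lemma Kn_connected: "graph_connected n (Kn_edges n)"
  unfolding graph_connected_def
proof (intro allI impI)
  fix u v assume "u < n" "v < n"
  thus "(u, v) \<in> {(x, y). {x, y} \<in> Kn_edges n}\<^sup>*"
    by (cases "u = v") (auto intro!: r_into_rtrancl edge_in_Kn)
qed

text \<open>The isolated vertices at time \<open>m\<close> force \<open>M > m\<close>, and
  \<open>G M\<close> has none. Either \<open>M\<close> lies in the second round, where
  \<open>coll\<close> applies to \<open>G M\<close>, or after it, where the protocol for
  \<open>E \<union> E'\<close> is still available.\<close>

lemma acq_at_connectivity_time:
  fixes m j :: nat
  assumes \<sigma>: "\<sigma> \<in> edge_orderings n" and n: "2 \<le> n"
  defines "E \<equiv> set (take m \<sigma>)" and "E' \<equiv> set (take j (drop m \<sigma>))"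
  assumes iso: "isolated n E \<noteq> {}" "isolated n (E \<union> E') = {}"
    and coll: "\<And>E2. E \<subseteq> E2 \<Longrightarrow> E2 \<subseteq> E \<union> E' \<Longrightarrow> isolated n E2 = {} \<Longrightarrow> collects_all n E2"
  shows "frac_acq_number n (process_graph \<sigma> (connectivity_time n \<sigma>)) = 1 \<and>
         unit_acq_number n (process_graph \<sigma> (connectivity_time n \<sigma>)) = 1"
proof -
  define G where "G M = set (take M \<sigma>)" for M
  define M where "M = connectivity_time n \<sigma>"
  have set\<sigma>: "set \<sigma> = Kn_edges n"
    using \<sigma> permutations_of_setD unfolding edge_orderings_def by blast
  have G_mono: "G a \<subseteq> G b" if "a \<le> b" for a b
    unfolding G_def using that by (rule set_take_subset_set_take)
  have GE: "G m = E" "G (m + j) = E \<union> E'"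
    unfolding G_def E_def E'_def by (simp_all add: take_add)
  have "graph_connected n (G (length \<sigma>))"
    unfolding G_def using Kn_connected set\<sigma> by simp
  hence "graph_connected n (G M)"
    unfolding M_def connectivity_time_def process_graph_def G_def[symmetric] by (rule LeastI)
  hence GM: "isolated n (G M) = {}"
    using n by (rule connected_imp_not_isolated)
  have anti: "isolated n B \<subseteq> isolated n A" if "A \<subseteq> B" for A B
    using that unfolding isolated_def nbrs_def by blast
  have "\<not> M \<le> m"
    using G_mono[of M m] anti[of "G M" "G m"] GM GE iso(1) by auto
  hence EM: "E \<subseteq> G M"
    using G_mono[of m M] GE by simp
  have "collects_all n (G M)"
  proof (cases "M \<le> m + j")
    case True
    thus ?thesis
      using coll[OF EM] G_mono[OF True] GE GM by simp
  next
    case False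
    have "collects_all n (E \<union> E')"
      using coll[of "E \<union> E'"] iso(2) by simp
    moreover have "E \<union> E' \<subseteq> G M"
      using False G_mono[of "m + j" M] GE by simp
    ultimately show ?thesis
      by (rule collects_all_mono)
  qed
  moreover have "G M \<subseteq> Kn_edges n"
    unfolding G_def using set_take_subset[of M \<sigma>] set\<sigma> by simp
  ultimately show ?thesis
    using acq_numbers_eq_1[of n "G M"] n unfolding M_def G_def process_graph_def by simp
qed

section \<open>Choice of the parameters\<close>

text \<open>The first round ends slightly below the connectivity threshold \<open>n * ln n / 2\<close>. There must be isolated
  vertices left (hence \<open>99 / 200 < 1 / 2\<close>), but a vertex of degree at most 24 next to a poor vertex must be
  unlikely: this event has probability about \<open>n\<close> to the power \<open>1 + 4 / 100 - 99 / 100 * (1 + 1 / 10)\<close>, where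
  \<open>1 / 10\<close> comes from \<open>q0\<close> and \<open>4 / 100\<close> from \<open>d0\<close>.\<close>

definition m0 :: "nat \<Rightarrow> nat" where "m0 n = nat \<lfloor>99 / 200 * n * ln n\<rfloor>"
text \<open>Density about \<open>2 * ln n / n\<close> in the second round, enough to reach all
  isolated vertices.\<close>

definition j0 :: "nat \<Rightarrow> nat" where "j0 n = nat \<lceil>n * ln n\<rceil>"
definition q0 :: "nat \<Rightarrow> nat" where "q0 n = n div 10"
definition d0 :: "nat \<Rightarrow> nat" where "d0 n = nat \<lceil>ln n / 100\<rceil>"
text \<open>\<open>2 * h0 n\<close> is about half of \<open>d0 n\<close>; the other half absorbs the
  \<open>2 * 24\<close> neighbours lost to poor vertices and attachment points.\<close>

definition h0 :: "nat \<Rightarrow> nat" where "h0 n = nat \<lfloor>ln n / 400\<rfloor>"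
text \<open>\<open>rprob_dense_pair\<close> is used with \<open>C = 1100\<close>, where
  \<open>2 * exp 1 * C\<^sup>2\<close> is about 6.6 million, below \<open>10 ^ 7\<close>.\<close>

definition y0 :: "nat \<Rightarrow> nat" where "y0 n = n div 10 ^ 7"
text \<open>A set \<open>J1\<close> with \<open>6 * card J1 > y0\<close> is too large for
  \<open>expansion\<close> in \<open>ex_stars\<close> and must be large enough for
  \<open>dense\<close>.\<close>

definition y1 :: "nat \<Rightarrow> nat" where "y1 n = y0 n div 6"
text \<open>The expected number of edges between sets of sizes \<open>y1 n\<close> and
  \<open>b0 n\<close> thus becomes at least \<open>2 * n\<close>, more than
  \<open>n * ln 4\<close>.\<close>

definition b0 :: "nat \<Rightarrow> nat" where "b0 n = nat \<lceil>2 * 10 ^ 8 * n / ln n\<rceil>"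
definition g0 :: "nat \<Rightarrow> nat" where "g0 n = h0 n div 4"
definition a0 :: "nat \<Rightarrow> nat" where "a0 n = y0 n div g0 n"
text \<open>As \<open>g0 n \<ge> sqrt (ln n)\<close> eventually, each step of growth adds at least
  \<open>ln (ln n) / 2\<close> to the logarithm of the size; the final 1 makes
  \<open>n < g0 n ^ k0 n\<close> strict.\<close>

definition k0 :: "nat \<Rightarrow> nat" where "k0 n = nat \<lceil>2 * ln n / ln (ln n)\<rceil> + 1"

lemma nat_floor_bounds: "0 \<le> x \<Longrightarrow> real (nat \<lfloor>x\<rfloor>) \<le> x" "x - 1 \<le> real (nat \<lfloor>x\<rfloor>)"
  by linarith+

lemma nat_ceiling_bounds: "x \<le> real (nat \<lceil>x\<rceil>)" "0 \<le> x \<Longrightarrow> real (nat \<lceil>x\<rceil>) \<le> x + 1"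
  by linarith+

lemma div_bounds: "real (x div y) \<le> real x / real y" "real x / real y - 1 \<le> real (x div y)"
proof -
  show "real (x div y) \<le> real x / real y"
    by (rule of_nat_div_le_of_nat)
  show "real x / real y - 1 \<le> real (x div y)"
  proof (cases "y = 0")
    case False
    have "x < y + (x div y) * y"
      using False by (intro dividend_less_div_times) simp
    hence "real x \<le> real (y + (x div y) * y)"
      by (simp only: of_nat_le_iff)
    thus ?thesis
      using False by (simp add: field_simps)
  qed simp
qed

lemma real_choose_two: "real (n choose 2) = real n * (real n - 1) / 2"
  by (cases n) (simp_all add: choose_two real_of_nat_div algebra_simps)

lemma ev_ln_pos: "eventually (\<lambda>n::nat. 1 \<le> ln (real n) \<and> 10 \<le> n \<and> 1 \<le> ln (ln (real n))) sequentially"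
proof -
  have "eventually (\<lambda>n::nat. 1 \<le> ln (real n)) sequentially"
    "eventually (\<lambda>n::nat. 1 \<le> ln (ln (real n))) sequentially"
    by real_asymp+
  moreover have "eventually (\<lambda>n::nat. 10 \<le> n) sequentially"
    by (rule eventually_ge_at_top)
  ultimately show ?thesis
    by eventually_elim simp
qed

text \<open>\<open>s\<close> stands for the number of poor vertices. It depends on the random graph,
  so the bounds must hold uniformly in it.\<close>

lemma ev_numeric:
  "eventually (\<lambda>n. \<forall>s. real s < real n powr (95 / 100) \<longrightarrow>
     s < q0 n \<and> 2 * h0 n + 2 * 24 \<le> d0 n \<and> 24 \<le> h0 n \<and> 1 \<le> g0 n \<and> 4 * g0 n \<le> h0 n \<and>
     g0 n * a0 n \<le> y0 n \<and> 1 \<le> a0 n \<and> y1 n \<le> g0 n * a0 n \<and> b0 n \<le> g0 n * a0 n \<and> n < g0 n ^ k0 n \<and>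
     y0 n \<le> n \<and> 6 * y1 n \<le> y0 n \<and> 7 * q0 n + 2 * s + b0 n \<le> n \<and>
     2 * (2 * k0 n + 6) * (a0 n + b0 n) \<le> y0 n \<and> 4 * (2 * (2 * k0 n + 6)) \<le> h0 n) sequentially"
proof -
  have e1: "eventually (\<lambda>n::nat. real n powr (95/100) \<le> n / 10 - 1) sequentially" by real_asymp
  have e2: "eventually (\<lambda>n::nat. ln n / 200 + 48 \<le> ln n / 100) sequentially" by real_asymp
  have e3: "eventually (\<lambda>n::nat. 24 \<le> ln n / 400 - 1) sequentially" by real_asymp
  have e4: "eventually (\<lambda>n::nat. ln (real n) \<le> n / 10^7 / 6 - 1) sequentially" by real_asymp
  have e5: "eventually (\<lambda>n::nat. 2 * 10^8 * n / ln n + 1 \<le> n / 10^7 - 1 - ln n) sequentially" by real_asymp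
  have e6: "eventually (\<lambda>n::nat. sqrt (ln n) \<le> ln n / 1600 - 2) sequentially" by real_asymp
  have e7: "eventually (\<lambda>n::nat. 7 * (n / 10) + 2 * real n powr (95/100) + (2 * 10^8 * n / ln n + 1) \<le> n) sequentially"
    by real_asymp
  have e8: "eventually (\<lambda>n::nat. 2 * (2 * (2 * ln n / ln (ln n) + 2) + 6) * (n / (ln n / 1600 - 2) + (2 * 10^8 * n / ln n + 1))
      \<le> n / 10^7 - 1) sequentially"
    by real_asymp
  have e9: "eventually (\<lambda>n::nat. 4 * (2 * (2 * (2 * ln n / ln (ln n) + 2) + 6)) \<le> ln n / 400 - 1) sequentially"
    by real_asymp
  show ?thesis
    using e1 e2 e3 e4 e5 e6 e7 e8 e9 ev_ln_pos
  proof (eventually_elim, intro allI impI)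
    fix n s :: nat
    assume A: "real n powr (95/100) \<le> n / 10 - 1" "ln n / 200 + 48 \<le> ln n / 100"
      "24 \<le> ln n / 400 - 1" "ln (real n) \<le> n / 10^7 / 6 - 1"
      "2 * 10^8 * n / ln n + 1 \<le> n / 10^7 - 1 - ln n"
      "sqrt (ln n) \<le> ln n / 1600 - 2"
      "7 * (n / 10) + 2 * real n powr (95/100) + (2 * 10^8 * n / ln n + 1) \<le> n"
      "2 * (2 * (2 * ln n / ln (ln n) + 2) + 6) * (n / (ln n / 1600 - 2) + (2 * 10^8 * n / ln n + 1)) \<le> n / 10^7 - 1"
      "4 * (2 * (2 * (2 * ln n / ln (ln n) + 2) + 6)) \<le> ln n / 400 - 1"
      "1 \<le> ln (real n) \<and> 10 \<le> n \<and> 1 \<le> ln (ln (real n))"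
    assume s: "real s < real n powr (95 / 100)"
    define L where "L = ln (real n)"
    have L: "1 \<le> L" "1 \<le> ln L" and n: "10 \<le> n"
      using A(10) unfolding L_def by auto
    note A = A[folded L_def]
    have q: "real (q0 n) \<le> n / 10" "n / 10 - 1 \<le> real (q0 n)"
      using div_bounds[of n 10] unfolding q0_def by auto
    have d: "L / 100 \<le> real (d0 n)"
      using nat_ceiling_bounds(1)[of "L / 100"] unfolding d0_def L_def by simp
    have h: "real (h0 n) \<le> L / 400" "L / 400 - 1 \<le> real (h0 n)"
      using nat_floor_bounds[of "L / 400"] L unfolding h0_def L_def by auto
    have y: "real (y0 n) \<le> n / 10 ^ 7" "n / 10 ^ 7 - 1 \<le> real (y0 n)"
      using div_bounds[of n "10 ^ 7"] unfolding y0_def by auto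
    have b: "real (b0 n) \<le> 2 * 10 ^ 8 * n / L + 1"
      using nat_ceiling_bounds(2)[of "2 * 10 ^ 8 * n / L"] L unfolding b0_def L_def by simp
    have g: "real (g0 n) \<le> h0 n / 4" "h0 n / 4 - 1 \<le> real (g0 n)"
      using div_bounds[of "h0 n" 4] unfolding g0_def by auto
    have k: "2 * L / ln L + 1 \<le> real (k0 n)" "real (k0 n) \<le> 2 * L / ln L + 2"
    proof -
      have "0 \<le> 2 * L / ln L"
        using L by simp
      from nat_ceiling_bounds(1)[of "2 * L / ln L"] nat_ceiling_bounds(2)[OF this]
      show "2 * L / ln L + 1 \<le> real (k0 n)" "real (k0 n) \<le> 2 * L / ln L + 2"
        unfolding k0_def L_def[symmetric] by simp_all
    qed
    have h24: "24 \<le> h0 n"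
      using h(2) A(3) by linarith
    have g1: "1 \<le> g0 n"
      using h24 unfolding g0_def by simp
    have gL: "real (g0 n) \<le> L"
      using g(1) h(1) L by linarith
    have gl: "L / 1600 - 2 \<le> real (g0 n)"
      using g(2) h(2) by linarith
    have sqL: "1 \<le> sqrt L"
      using L by simp
    have ga: "g0 n * a0 n \<le> y0 n"
      unfolding a0_def by simp
    have a1: "1 \<le> a0 n"
    proof -
      have "real (g0 n) \<le> real (y0 n)"
        using gL A(4) y(2) L of_nat_0_le_iff[of n, where 'a = real] by (simp add: field_simps)
      thus ?thesis
        using g1 unfolding a0_def by (simp add: div_greater_zero_iff Suc_le_eq)
    qed
    have ga': "y0 n - g0 n \<le> g0 n * a0 n"
      using mod_less_divisor[of "g0 n" "y0 n"] g1 mult_div_mod_eq[of "g0 n" "y0 n"]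
      unfolding a0_def by linarith
    hence ga'': "real (y0 n) - real (g0 n) \<le> real (g0 n * a0 n)"
      by linarith
    have y1: "real (y1 n) \<le> y0 n / 6"
      using div_bounds(1)[of "y0 n" 6] unfolding y1_def by simp
    have i1: "s < q0 n"
      using s A(1) q(2) by linarith
    have i2: "2 * h0 n + 2 * 24 \<le> d0 n"
      using h(1) d A(2) by linarith
    have i3: "4 * g0 n \<le> h0 n"
      unfolding g0_def by simp
    have i4: "y1 n \<le> g0 n * a0 n"
    proof -
      have "L \<le> (real (y0 n) + 1) / 6 - 1"
        using y(2) A(4) by (simp add: field_simps)
      hence "real (y1 n) \<le> real (y0 n) - real (g0 n)"
        using y1 gL of_nat_0_le_iff[of "y0 n", where 'a = real] by (simp add: field_simps)
      hence "real (y1 n) \<le> real (g0 n * a0 n)"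
        using ga'' by (rule order.trans)
      thus ?thesis
        by (simp only: of_nat_le_iff)
    qed
    have i5: "b0 n \<le> g0 n * a0 n"
    proof -
      have "real (b0 n) \<le> real (g0 n * a0 n)"
        using ga'' b gL y(2) A(5) by linarith
      thus ?thesis
        by (simp only: of_nat_le_iff)
    qed
    have i6: "n < g0 n ^ k0 n"
    proof -
      have "real n = exp L"
        using n unfolding L_def by simp
      also have "L < (2 * L / ln L + 1) * (ln L / 2)"
      proof -
        have "L \<noteq> 1"
          using L(2) by auto
        thus ?thesis
          using L by (simp add: field_simps)
      qed
      hence "exp L < exp ((2 * L / ln L + 1) * (ln L / 2))"
        by simp
      also have "\<dots> \<le> exp (real (k0 n) * (ln L / 2))"
        using k(1) L unfolding exp_le_cancel_iff by (intro mult_right_mono) auto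
      also have "\<dots> = sqrt L ^ k0 n"
        using L by (simp add: exp_of_nat_mult ln_sqrt[symmetric])
      also have "\<dots> \<le> real (g0 n) ^ k0 n"
        using A(6) gl sqL by (intro power_mono) auto
      finally show ?thesis
        by (simp flip: of_nat_power)
    qed
    have i7: "y0 n \<le> n" "6 * y1 n \<le> y0 n"
      unfolding y0_def y1_def by simp_all
    have i8: "7 * q0 n + 2 * s + b0 n \<le> n"
    proof -
      have "real (7 * q0 n + 2 * s + b0 n) \<le> real n"
        using s q(1) b A(7) by simp
      thus ?thesis
        by (simp only: of_nat_le_iff)
    qed
    have i9: "2 * (2 * k0 n + 6) * (a0 n + b0 n) \<le> y0 n"
    proof -
      have pos: "0 < L / 1600 - 2"
        using A(6) sqL by linarith
      have "real (a0 n) \<le> real (y0 n) / real (g0 n)"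
        unfolding a0_def by (rule div_bounds)
      also have "\<dots> \<le> n / (L / 1600 - 2)"
        using i7(1) gl pos by (intro frac_le) auto
      finally have "real (a0 n + b0 n) \<le> n / (L / 1600 - 2) + (2 * 10 ^ 8 * n / L + 1)"
        using b by simp
      moreover have "real (2 * (2 * k0 n + 6)) \<le> 2 * (2 * (2 * L / ln L + 2) + 6)"
        using k(2) by simp
      ultimately have "real (2 * (2 * k0 n + 6)) * real (a0 n + b0 n) \<le>
          2 * (2 * (2 * L / ln L + 2) + 6) * (n / (L / 1600 - 2) + (2 * 10 ^ 8 * n / L + 1))"
        using L by (intro mult_mono) auto
      also have "\<dots> \<le> real (y0 n)"
        using A(8) y(2) by linarith
      finally show ?thesis
        by (simp only: of_nat_le_iff flip: of_nat_mult)
    qed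
    have i10: "4 * (2 * (2 * k0 n + 6)) \<le> h0 n"
    proof -
      have "real (4 * (2 * (2 * k0 n + 6))) \<le> real (h0 n)"
        using k(2) A(9) h(2) by simp
      thus ?thesis
        by (simp only: of_nat_le_iff)
    qed
    show "s < q0 n \<and> 2 * h0 n + 2 * 24 \<le> d0 n \<and> 24 \<le> h0 n \<and> 1 \<le> g0 n \<and> 4 * g0 n \<le> h0 n \<and>
     g0 n * a0 n \<le> y0 n \<and> 1 \<le> a0 n \<and> y1 n \<le> g0 n * a0 n \<and> b0 n \<le> g0 n * a0 n \<and> n < g0 n ^ k0 n \<and>
     y0 n \<le> n \<and> 6 * y1 n \<le> y0 n \<and> 7 * q0 n + 2 * s + b0 n \<le> n \<and>
     2 * (2 * k0 n + 6) * (a0 n + b0 n) \<le> y0 n \<and> 4 * (2 * (2 * k0 n + 6)) \<le> h0 n"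
      by (intro conjI i1 i2 h24 g1 i3 ga a1 i4 i5 i6 i7 i8 i9 i10)
  qed
qed

text \<open>Thinning with \<open>z0\<close> costs the factor \<open>1 - z0 \<ge> 98 / 100\<close>.
  The quadratic Taylor bound is sharp enough at \<open>1 / 4\<close>; its 16th power is about
  52.7.\<close>

lemma exp_minus_4_le: "exp (- 4 :: real) \<le> 2 / 100"
proof -
  have "(1 + 1/4 + (1/4)\<^sup>2 / 2) ^ 16 \<le> (exp (1 / 4 :: real)) ^ 16"
    by (intro power_mono exp_lower_Taylor_quadratic) auto
  also have "\<dots> = exp 4"
    by (simp add: exp_of_nat_mult[symmetric])
  finally have "50 \<le> exp (4 :: real)"
    by (simp add: power_divide power2_eq_square)
  thus ?thesis
    by (simp add: exp_minus field_simps)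
qed

text \<open>\<open>985 / 1000\<close> lies slightly below the limit factor \<open>99 / 100\<close>;
  the gap absorbs rounding and the 100 excluded edges. The last two bounds serve the second moment
  and the existence of the second round.\<close>

lemma ev_density:
  "eventually (\<lambda>n. real (m0 n) / (n choose 2) \<le> ln n / n \<and>
     985 / 1000 * (ln n / n) \<le> real (m0 n - 100) / (n choose 2) \<and>
     real (m0 n) \<le> 99 / 200 * n * ln n \<and> m0 n + 2 * (n - 1) < n choose 2 \<and> m0 n + j0 n \<le> n choose 2) sequentially"
proof -
  have e1: "eventually (\<lambda>n::nat. 99 / 200 * n * ln n / (real n * (real n - 1) / 2) \<le> ln n / n) sequentially"
    by real_asymp
  have e2: "eventually (\<lambda>n::nat. 985 / 1000 * (ln n / n) \<le> (99 / 200 * n * ln n - 101) / (real n * (real n - 1) / 2)) sequentially"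
    by real_asymp
  have e3: "eventually (\<lambda>n::nat. 99 / 200 * n * ln n + 2 * n < real n * (real n - 1) / 2) sequentially"
    by real_asymp
  have e4: "eventually (\<lambda>n::nat. 99 / 200 * n * ln n + (n * ln n + 1) \<le> real n * (real n - 1) / 2) sequentially"
    by real_asymp
  show ?thesis
    using e1 e2 e3 e4 ev_ln_pos
  proof eventually_elim
    case (elim n)
    have m: "real (m0 n) \<le> 99 / 200 * n * ln n" "99 / 200 * n * ln n - 1 \<le> real (m0 n)"
      using nat_floor_bounds[of "99 / 200 * n * ln n"] elim(5) unfolding m0_def by auto
    have j: "real (j0 n) \<le> n * ln n + 1"
      using nat_ceiling_bounds(2)[of "n * ln n"] elim(5) unfolding j0_def by auto
    have N: "0 < real n * (real n - 1) / 2"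
      using elim(5) by simp
    have "real (m0 n) / (real n * (real n - 1) / 2) \<le> 99 / 200 * n * ln n / (real n * (real n - 1) / 2)"
      using N by (intro divide_right_mono m(1)) auto
    hence "real (m0 n) / (n choose 2) \<le> ln n / n"
      unfolding real_choose_two using elim(1) by linarith
    moreover have "99 / 200 * n * ln n - 101 \<le> real (m0 n - 100)"
      using m(2) by linarith
    hence "(99 / 200 * n * ln n - 101) / (real n * (real n - 1) / 2) \<le> real (m0 n - 100) / (n choose 2)"
      unfolding real_choose_two using N by (intro divide_right_mono) auto
    hence "985 / 1000 * (ln n / n) \<le> real (m0 n - 100) / (n choose 2)"
      using elim(2) by linarith
    moreover have "real (m0 n + 2 * (n - 1)) < real (n choose 2)"
      unfolding real_choose_two using m(1) elim(3) by simp
    hence "m0 n + 2 * (n - 1) < n choose 2"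
      by (simp only: of_nat_less_iff)
    moreover have "real (m0 n + j0 n) \<le> real (n choose 2)"
      unfolding real_choose_two using m(1) j elim(4) by simp
    hence "m0 n + j0 n \<le> n choose 2"
      by (simp only: of_nat_le_iff)
    ultimately show ?case
      using m(1) by blast
  qed
qed

text \<open>\<open>(1 / z0) ^ d0 n\<close> is then of order \<open>n powr (4 / 100)\<close>, while
  \<open>1 - z0\<close> stays close to 1.\<close>

abbreviation "z0 \<equiv> exp (- 4) :: real"

text \<open>The exponent of \<open>n\<close> is \<open>4 / 100 - 98 / 100 * 985 / 1000 / 10\<close>,
  about -0.0565. Excluding 100 vertices and edges covers the largest configuration, with
  \<open>2 * 25 + 1\<close> vertices.\<close>

lemma ev_poor_weight:
  "eventually (\<lambda>n. poor_weight n (q0 n) (d0 n) (m0 n) z0 100 \<le> exp (- (55 / 1000) * ln n)) sequentially"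
proof -
  have e1: "eventually (\<lambda>n::nat. 2 * exp (4 * (ln n / 100 + 1)) * exp (- (98 / 100 * (985 / 1000 * (ln n / n)) * (n / 10 - 101)))
      \<le> exp (- (55 / 1000) * ln n)) sequentially"
    by real_asymp
  show ?thesis
    using e1 ev_density ev_ln_pos
  proof eventually_elim
    case (elim n)
    have d: "real (d0 n) \<le> ln n / 100 + 1"
      using nat_ceiling_bounds(2)[of "ln n / 100"] elim(3) unfolding d0_def by auto
    have "real n / 10 - 1 \<le> real (q0 n)"
      using div_bounds(2)[of n 10] unfolding q0_def by simp
    hence q: "real n / 10 - 101 \<le> real (q0 n - 100)"
      by linarith
    have "(1 / z0) ^ d0 n = exp (4 * real (d0 n))"
      by (simp add: exp_minus inverse_eq_divide exp_of_nat_mult[symmetric] mult.commute)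
    also have "\<dots> \<le> exp (4 * (ln n / 100 + 1))"
      using d by simp
    finally have 1: "(1 / z0) ^ d0 n \<le> exp (4 * (ln n / 100 + 1))" .
    have "98 / 100 * (985 / 1000 * (ln n / n)) * (n / 10 - 101) \<le>
        98 / 100 * (985 / 1000 * (ln n / n)) * real (q0 n - 100)"
      using q elim(3) by (intro mult_left_mono) auto
    also have "\<dots> \<le> (1 - z0) * (real (m0 n - 100) / (n choose 2)) * real (q0 n - 100)"
      using exp_minus_4_le elim by (intro mult_right_mono mult_mono) auto
    finally have "exp (- ((1 - z0) * (real (m0 n - 100) / (n choose 2)) * real (q0 n - 100))) \<le>
        exp (- (98 / 100 * (985 / 1000 * (ln n / n)) * (n / 10 - 101)))"
      by simp
    hence "poor_weight n (q0 n) (d0 n) (m0 n) z0 100 \<le>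
        2 * exp (4 * (ln n / 100 + 1)) * exp (- (98 / 100 * (985 / 1000 * (ln n / n)) * (n / 10 - 101)))"
      using 1 unfolding poor_weight_def by (intro mult_mono) auto
    thus ?case
      using elim(1) by linarith
  qed
qed

section \<open>Limits\<close>

lemma squeeze_0:
  fixes f g :: "nat \<Rightarrow> real"
  assumes "\<And>n. 0 \<le> f n" "eventually (\<lambda>n. f n \<le> g n) sequentially" "g \<longlonglongrightarrow> 0"
  shows "f \<longlonglongrightarrow> 0"
  using assms by (intro tendsto_sandwich[of "\<lambda>_. 0" f sequentially g]) auto

lemma exp_1_le: "exp (1 :: real) \<le> 272 / 100"
  using e_less_272 by simp

abbreviation "poor0 n \<equiv> poor n (q0 n) (d0 n)"
abbreviation "dens n \<equiv> real (m0 n) / real (n choose 2)"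

lemma two_q0_le: "2 * q0 n \<le> n"
  unfolding q0_def by simp

lemma z0: "0 < z0" "z0 \<le> 1"
  by simp_all

lemma ev_n_dens: "eventually (\<lambda>n. real n * dens n \<le> ln n) sequentially"
  using ev_density ev_ln_pos
proof eventually_elim
  case (elim n)
  hence "real n * dens n \<le> real n * (ln n / n)"
    by (intro mult_left_mono) auto
  thus ?case
    using elim by simp
qed

text \<open>\<open>25 * 55 / 1000 > 1\<close>, so the 25th power beats the factor \<open>n\<close>;
  hence 24 as the bound \<open>c\<close>.\<close>

lemma lim_poor_nbrs:
  "(\<lambda>n. rprob (Kn_edges n) (m0 n) (many_poor_nbrs n (q0 n) (d0 n) 25)) \<longlonglongrightarrow> 0"
proof (rule squeeze_0[OF rprob_nonneg])
  show "eventually (\<lambda>n. rprob (Kn_edges n) (m0 n) (many_poor_nbrs n (q0 n) (d0 n) 25) \<le>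
      n * (ln n * exp (- (55 / 1000) * ln n)) ^ 25) sequentially"
    using ev_density ev_ln_pos ev_n_dens ev_poor_weight
  proof eventually_elim
    case (elim n)
    have "rprob (Kn_edges n) (m0 n) (many_poor_nbrs n (q0 n) (d0 n) 25) \<le>
        n * (n * dens n * poor_weight n (q0 n) (d0 n) (m0 n) z0 100) ^ 25"
      by (rule rprob_many_poor_nbrs) (use elim z0 two_q0_le in auto)
    also have "\<dots> \<le> n * (ln n * exp (- (55 / 1000) * ln n)) ^ 25"
      using elim poor_weight_nonneg[OF z0(1)] by (intro mult_left_mono power_mono mult_mono) auto
    finally show ?case .
  qed
  show "(\<lambda>n. real n * (ln n * exp (- (55 / 1000) * ln n)) ^ 25) \<longlonglongrightarrow> 0"
    by real_asymp
qed

lemma lim_poor_second_nbrs: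
  "(\<lambda>n. rprob (Kn_edges n) (m0 n) (many_poor_paths n (q0 n) (d0 n) 25)) \<longlonglongrightarrow> 0"
proof (rule squeeze_0[OF rprob_nonneg])
  show "eventually (\<lambda>n. rprob (Kn_edges n) (m0 n) (many_poor_paths n (q0 n) (d0 n) 25) \<le>
      n * ((ln n)\<^sup>2 * exp (- (55 / 1000) * ln n)) ^ 25) sequentially"
    using ev_density ev_ln_pos ev_n_dens ev_poor_weight
  proof eventually_elim
    case (elim n)
    have "rprob (Kn_edges n) (m0 n) (many_poor_paths n (q0 n) (d0 n) 25) \<le>
        n * ((n * dens n)\<^sup>2 * poor_weight n (q0 n) (d0 n) (m0 n) z0 100) ^ 25"
      by (rule rprob_many_poor_second_nbrs) (use elim z0 two_q0_le in auto)
    also have "\<dots> \<le> n * ((ln n)\<^sup>2 * exp (- (55 / 1000) * ln n)) ^ 25"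
      using elim poor_weight_nonneg[OF z0(1)] by (intro mult_left_mono power_mono mult_mono) auto
    finally show ?case .
  qed
  show "(\<lambda>n. real n * ((ln n)\<^sup>2 * exp (- (55 / 1000) * ln n)) ^ 25) \<longlonglongrightarrow> 0"
    by real_asymp
qed

text \<open>The exponent of \<open>n\<close> is 1 from \<open>n\<^sup>2 * p\<close>, plus
  \<open>4 / 100\<close> from thinning, minus \<open>98 / 100 * 985 / 1000 * 11 / 10\<close>: about
  -0.02.\<close>

lemma lim_low_next_to_poor:
  "(\<lambda>n. rprob (Kn_edges n) (m0 n) (low_next_to_poor n (q0 n) (d0 n) 24)) \<longlonglongrightarrow> 0"
proof (rule squeeze_0[OF rprob_nonneg])
  let ?g = "\<lambda>n::nat. 2 * (real n)\<^sup>2 * (ln n / n) * exp (4 * (24 + (ln n / 100 + 1))) *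
      exp (- (98 / 100 * (985 / 1000 * (ln n / n)) * (11 / 10 * n - 5)))"
  show "eventually (\<lambda>n. rprob (Kn_edges n) (m0 n) (low_next_to_poor n (q0 n) (d0 n) 24) \<le> ?g n) sequentially"
    using ev_density ev_ln_pos
  proof eventually_elim
    case (elim n)
    have d: "real (d0 n) \<le> ln n / 100 + 1"
      using nat_ceiling_bounds(2)[of "ln n / 100"] elim(2) unfolding d0_def by auto
    have "real n / 10 - 1 \<le> real (q0 n)"
      using div_bounds(2)[of n 10] unfolding q0_def by simp
    hence q: "11 / 10 * real n - 5 \<le> real (n - 2 + (q0 n - 2))"
      using elim(2) by linarith
    have "(1 / z0) ^ (24 + d0 n) = exp (4 * (24 + real (d0 n)))"
      by (simp add: exp_minus inverse_eq_divide exp_of_nat_mult[symmetric] mult.commute)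
    also have "\<dots> \<le> exp (4 * (24 + (ln n / 100 + 1)))"
      using d by simp
    finally have 1: "(1 / z0) ^ (24 + d0 n) \<le> exp (4 * (24 + (ln n / 100 + 1)))" .
    have "real (m0 n - 100) / (n choose 2) \<le> real (m0 n - 1) / (n choose 2)"
      by (intro divide_right_mono) auto
    hence th: "985 / 1000 * (ln n / n) \<le> real (m0 n - 1) / (n choose 2)"
      using elim(1) by linarith
    have "98 / 100 * (985 / 1000 * (ln n / n)) * (11 / 10 * n - 5) \<le>
        98 / 100 * (985 / 1000 * (ln n / n)) * real (n - 2 + (q0 n - 2))"
      using q elim(2) by (intro mult_left_mono) auto
    also have "\<dots> \<le> (1 - z0) * (real (m0 n - 1) / (n choose 2)) * real (n - 2 + (q0 n - 2))"
      using exp_minus_4_le th elim(2) by (intro mult_right_mono mult_mono) auto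
    finally have 2: "exp (- ((1 - z0) * (real (m0 n - 1) / (n choose 2)) * real (n - 2 + (q0 n - 2)))) \<le>
        exp (- (98 / 100 * (985 / 1000 * (ln n / n)) * (11 / 10 * n - 5)))"
      by simp
    have "rprob (Kn_edges n) (m0 n) (low_next_to_poor n (q0 n) (d0 n) 24) \<le>
        2 * (real n)\<^sup>2 * dens n * (1 / z0) ^ (24 + d0 n) *
        exp (- ((1 - z0) * (real (m0 n - 1) / (n choose 2)) * real (n - 2 + (q0 n - 2))))"
      by (rule rprob_low_next_to_poor) (use elim z0 two_q0_le in auto)
    also have "\<dots> \<le> ?g n"
      using elim 1 2 by (intro mult_mono mult_left_mono) auto
    finally show ?case .
  qed
  show "?g \<longlonglongrightarrow> 0"
    by real_asymp
qed

text \<open>\<open>exp 1 * n * dens n / h0 n\<close> is asymptotically at most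
  \<open>2.72 * 400 = 1088\<close>, hence \<open>C = 1100\<close>.\<close>

lemma lim_dense_pair:
  "(\<lambda>n. rprob (Kn_edges n) (m0 n) (dense_pair n (h0 n) (y0 n))) \<longlonglongrightarrow> 0"
proof (rule squeeze_0[OF rprob_nonneg])
  have e1: "eventually (\<lambda>n::nat. 272 / 100 * ln n / (ln n / 400 - 1) \<le> 1100) sequentially"
    by real_asymp
  have e2: "eventually (\<lambda>n::nat. 1 \<le> ln n / 400 - 1) sequentially"
    by real_asymp
  show "eventually (\<lambda>n. rprob (Kn_edges n) (m0 n) (dense_pair n (h0 n) (y0 n)) \<le> n * (ln n) * (exp 1 * 1100\<^sup>2 / n)\<^sup>2) sequentially"
    using ev_density ev_ln_pos ev_n_dens e1 e2
  proof eventually_elim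
    case (elim n)
    have h: "real (h0 n) \<le> ln n / 400" "ln n / 400 - 1 \<le> real (h0 n)"
      using nat_floor_bounds[of "ln n / 400"] elim(2) unfolding h0_def by auto
    have y: "real (y0 n) \<le> n / 10 ^ 7"
      using div_bounds(1)[of n "10 ^ 7"] unfolding y0_def by auto
    have "rprob (Kn_edges n) (m0 n) (dense_pair n (h0 n) (y0 n)) \<le> n * h0 n * (exp 1 * 1100\<^sup>2 / n)\<^sup>2"
    proof (rule rprob_dense_pair)
      have "exp 1 * real n * dens n / real (h0 n) = exp 1 * (real n * dens n) / real (h0 n)"
        by simp
      also have "\<dots> \<le> 272 / 100 * ln n / (ln n / 400 - 1)"
        using exp_1_le elim h by (intro frac_le mult_mono mult_nonneg_nonneg) auto
      finally show "exp 1 * real n * dens n / real (h0 n) \<le> 1100"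
        using elim(4) by linarith
      have "exp 1 * 1100\<^sup>2 * real (y0 n) \<le> 272 / 100 * 1100\<^sup>2 * (n / 10 ^ 7)"
        using exp_1_le y by (intro mult_mono) auto
      also have "\<dots> \<le> n / 2"
        by simp
      finally show "2 * (exp 1 * 1100\<^sup>2 * real (y0 n)) \<le> n"
        by simp
      show "0 < h0 n"
        using h elim(5) by linarith
      show "2 * y0 n \<le> n"
        unfolding y0_def by simp
    qed (use elim in auto)
    also have "\<dots> \<le> n * (ln n) * (exp 1 * 1100\<^sup>2 / n)\<^sup>2"
      using h elim(2) by (intro mult_right_mono mult_left_mono) auto
    finally show ?case
      by simp
  qed
  show "(\<lambda>n. real n * (ln n) * (exp 1 * 1100\<^sup>2 / n)\<^sup>2) \<longlonglongrightarrow> 0"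
    by real_asymp
qed

lemma lim_no_edges_between:
  "(\<lambda>n. rprob (Kn_edges n) (m0 n) (separated_pair n (y1 n) (b0 n))) \<longlonglongrightarrow> 0"
proof (rule squeeze_0[OF rprob_nonneg])
  have e1: "eventually (\<lambda>n::nat. 2 * real n \<le> 985 / 1000 * (2 * 10 ^ 8 * ((n / 10 ^ 7 - 1) / 6 - 1))) sequentially"
    by real_asymp
  have e2: "eventually (\<lambda>n::nat. 0 \<le> (n / 10 ^ 7 - 1) / 6 - (1 :: real)) sequentially"
    by real_asymp
  show "eventually (\<lambda>n. rprob (Kn_edges n) (m0 n) (separated_pair n (y1 n) (b0 n)) \<le> 4 ^ n * exp (- (2 * real n))) sequentially"
    using ev_density ev_ln_pos e1 e2
  proof eventually_elim
    case (elim n)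
    have b: "2 * 10 ^ 8 * real n / ln n \<le> real (b0 n)"
      using nat_ceiling_bounds(1)[of "2 * 10 ^ 8 * n / ln n"] unfolding b0_def by simp
    have "(n / 10 ^ 7 - 1) / 6 - 1 \<le> real (y0 n) / 6 - 1"
      using div_bounds(2)[of n "10 ^ 7"] unfolding y0_def by (intro diff_right_mono divide_right_mono) auto
    also have "\<dots> \<le> real (y1 n)"
      using div_bounds(2)[of "y0 n" 6] unfolding y1_def by simp
    finally have y: "(n / 10 ^ 7 - 1) / 6 - 1 \<le> real (y1 n)" .
    have "real (m0 n - 100) / (n choose 2) \<le> dens n"
      by (intro divide_right_mono) auto
    hence p: "985 / 1000 * (ln n / n) \<le> dens n"
      using elim(1) by linarith
    have cancel: "985 / 1000 * (l / x) * (c * (2 * 10 ^ 8 * x / l)) = 985 / 1000 * (2 * 10 ^ 8 * c)"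
      if "0 < l" "0 < x" for l x c :: real
      using that by (simp add: field_simps)
    have "2 * real n \<le> 985 / 1000 * (ln n / n) * (((n / 10 ^ 7 - 1) / 6 - 1) * (2 * 10 ^ 8 * real n / ln n))"
      using elim(2,3) by (subst cancel) auto
    also have "\<dots> \<le> dens n * (real (y1 n) * real (b0 n))"
      using p y b elim(2,4) by (intro mult_mono mult_nonneg_nonneg) auto
    finally have "exp (- (dens n * real (y1 n * b0 n))) \<le> exp (- (2 * real n))"
      by simp
    hence "4 ^ n * exp (- (dens n * real (y1 n * b0 n))) \<le> 4 ^ n * exp (- (2 * real n))"
      by (intro mult_left_mono) auto
    thus ?case
      using rprob_no_edges_between[of "m0 n" n "y1 n" "b0 n"] elim(1) by linarith
  qed
  \<comment> \<open>Any exponent between \<open>ln 4\<close> and 2 would let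
    \<open>exp (- 2 * n)\<close> beat \<open>4 ^ n\<close>.\<close>
  have "4 \<le> exp (3 / 2 :: real)"
  proof -
    have "(1 + 3/4 + (3/4)\<^sup>2 / 2) ^ 2 \<le> (exp (3 / 4 :: real)) ^ 2"
      by (intro power_mono exp_lower_Taylor_quadratic) auto
    also have "\<dots> = exp (3 / 2)"
      by (simp add: exp_of_nat_mult[symmetric])
    finally show ?thesis
      by (simp add: power2_eq_square)
  qed
  hence "4 ^ n * exp (- (2 * real n)) \<le> exp (3 / 2) ^ n * exp (- (2 * real n))" for n
    by (intro mult_right_mono power_mono) auto
  also have "exp (3 / 2) ^ n * exp (- (2 * real n)) = exp (- (real n / 2))" for n
    by (simp add: exp_of_nat_mult[symmetric] exp_add[symmetric])
  finally have *: "4 ^ n * exp (- (2 * real n)) \<le> exp (- (real n / 2))" for n .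
  show "(\<lambda>n. 4 ^ n * exp (- (2 * real n))) \<longlonglongrightarrow> 0"
  proof (rule squeeze_0)
    show "(\<lambda>n::nat. exp (- (real n / 2))) \<longlonglongrightarrow> 0"
      by real_asymp
  qed (use * in auto)
qed

text \<open>The exponent of \<open>n\<close> is
  \<open>1 - 55 / 1000 - 95 / 100 = - 5 / 1000\<close>.\<close>

lemma lim_poor_large:
  "(\<lambda>n. rprob (Kn_edges n) (m0 n) (\<lambda>E. real n powr (95 / 100) \<le> real (card (poor0 n E)))) \<longlonglongrightarrow> 0"
proof (rule squeeze_0[OF rprob_nonneg])
  show "eventually (\<lambda>n. rprob (Kn_edges n) (m0 n) (\<lambda>E. real n powr (95 / 100) \<le> real (card (poor0 n E))) \<le>
      n * exp (- (55 / 1000) * ln n) / real n powr (95 / 100)) sequentially"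
    using ev_density ev_ln_pos ev_poor_weight
  proof eventually_elim
    case (elim n)
    have "rprob (Kn_edges n) (m0 n) (\<lambda>E. real n powr (95 / 100) \<le> real (card (poor0 n E))) \<le>
        n * poor_weight n (q0 n) (d0 n) (m0 n) z0 100 / real n powr (95 / 100)"
      by (rule rprob_poor_large) (use elim z0 two_q0_le in auto)
    also have "\<dots> \<le> n * exp (- (55 / 1000) * ln n) / real n powr (95 / 100)"
      using elim by (intro divide_right_mono mult_left_mono) auto
    finally show ?case .
  qed
  show "(\<lambda>n. n * exp (- (55 / 1000) * ln n) / real n powr (95 / 100)) \<longlonglongrightarrow> 0"
    by real_asymp
qed

text \<open>The exponent of \<open>n\<close> is
  \<open>1 - 985 / 1000 - 3 / 100 = - 15 / 1000\<close>.\<close>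

lemma lim_isolated_large:
  "(\<lambda>n. rprob (Kn_edges n) (m0 n) (\<lambda>E. real n powr (3 / 100) \<le> real (card (isolated n E)))) \<longlonglongrightarrow> 0"
proof (rule squeeze_0[OF rprob_nonneg])
  show "eventually (\<lambda>n. rprob (Kn_edges n) (m0 n) (\<lambda>E. real n powr (3 / 100) \<le> real (card (isolated n E))) \<le>
      n * exp (- (985 / 1000 * (ln n / n) * (real n - 1))) / real n powr (3 / 100)) sequentially"
    using ev_density ev_ln_pos
  proof eventually_elim
    case (elim n)
    have "real (m0 n - 100) / (n choose 2) \<le> dens n"
      by (intro divide_right_mono) auto
    hence "985 / 1000 * (ln n / n) * (real n - 1) \<le> dens n * real (n - 1)"
      using elim by (intro mult_mono) auto
    hence "exp (- (dens n * real (n - 1))) \<le> exp (- (985 / 1000 * (ln n / n) * (real n - 1)))"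
      by simp
    hence "n * exp (- (dens n * real (n - 1))) / real n powr (3 / 100) \<le>
        n * exp (- (985 / 1000 * (ln n / n) * (real n - 1))) / real n powr (3 / 100)"
      by (intro divide_right_mono mult_left_mono) auto
    moreover have "rprob (Kn_edges n) (m0 n) (\<lambda>E. real n powr (3 / 100) \<le> real (card (isolated n E))) \<le>
        n * exp (- (dens n * real (n - 1))) / real n powr (3 / 100)"
      by (rule rprob_isolated_large) (use elim in auto)
    ultimately show ?case
      by linarith
  qed
  show "(\<lambda>n. n * exp (- (985 / 1000 * (ln n / n) * (real n - 1))) / real n powr (3 / 100)) \<longlonglongrightarrow> 0"
    by real_asymp
qed

text \<open>Reciprocal of \<open>1 + x \<le> exp x\<close> at
  \<open>x = y / (1 - y)\<close>.\<close>

lemma exp_le_one_minus: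
  fixes y :: real
  assumes "0 \<le> y" "y < 1"
  shows "exp (- (y / (1 - y))) \<le> 1 - y"
proof -
  have "1 / (1 - y) = 1 + y / (1 - y)"
    using assms by (simp add: field_simps)
  also have "\<dots> \<le> exp (y / (1 - y))"
    by (rule exp_ge_add_one_self)
  finally show ?thesis
    using assms by (simp add: exp_minus field_simps)
qed

text \<open>\<open>991 / 1000\<close> lies between the density factor \<open>99 / 100\<close> of the
  first round and 1. The expected number of isolated vertices is thus at least about
  \<open>n powr (9 / 1000)\<close>, and the correlation term tends to 0.\<close>

lemma lim_no_isolated:
  "(\<lambda>n. rprob (Kn_edges n) (m0 n) (\<lambda>E. isolated n E = {})) \<longlonglongrightarrow> 0"
proof (rule squeeze_0[OF rprob_nonneg])
  let ?y = "\<lambda>n::nat. 991 / 1000 * (ln n / n)"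
  let ?g = "\<lambda>n::nat. 1 / (n * exp (- (n * (?y n / (1 - ?y n))))) + (1 / (1 - ?y n) - 1)"
  have e1: "eventually (\<lambda>n::nat. 99 / 200 * n * ln n / (real n * (real n - 1) / 2 - 2 * real n) \<le> ?y n) sequentially"
    by real_asymp
  have e2: "eventually (\<lambda>n::nat. ?y n < 1) sequentially"
    by real_asymp
  have e3: "eventually (\<lambda>n::nat. 0 < real n * (real n - 1) / 2 - 2 * real n) sequentially"
    by real_asymp
  show "eventually (\<lambda>n. rprob (Kn_edges n) (m0 n) (\<lambda>E. isolated n E = {}) \<le> ?g n) sequentially"
    using ev_density ev_ln_pos e1 e2 e3
  proof eventually_elim
    case (elim n)
    let ?N = "n choose 2"
    have y0: "0 \<le> ?y n"
      using elim(2) by simp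
    have x: "real (m0 n) / real M \<le> ?y n" if "real n * (real n - 1) / 2 - 2 * real n \<le> real M" for M
    proof -
      have "real (m0 n) / real M \<le> 99 / 200 * n * ln n / (real n * (real n - 1) / 2 - 2 * real n)"
        using elim that by (intro frac_le) auto
      thus ?thesis
        using elim(3) by linarith
    qed
    have N: "real ?N = real n * (real n - 1) / 2"
      by (rule real_choose_two)
    have inv: "1 / (1 - r) \<le> 1 / (1 - y)" if "r \<le> y" "y < 1" for r y :: real
      using that by (intro divide_left_mono mult_pos_pos) auto
    have x1: "real (m0 n) / real (?N - (n - 1)) \<le> ?y n"
      using elim(2) N elim(1) by (intro x) linarith
    have x2: "real (m0 n) / real (?N - 2 * (n - 1) + 1) \<le> ?y n"
      using elim(2) N elim(1) by (intro x) linarith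
    have "exp (- (n * (?y n / (1 - ?y n)))) = exp (- (?y n / (1 - ?y n))) ^ n"
      by (simp add: exp_of_nat_mult[symmetric])
    also have "\<dots> \<le> (1 - ?y n) ^ n"
      using y0 elim(4) by (intro power_mono exp_le_one_minus) auto
    also have "\<dots> \<le> (1 - ?y n) ^ (n - 1)"
      using y0 elim(4) by (intro power_decreasing) auto
    also have "\<dots> \<le> (1 - real (m0 n) / real (?N - (n - 1))) ^ (n - 1)"
      using x1 elim(4) by (intro power_mono) auto
    finally have "1 / (n * (1 - real (m0 n) / real (?N - (n - 1))) ^ (n - 1)) \<le>
        1 / (n * exp (- (n * (?y n / (1 - ?y n)))))"
      using elim(2) by (intro divide_left_mono mult_left_mono mult_pos_pos)
        (auto intro: less_le_trans[OF exp_gt_zero])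
    moreover have "1 / (1 - real (m0 n) / real (?N - 2 * (n - 1) + 1)) \<le> 1 / (1 - ?y n)"
      by (rule inv[OF x2 elim(4)])
    moreover have "rprob (Kn_edges n) (m0 n) (\<lambda>E. isolated n E = {}) \<le>
        1 / (n * (1 - real (m0 n) / real (?N - (n - 1))) ^ (n - 1)) +
        (1 / (1 - real (m0 n) / real (?N - 2 * (n - 1) + 1)) - 1)"
      by (rule rprob_no_isolated) (use elim in auto)
    ultimately show ?case
      by linarith
  qed
  show "?g \<longlonglongrightarrow> 0"
    by real_asymp
qed

text \<open>Adds to the deterministic hypotheses the sizes on which the second round relies, and the
  isolated vertices that keep the connectivity time beyond \<open>m0 n\<close>.\<close>

definition typical :: "nat \<Rightarrow> nat set set \<Rightarrow> bool" where
  "typical n E \<longleftrightarrow>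
     typical_graph n (q0 n) (d0 n) 24 (h0 n) (y0 n) (y1 n) (b0 n) (g0 n) (a0 n) (k0 n) E \<and>
     isolated n E \<noteq> {} \<and> real (card (isolated n E)) < real n powr (3 / 100) \<and>
     real (card (poor0 n E)) < real n powr (95 / 100)"

lemma lim_atypical: "(\<lambda>n. rprob (Kn_edges n) (m0 n) (\<lambda>E. \<not> typical n E)) \<longlonglongrightarrow> 0"
proof (rule squeeze_0[OF rprob_nonneg])
  let ?P1 = "\<lambda>n. many_poor_nbrs n (q0 n) (d0 n) 25"
  let ?P2 = "\<lambda>n. many_poor_paths n (q0 n) (d0 n) 25"
  let ?P3 = "\<lambda>n. low_next_to_poor n (q0 n) (d0 n) 24"
  let ?P4 = "\<lambda>n. dense_pair n (h0 n) (y0 n)"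
  let ?P5 = "\<lambda>n. separated_pair n (y1 n) (b0 n)"
  let ?P6 = "\<lambda>n E. real n powr (95 / 100) \<le> real (card (poor0 n E))"
  let ?P7 = "\<lambda>n E. real n powr (3 / 100) \<le> real (card (isolated n E))"
  let ?P8 = "\<lambda>n E. isolated n E = {}"
  let ?r = "\<lambda>P n. rprob (Kn_edges n) (m0 n) (P n)"
  have disj: "rprob (Kn_edges n) m (\<lambda>E. P E \<or> Q E) \<le> rprob (Kn_edges n) m P + s"
    if "rprob (Kn_edges n) m Q \<le> s" for n m P Q s
    using rprob_disj[OF finite_Kn_edges[of n], of m P Q] that by linarith
  show "eventually (\<lambda>n. ?r (\<lambda>n E. \<not> typical n E) n \<le>
      ?r ?P1 n + (?r ?P2 n + (?r ?P3 n + (?r ?P4 n + (?r ?P5 n + (?r ?P6 n + (?r ?P7 n + ?r ?P8 n)))))))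
      sequentially"
    using ev_numeric
  proof eventually_elim
    case (elim n)
    have "?r (\<lambda>n E. \<not> typical n E) n \<le> ?r (\<lambda>n E. ?P1 n E \<or> ?P2 n E \<or> ?P3 n E \<or> ?P4 n E \<or> ?P5 n E \<or>
        ?P6 n E \<or> ?P7 n E \<or> ?P8 n E) n"
    proof (rule rprob_mono[OF finite_Kn_edges], rule ccontr)
      fix E assume E: "E \<subseteq> Kn_edges n" and atyp: "\<not> typical n E"
        and "\<not> (?P1 n E \<or> ?P2 n E \<or> ?P3 n E \<or> ?P4 n E \<or> ?P5 n E \<or> ?P6 n E \<or> ?P7 n E \<or> ?P8 n E)"
      hence P1: "\<not> ?P1 n E" and P2: "\<not> ?P2 n E" and P3: "\<not> ?P3 n E" and P4: "\<not> ?P4 n E"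
        and P5: "\<not> ?P5 n E" and P6: "\<not> ?P6 n E" and P7: "\<not> ?P7 n E" and P8: "\<not> ?P8 n E"
        by simp_all
      have S: "real (card (poor0 n E)) < real n powr (95 / 100)"
        using P6 by simp
      have num: "card (poor0 n E) < q0 n \<and> 2 * h0 n + 2 * 24 \<le> d0 n \<and> 24 \<le> h0 n \<and> 1 \<le> g0 n \<and>
         4 * g0 n \<le> h0 n \<and> g0 n * a0 n \<le> y0 n \<and> 1 \<le> a0 n \<and> y1 n \<le> g0 n * a0 n \<and>
         b0 n \<le> g0 n * a0 n \<and> n < g0 n ^ k0 n \<and> y0 n \<le> n \<and> 6 * y1 n \<le> y0 n \<and>
         7 * q0 n + 2 * card (poor0 n E) + b0 n \<le> n \<and>
         2 * (2 * k0 n + 6) * (a0 n + b0 n) \<le> y0 n \<and> 4 * (2 * (2 * k0 n + 6)) \<le> h0 n"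
        using elim S by (elim allE[of _ "card (poor0 n E)"] impE) auto
      have "typical_graph n (q0 n) (d0 n) 24 (h0 n) (y0 n) (y1 n) (b0 n) (g0 n) (a0 n) (k0 n) E"
      proof unfold_locales
        fix v assume "v < n"
        hence "\<not> 25 \<le> card (nbrs E v \<inter> poor0 n E)"
          using P1 by blast
        thus "card (nbrs E v \<inter> poor0 n E) \<le> 24"
          by simp
      next
        fix v Y and f :: "nat \<Rightarrow> nat"
        assume "v < n" "v \<notin> poor0 n E" "Y \<subseteq> nbrs E v" "Y \<inter> poor0 n E = {}" "inj_on f Y"
          "\<And>y. y \<in> Y \<Longrightarrow> f y \<in> nbrs E y \<inter> poor0 n E"
        hence "\<not> 25 \<le> card Y"
          using P2 by blast
        thus "card Y \<le> 24"
          by simp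
      next
        fix s assume "s < n" "card (nbrs E s) \<le> 24"
        thus "nbrs E s \<inter> poor0 n E = {}"
          using P3 by blast
      next
        fix A Y m assume *: "A \<subseteq> {..<n}" "Y \<subseteq> {..<n}" "A \<noteq> {}" "1 \<le> m" "4 * m \<le> h0 n"
          "card Y = m * card A" "m * card A \<le> y0 n"
        show "\<exists>x\<in>A. card (nbrs E x \<inter> Y) < 2 * h0 n"
        proof (rule ccontr)
          assume "\<not> ?thesis"
          hence "\<forall>x\<in>A. 2 * h0 n \<le> card (nbrs E x \<inter> Y)"
            by (simp add: not_less)
          hence "?P4 n E"
            using * by (intro exI[of _ A] exI[of _ Y] exI[of _ m] conjI)
          thus False
            by (rule notE[OF P4])
        qed
      next
        fix X Y assume *: "X \<subseteq> {..<n}" "Y \<subseteq> {..<n}" "X \<inter> Y = {}" "y1 n \<le> card X" "b0 n \<le> card Y"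
        show "\<exists>x\<in>X. \<exists>y\<in>Y. {x, y} \<in> E"
        proof (rule ccontr)
          assume "\<not> ?thesis"
          hence "\<forall>x\<in>X. \<forall>y\<in>Y. {x, y} \<notin> E"
            by blast
          hence "?P5 n E"
            using * by (intro exI[of _ X] exI[of _ Y] conjI)
          thus False
            by (rule notE[OF P5])
        qed
      qed (use E num in simp_all)
      hence "typical n E"
        using S P7 P8 unfolding typical_def by simp
      thus False
        using atyp by simp
    qed
    also have "\<dots> \<le> ?r ?P1 n + (?r ?P2 n + (?r ?P3 n + (?r ?P4 n + (?r ?P5 n + (?r ?P6 n + (?r ?P7 n + ?r ?P8 n))))))"
      by (intro disj rprob_disj finite_Kn_edges)
    finally show ?case .
  qed
  show "(\<lambda>n. ?r ?P1 n + (?r ?P2 n + (?r ?P3 n + (?r ?P4 n + (?r ?P5 n + (?r ?P6 n + (?r ?P7 n + ?r ?P8 n))))))) \<longlonglongrightarrow> 0"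
    by (intro tendsto_add_zero lim_poor_nbrs lim_poor_second_nbrs lim_low_next_to_poor lim_dense_pair
        lim_no_edges_between lim_poor_large lim_isolated_large lim_no_isolated)
qed

text \<open>The exponents of \<open>n\<close> in the three terms are \<open>3 / 100 - 2\<close>,
  \<open>3 / 100 + 95 / 100 - 1\<close> and \<open>1 + 6 / 100 - 2\<close>; the middle one is the
  tight one. \<open>(ln n)\<^sup>2\<close> bounds the square of the star size.\<close>

definition second_bound :: "nat \<Rightarrow> real" where
  "second_bound n = real n powr (3 / 100) * exp (- (2 * (ln n / n) * (real n - 1))) +
     (real n powr (3 / 100) * real n powr (95 / 100) * (5 * (ln n / n)) +
      (n * (ln n)\<^sup>2 * (real n powr (3 / 100))\<^sup>2) * (5 * (ln n / n))\<^sup>2)"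

lemma lim_second_bound: "second_bound \<longlonglongrightarrow> 0"
  unfolding second_bound_def by real_asymp

text \<open>The second round has density between \<open>2 * ln n / n\<close> and
  \<open>5 * ln n / n\<close>: the lower bound serves the exponential term, the upper one the two
  others.\<close>

lemma ev_second_round:
  "eventually (\<lambda>n. \<forall>E. E \<subseteq> Kn_edges n \<longrightarrow> card E = m0 n \<longrightarrow> typical n E \<longrightarrow>
     rprob (Kn_edges n - E) (j0 n) (\<lambda>E'. isolated n (E \<union> E') \<noteq> {} \<or>
       (\<exists>E2. E \<subseteq> E2 \<and> E2 \<subseteq> E \<union> E' \<and> isolated n E2 = {} \<and> \<not> collects_all n E2)) \<le> second_bound n)
   sequentially"
proof -
  have e1: "eventually (\<lambda>n::nat. (n * ln n + 1) / (real n * (real n - 1) / 2 - 99 / 200 * n * ln n) \<le> 5 * (ln n / n)) sequentially"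
    by real_asymp
  have e2: "eventually (\<lambda>n::nat. 0 < real n * (real n - 1) / 2 - 99 / 200 * n * ln n) sequentially"
    by real_asymp
  have e3: "eventually (\<lambda>n::nat. 0 < real n powr (95 / 100)) sequentially"
    by real_asymp
  show ?thesis
    using e1 e2 e3 ev_density ev_ln_pos ev_numeric
  proof (eventually_elim, intro allI impI)
    fix n E
    assume A: "(n * ln n + 1) / (real n * (real n - 1) / 2 - 99 / 200 * n * ln n) \<le> 5 * (ln n / n)"
      "0 < real n * (real n - 1) / 2 - 99 / 200 * n * ln n"
      and B: "real (m0 n) / (n choose 2) \<le> ln n / n \<and>
       985 / 1000 * (ln n / n) \<le> real (m0 n - 100) / (n choose 2) \<and>
       real (m0 n) \<le> 99 / 200 * n * ln n \<and> m0 n + 2 * (n - 1) < n choose 2 \<and> m0 n + j0 n \<le> n choose 2"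
      and L: "1 \<le> ln (real n) \<and> 10 \<le> n \<and> 1 \<le> ln (ln (real n))"
    assume tE: "E \<subseteq> Kn_edges n" "card E = m0 n" "typical n E"
    interpret typical_graph n "q0 n" "d0 n" 24 "h0 n" "y0 n" "y1 n" "b0 n" "g0 n" "a0 n" "k0 n" E
      using tE(3) unfolding typical_def by simp
    let ?K' = "Kn_edges n - E"
    define p where "p = real (j0 n) / real (card ?K')"
    have cK: "card ?K' = (n choose 2) - m0 n"
      using tE(1,2) finite_subset[OF tE(1) finite_Kn_edges]
      by (simp add: card_Diff_subset card_Kn_edges)
    hence rK: "real (card ?K') = real n * (real n - 1) / 2 - real (m0 n)"
      using B by (simp add: real_choose_two of_nat_diff)
    have j: "n * ln n \<le> real (j0 n)" "real (j0 n) \<le> n * ln n + 1"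
      using nat_ceiling_bounds[of "n * ln n"] L unfolding j0_def by auto
    have pos: "0 < real (card ?K')"
      using rK A(2) B by linarith
    have p_le: "p \<le> 5 * (ln n / n)"
    proof -
      have "p \<le> (n * ln n + 1) / (real n * (real n - 1) / 2 - 99 / 200 * n * ln n)"
        unfolding p_def using j(2) A(2) B L rK by (intro frac_le) auto
      thus ?thesis
        using A(1) by linarith
    qed
    have p_ge: "2 * (ln n / n) \<le> p"
    proof -
      have "real (card ?K') \<le> real n * real n / 2"
        using rK by (simp add: field_simps)
      hence "n * ln n / (real n * real n / 2) \<le> p"
        unfolding p_def using j(1) pos L by (intro frac_le) auto
      thus ?thesis
        using L by (simp add: field_simps)
    qed
    have I: "real (card (isolated n E)) \<le> real n powr (3 / 100)"
      and S: "real (card (poor0 n E)) \<le> real n powr (95 / 100)"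
      using tE(3) unfolding typical_def by auto
    \<comment> \<open>By \<open>num\<close> even eight times the star size is at most about
      \<open>h0 n\<close>, so \<open>ln n\<close> is a generous bound.\<close>
    have k: "real (2 * k0 n + 6) \<le> ln n"
    proof -
      have "real (h0 n) \<le> ln n / 400"
        using nat_floor_bounds(1)[of "ln n / 400"] L unfolding h0_def by auto
      moreover have "real (4 * (2 * (2 * k0 n + 6))) \<le> real (h0 n)"
        using num(15) by (simp only: of_nat_le_iff)
      ultimately show ?thesis
        using L by simp
    qed
    have q: "real (q0 n) \<le> n"
      unfolding q0_def by simp
    have "0 \<le> p"
      unfolding p_def by simp
    have "2 * (ln n / n) * (real n - 1) \<le> p * real (n - 1)"
      using p_ge L \<open>0 \<le> p\<close> by (intro mult_mono) auto
    hence ex: "exp (- (p * real (n - 1))) \<le> exp (- (2 * (ln n / n) * (real n - 1)))"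
      by simp
    have "rprob ?K' (j0 n) (\<lambda>E'. isolated n (E \<union> E') \<noteq> {} \<or>
        (\<exists>E2. E \<subseteq> E2 \<and> E2 \<subseteq> E \<union> E' \<and> isolated n E2 = {} \<and> \<not> collects_all n E2)) \<le>
        card (isolated n E) * exp (- (p * real (n - 1))) +
        (real (card (isolated n E)) * real (card (poor0 n E)) * p +
         (real (q0 n) * (real (2 * k0 n + 6))\<^sup>2 * (real (card (isolated n E)))\<^sup>2) * p\<^sup>2)"
      unfolding p_def using B cK by (intro second_round) auto
    also have "\<dots> \<le> second_bound n"
      unfolding second_bound_def using I S k q p_le ex \<open>0 \<le> p\<close> L
      by (intro add_mono mult_mono power_mono mult_nonneg_nonneg) auto
    finally show "rprob ?K' (j0 n) (\<lambda>E'. isolated n (E \<union> E') \<noteq> {} \<or>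
        (\<exists>E2. E \<subseteq> E2 \<and> E2 \<subseteq> E \<union> E' \<and> isolated n E2 = {} \<and> \<not> collects_all n E2)) \<le> second_bound n" .
  qed
qed

lemma order_prob_compl:
  assumes "finite K"
  shows "order_prob K (\<lambda>\<sigma>. \<not> P \<sigma>) = 1 - order_prob K P"
  unfolding order_prob_def
  using measure_pmf.prob_compl[of "{\<sigma>. P \<sigma>}" "pmf_of_set (permutations_of_set K)"]
  by (simp add: Compl_eq_Diff_UNIV[symmetric] Collect_neg_eq)

lemma order_prob_le_add:
  assumes "finite K" "\<And>\<sigma>. \<sigma> \<in> permutations_of_set K \<Longrightarrow> P \<sigma> \<Longrightarrow> Q \<sigma> \<or> R \<sigma>"
  shows "order_prob K P \<le> order_prob K Q + order_prob K R"
proof -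
  have "{\<sigma> \<in> permutations_of_set K. P \<sigma>} \<subseteq>
      {\<sigma> \<in> permutations_of_set K. Q \<sigma>} \<union> {\<sigma> \<in> permutations_of_set K. R \<sigma>}"
    using assms(2) by blast
  hence "card {\<sigma> \<in> permutations_of_set K. P \<sigma>} \<le>
      card {\<sigma> \<in> permutations_of_set K. Q \<sigma>} + card {\<sigma> \<in> permutations_of_set K. R \<sigma>}"
    by (intro order.trans[OF card_mono card_Un_le]) auto
  hence "real (card {\<sigma> \<in> permutations_of_set K. P \<sigma>}) \<le>
      real (card {\<sigma> \<in> permutations_of_set K. Q \<sigma>}) + real (card {\<sigma> \<in> permutations_of_set K. R \<sigma>})"
    by (simp flip: of_nat_add)
  thus ?thesis
    unfolding order_prob_altdef[OF assms(1)] add_divide_distrib[symmetric]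
    by (rule divide_right_mono) simp
qed

theorem theorem1p1:
  shows "(\<lambda>n. measure_pmf.prob (pmf_of_set (edge_orderings n))
            {\<sigma>. frac_acq_number n (process_graph \<sigma> (connectivity_time n \<sigma>)) = 1 \<and>
                 unit_acq_number n (process_graph \<sigma> (connectivity_time n \<sigma>)) = 1})
         \<longlonglongrightarrow> 1"
proof -
  define good_order where "good_order n \<sigma> \<longleftrightarrow>
    frac_acq_number n (process_graph \<sigma> (connectivity_time n \<sigma>)) = 1 \<and>
    unit_acq_number n (process_graph \<sigma> (connectivity_time n \<sigma>)) = 1" for n \<sigma>
  let ?Q = "\<lambda>n E E'. isolated n (E \<union> E') \<noteq> {} \<or>
       (\<exists>E2. E \<subseteq> E2 \<and> E2 \<subseteq> E \<union> E' \<and> isolated n E2 = {} \<and> \<not> collects_all n E2)"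
  have "(\<lambda>n. order_prob (Kn_edges n) (\<lambda>\<sigma>. \<not> good_order n \<sigma>)) \<longlonglongrightarrow> 0"
  proof (rule squeeze_0)
    show "0 \<le> order_prob (Kn_edges n) (\<lambda>\<sigma>. \<not> good_order n \<sigma>)" for n
      unfolding order_prob_def by simp
    show "eventually (\<lambda>n. order_prob (Kn_edges n) (\<lambda>\<sigma>. \<not> good_order n \<sigma>) \<le>
        rprob (Kn_edges n) (m0 n) (\<lambda>E. \<not> typical n E) + second_bound n) sequentially"
      using ev_second_round ev_density ev_ln_pos
    proof eventually_elim
      case (elim n)
      let ?K = "Kn_edges n" and ?E = "\<lambda>\<sigma>. set (take (m0 n) \<sigma>)"
        and ?E' = "\<lambda>\<sigma>. set (take (j0 n) (drop (m0 n) \<sigma>))"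
      \<comment> \<open>A bad ordering has an atypical first round, or a typical one followed by a
        failing second round; the latter is bounded conditionally on the first round.\<close>
      have "order_prob ?K (\<lambda>\<sigma>. \<not> good_order n \<sigma>) \<le>
          order_prob ?K (\<lambda>\<sigma>. \<not> typical n (?E \<sigma>)) +
          order_prob ?K (\<lambda>\<sigma>. typical n (?E \<sigma>) \<and> ?Q n (?E \<sigma>) (?E' \<sigma>))"
      proof (rule order_prob_le_add[OF finite_Kn_edges], rule ccontr)
        fix \<sigma> assume \<sigma>: "\<sigma> \<in> permutations_of_set ?K" "\<not> good_order n \<sigma>"
          "\<not> (\<not> typical n (?E \<sigma>) \<or> typical n (?E \<sigma>) \<and> ?Q n (?E \<sigma>) (?E' \<sigma>))"
        hence "typical n (?E \<sigma>)" "\<not> ?Q n (?E \<sigma>) (?E' \<sigma>)"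
          by simp_all
        hence "good_order n \<sigma>"
          unfolding good_order_def using \<sigma>(1) elim(3)
          by (intro acq_at_connectivity_time[of \<sigma> n "m0 n" "j0 n"])
            (auto simp: edge_orderings_def typical_def)
        thus False
          using \<sigma>(2) by simp
      qed
      also have "order_prob ?K (\<lambda>\<sigma>. \<not> typical n (?E \<sigma>)) = rprob ?K (m0 n) (\<lambda>E. \<not> typical n E)"
        using elim(2) by (intro order_prob_prefix finite_Kn_edges) (simp add: card_Kn_edges)
      also have "order_prob ?K (\<lambda>\<sigma>. typical n (?E \<sigma>) \<and> ?Q n (?E \<sigma>) (?E' \<sigma>)) \<le> second_bound n"
      proof (rule order_prob_two_prefixes[OF finite_Kn_edges])
        show "m0 n + j0 n \<le> card ?K"
          using elim(2) by (simp add: card_Kn_edges)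
        show "0 \<le> second_bound n"
          using elim(3) unfolding second_bound_def by auto
        show "rprob (?K - E) (j0 n) (?Q n E) \<le> second_bound n"
          if "E \<subseteq> ?K" "card E = m0 n" "typical n E" for E
          using elim(1) that by (elim allE[of _ E] impE)
      qed
      finally show ?case
        by simp
    qed
    show "(\<lambda>n. rprob (Kn_edges n) (m0 n) (\<lambda>E. \<not> typical n E) + second_bound n) \<longlonglongrightarrow> 0"
      by (intro tendsto_add_zero lim_atypical lim_second_bound)
  qed
  hence "(\<lambda>n. 1 - order_prob (Kn_edges n) (good_order n)) \<longlonglongrightarrow> 0"
    by (simp add: order_prob_compl finite_Kn_edges)
  hence "(\<lambda>n. order_prob (Kn_edges n) (good_order n)) \<longlonglongrightarrow> 1"
    using tendsto_diff[OF tendsto_const[of 1]] by fastforce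
  thus ?thesis
    unfolding order_prob_def edge_orderings_def good_order_def .
qed

end
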